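(* Let $K$ be a compact Lie group acting linearly and isometrically on a finite-dimensional Euclidean space $V$, let $G_0=K\ltimes V$ be the motion group, let $A\subset V$ be a linear subspace of dimension $n$, and let $M_K=\{k\in K: kv=v \text{ for all } v\in A\}$. For any element $x\in M_K$, the higher orbital integral $\tau_{A,x}$ is a cyclic cocycle of degree $n$ on the convolution algebra $C_c^\infty(G_0)$; that is, for all $f_0,\dots,f_{n+1}\in C_c^\infty(G_0)$, $$\sum_{i=0}^n(-1)^i\tau_{A,x}(f_0,\dots,f_i*f_{i+1},\dots,f_{n+1})+(-1)^{n+1}\tau_{A,x}(f_{n+1}*f_0,f_1,\dots,f_n)=0$$ and $$\tau_{A,x}(f_n,f_0,\dots,f_{n-1})=(-1)^n\tau_{A,x}(f_0,f_1,\dots,f_n).$$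
   Context: The product on $G_0=K\ltimes V$ is $(k_0,v_0)(k_1,v_1)=(k_0k_1,k_1^{-1}v_0+v_1)$, where $kv$ denotes the action of $k\in K$ on $v\in V$. The Haar measure is $dk\,dv$ with $dk$ a Haar measure on $K$ and $dv$ the Euclidean (Lebesgue) measure on $V$. Convolution is $(f*f')(g)=\int_{G_0}f(g')f'(g'^{-1}g)\,dg'$. $A^\perp$ is the orthogonal complement of $A$ in $V$ (with Euclidean measure). Fix an orthonormal basis $e_1,\dots,e_n$ of $A$ and set $H_j(v)=\langle v,e_j\rangle$ for $v\in V$. $Z_{M_K}(x)$ is the centralizer of $x$ in $M_K$, and $M_K/Z_{M_K}(x)$ carries an $M_K$-invariant measure. Notation: $\prod_{l=i}^mk_l=k_ik_{i+1}\cdots k_m$, equal to the identity $e$ if $i=m+1$. $S_n$ is the permutation group on $n$ letters. For $\sigma\in S_n$ and $f_0,\dots,f_n\in C_c^\infty(G_0)$ define $$\tau_{A,x,\sigma}(f_0,\dots,f_n)=\int_{h\in M_K/Z_{M_K}(x)}\int_{u\in K}\int_{w\in A^\perp}\int_{(k_1,v_1),\dots,(k_n,v_n)\in G_0}$$ $$f_0\Big(uhxh^{-1}u^{-1}k_n^{-1}\cdots k_1^{-1},\;k_1\cdots k_nuw-\sum_{j=1}^n\Big(\prod_{l=1}^jk_l\Big)v_j\Big)\prod_{j=1}^nf_j(k_j,v_j)\prod_{j=1}^nH_{\sigma(j)}\Big(u^{-1}\Big(\prod_{l=j+1}^nk_l\Big)^{-1}v_j\Big),$$ and the higher orbital integral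 $$\tau_{A,x}(f_0,\dots,f_n)=\sum_{\sigma\in S_n}\mathrm{sign}(\sigma)\,\tau_{A,x,\sigma}(f_0,\dots,f_n).$$ *)

theory Defs
  imports
    "HOL-Analysis.Analysis"
    "HOL-Algebra.Left_Coset"
    "HOL-Combinatorics.Permutations"
begin

section \<open>Smooth manifolds and Lie groups\<close>

text \<open>
  Finite-dimensional spaces are modelled by types together with the predicate \<open>finite_dim\<close>, and not
  by the class \<open>euclidean_space\<close>, because that class excludes dimension 0: finite groups
  (0-dimensional Lie groups) and the zero vector space are to be included.
\<close>

definition finite_dim :: "'a::real_vector itself \<Rightarrow> bool" where
  "finite_dim _ \<longleftrightarrow> (\<exists>B::'a set. finite B \<and> span B = UNIV)"

text \<open>Both notions are meant for open sets \<open>S\<close> of a finite-dimensional space.\<close>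

primrec Ck_on :: "nat \<Rightarrow> ('a::real_normed_vector \<Rightarrow> 'b::real_normed_vector) \<Rightarrow> 'a set \<Rightarrow> bool" where
  "Ck_on 0 f S \<longleftrightarrow> continuous_on S f"
| "Ck_on (Suc k) f S \<longleftrightarrow>
     (\<forall>x\<in>S. f differentiable (at x)) \<and> (\<forall>v. Ck_on k (\<lambda>x. frechet_derivative f (at x) v) S)"

definition smooth_on :: "('a::real_normed_vector \<Rightarrow> 'b::real_normed_vector) \<Rightarrow> 'a set \<Rightarrow> bool" where
  "smooth_on f S \<longleftrightarrow> (\<forall>k. Ck_on k f S)"

type_synonym ('a, 'm) chart = "'a set \<times> ('a \<Rightarrow> 'm)"

definition smooth_atlas :: "('a::{t2_space,second_countable_topology}, 'm::real_normed_vector) chart set \<Rightarrow> bool" where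
  "smooth_atlas \<A> \<longleftrightarrow>
     finite_dim TYPE('m) \<and>
     (\<Union>(U, \<phi>)\<in>\<A>. U) = UNIV \<and>
     (\<forall>(U, \<phi>)\<in>\<A>. open U \<and> open (\<phi> ` U) \<and> homeomorphism U (\<phi> ` U) \<phi> (inv_into U \<phi>)) \<and>
     (\<forall>(U, \<phi>)\<in>\<A>. \<forall>(W, \<psi>)\<in>\<A>. smooth_on (\<psi> \<circ> inv_into U \<phi>) (\<phi> ` (U \<inter> W)))"

definition prod_atlas :: "('a, 'm) chart set \<Rightarrow> ('b, 'n) chart set \<Rightarrow> ('a \<times> 'b, 'm \<times> 'n) chart set" where
  "prod_atlas \<A> \<B> = {(U \<times> W, map_prod \<phi> \<psi>) | U \<phi> W \<psi>. (U, \<phi>) \<in> \<A> \<and> (W, \<psi>) \<in> \<B>}"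

definition vec_atlas :: "('v, 'v) chart set" where
  "vec_atlas = {(UNIV, \<lambda>v. v)}"

definition smooth_map ::
  "('a::topological_space, 'm::real_normed_vector) chart set \<Rightarrow>
   ('b::topological_space, 'n::real_normed_vector) chart set \<Rightarrow> ('a \<Rightarrow> 'b) \<Rightarrow> bool" where
  "smooth_map \<A> \<B> f \<longleftrightarrow>
     continuous_on UNIV f \<and>
     (\<forall>(U, \<phi>)\<in>\<A>. \<forall>(W, \<psi>)\<in>\<B>. smooth_on (\<psi> \<circ> f \<circ> inv_into U \<phi>) (\<phi> ` (U \<inter> f -` W)))"

definition lie_group ::
  "'k::{t2_space,second_countable_topology} monoid \<Rightarrow> ('k, 'm::real_normed_vector) chart set \<Rightarrow> bool" where
  "lie_group K \<A> \<longleftrightarrow>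
     group K \<and> carrier K = UNIV \<and> smooth_atlas \<A> \<and>
     smooth_map (prod_atlas \<A> \<A>) \<A> (\<lambda>(k, l). k \<otimes>\<^bsub>K\<^esub> l) \<and>
     smooth_map \<A> \<A> (\<lambda>k. inv\<^bsub>K\<^esub> k)"

definition compact_lie_group ::
  "'k::{t2_space,second_countable_topology} monoid \<Rightarrow> ('k, 'm::real_normed_vector) chart set \<Rightarrow> bool" where
  "compact_lie_group K \<A> \<longleftrightarrow> lie_group K \<A> \<and> compact (UNIV :: 'k set)"

definition linear_isometric_action ::
  "'k::{t2_space,second_countable_topology} monoid \<Rightarrow> ('k, 'm::real_normed_vector) chart set \<Rightarrow>
   ('k \<Rightarrow> 'v::real_inner \<Rightarrow> 'v) \<Rightarrow> bool" where
  "linear_isometric_action K \<A> act \<longleftrightarrow>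
     (\<forall>v. act \<one>\<^bsub>K\<^esub> v = v) \<and>
     (\<forall>k l v. act (k \<otimes>\<^bsub>K\<^esub> l) v = act k (act l v)) \<and>
     (\<forall>k. linear (act k)) \<and>
     (\<forall>k v. norm (act k v) = norm v) \<and>
     smooth_map (prod_atlas \<A> vec_atlas) vec_atlas (\<lambda>(k, v). act k v)"

section \<open>Invariant measures\<close>

text \<open>
  Regularity need not be required below: the spaces are locally compact and second countable
  (for the quotient: compact metrizable), so every Borel measure that is finite on compact sets
  is regular.
\<close>

definition haar_measure ::
  "'k::{t2_space,second_countable_topology} monoid \<Rightarrow> 'k measure \<Rightarrow> bool" where
  "haar_measure K \<mu> \<longleftrightarrow>
     sets \<mu> = sets borel \<and>
     (\<forall>C. compact C \<longrightarrow> emeasure \<mu> C < \<infinity>) \<and>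
     emeasure \<mu> UNIV \<noteq> 0 \<and>
     (\<forall>k. \<forall>B\<in>sets borel. emeasure \<mu> ((\<lambda>l. k \<otimes>\<^bsub>K\<^esub> l) ` B) = emeasure \<mu> B)"

text \<open>
  The Lebesgue measure of a finite-dimensional subspace \<open>S\<close>, as a Borel measure on the ambient
  space concentrated on \<open>S\<close>: the image of the Lebesgue measure on the coordinates with respect to an
  orthonormal basis of \<open>S\<close> (of which it does not depend). It is \<open>lborel\<close> if \<open>S\<close> is a whole
  Euclidean space, and the unit point mass at 0 if \<open>S = {0}\<close>.
\<close>

definition euclidean_measure :: "'v::real_inner set \<Rightarrow> 'v measure" where
  "euclidean_measure S =
     (let B = (SOME B. finite B \<and> pairwise orthogonal B \<and> (\<forall>b\<in>B. norm b = 1) \<and> span B = S)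
      in distr (\<Pi>\<^sub>M b\<in>B. (lborel :: real measure)) borel (\<lambda>c. \<Sum>b\<in>B. c b *\<^sub>R b))"

text \<open>The Borel sets, for the quotient topology, of the space of left cosets of \<open>Z\<close> in \<open>M\<close>.\<close>

definition quotient_borel :: "'k::topological_space monoid \<Rightarrow> 'k set \<Rightarrow> 'k set \<Rightarrow> 'k set measure" where
  "quotient_borel K M Z =
     sigma (lcosets\<^bsub>K\<lparr>carrier := M\<rparr>\<^esub> Z)
       {U. U \<subseteq> lcosets\<^bsub>K\<lparr>carrier := M\<rparr>\<^esub> Z \<and>
           openin (top_of_set M) {h \<in> M. h <#\<^bsub>K\<^esub> Z \<in> U}}"

text \<open>Finiteness on compact sets is finiteness here, as \<open>M\<close> (hence the quotient) will be compact.\<close>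

definition invariant_quotient_measure ::
  "'k::topological_space monoid \<Rightarrow> 'k set \<Rightarrow> 'k set \<Rightarrow> 'k set measure \<Rightarrow> bool" where
  "invariant_quotient_measure K M Z \<nu> \<longleftrightarrow>
     space \<nu> = space (quotient_borel K M Z) \<and>
     sets \<nu> = sets (quotient_borel K M Z) \<and>
     emeasure \<nu> (space \<nu>) < \<infinity> \<and> emeasure \<nu> (space \<nu>) \<noteq> 0 \<and>
     (\<forall>m\<in>M. \<forall>B\<in>sets \<nu>. emeasure \<nu> ((\<lambda>C. m <#\<^bsub>K\<^esub> C) ` B) = emeasure \<nu> B)"

section \<open>The motion group and its convolution algebra\<close>

definition motion_group :: "'k monoid \<Rightarrow> ('k \<Rightarrow> 'v::ab_group_add \<Rightarrow> 'v) \<Rightarrow> ('k \<times> 'v) monoid" where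
  "motion_group K act =
     \<lparr>carrier = carrier K \<times> UNIV,
      mult = (\<lambda>(k0, v0) (k1, v1). (k0 \<otimes>\<^bsub>K\<^esub> k1, act (inv\<^bsub>K\<^esub> k1) v0 + v1)),
      one = (\<one>\<^bsub>K\<^esub>, 0)\<rparr>"

definition motion_measure :: "'k measure \<Rightarrow> ('k \<times> 'v::real_inner) measure" where
  "motion_measure \<mu> = \<mu> \<Otimes>\<^sub>M euclidean_measure UNIV"

definition convolution ::
  "'k monoid \<Rightarrow> ('k \<Rightarrow> 'v::real_inner \<Rightarrow> 'v) \<Rightarrow> 'k measure \<Rightarrow>
   ('k \<times> 'v \<Rightarrow> complex) \<Rightarrow> ('k \<times> 'v \<Rightarrow> complex) \<Rightarrow> ('k \<times> 'v \<Rightarrow> complex)" where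
  "convolution K act \<mu> f f' =
     (\<lambda>g. \<integral>g'. f g' * f' (inv\<^bsub>motion_group K act\<^esub> g' \<otimes>\<^bsub>motion_group K act\<^esub> g) \<partial>motion_measure \<mu>)"

definition Cc_smooth ::
  "('k::topological_space, 'm::real_normed_vector) chart set \<Rightarrow> ('k \<times> 'v::real_inner \<Rightarrow> complex) set" where
  "Cc_smooth \<A> =
     {f. smooth_map (prod_atlas \<A> vec_atlas) vec_atlas f \<and> compact (closure {g. f g \<noteq> 0})}"

section \<open>Higher orbital integrals\<close>

definition fixing_subgroup :: "'k monoid \<Rightarrow> ('k \<Rightarrow> 'v \<Rightarrow> 'v) \<Rightarrow> 'v set \<Rightarrow> 'k set" where
  "fixing_subgroup K act A = {k \<in> carrier K. \<forall>v\<in>A. act k v = v}"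

definition centralizer_in :: "'k monoid \<Rightarrow> 'k set \<Rightarrow> 'k \<Rightarrow> 'k set" where
  "centralizer_in K M x = {z \<in> M. z \<otimes>\<^bsub>K\<^esub> x = x \<otimes>\<^bsub>K\<^esub> z}"

text \<open>
  The common value of \<open>h x h\<^sup>-\<^sup>1\<close> for all \<open>h\<close> in a left coset \<open>C\<close> of the centralizer of \<open>x\<close>.
\<close>

definition coset_conj :: "'k monoid \<Rightarrow> 'k \<Rightarrow> 'k set \<Rightarrow> 'k" where
  "coset_conj K x C = the_elem ((\<lambda>h. h \<otimes>\<^bsub>K\<^esub> x \<otimes>\<^bsub>K\<^esub> inv\<^bsub>K\<^esub> h) ` C)"

text \<open>\<open>k i \<otimes> k (i + 1) \<otimes> \<dots> \<otimes> k m\<close>, which is \<open>\<one>\<close> if \<open>i = m + 1\<close>.\<close>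

definition segment_prod :: "'k monoid \<Rightarrow> (nat \<Rightarrow> 'k) \<Rightarrow> nat \<Rightarrow> nat \<Rightarrow> 'k" where
  "segment_prod K k i m = foldr (\<lambda>l p. k l \<otimes>\<^bsub>K\<^esub> p) [i..<Suc m] \<one>\<^bsub>K\<^esub>"

text \<open>
  Here \<open>e 1, \<dots>, e n\<close> is the orthonormal basis of \<open>A\<close>, so that \<open>H\<^sub>j v = v \<bullet> e j\<close>; the point
  \<open>(k\<^sub>j, v\<^sub>j)\<close> of the motion group is \<open>(fst (g j), snd (g j))\<close>; the arguments are
  \<open>f 0, \<dots>, f n\<close>, the values of \<open>f\<close> beyond \<open>n\<close> being irrelevant.
\<close>

definition higher_orbital_perm ::
  "'k monoid \<Rightarrow> ('k \<Rightarrow> 'v::real_inner \<Rightarrow> 'v) \<Rightarrow> 'k measure \<Rightarrow> 'k set measure \<Rightarrow>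
   'v set \<Rightarrow> (nat \<Rightarrow> 'v) \<Rightarrow> nat \<Rightarrow> 'k \<Rightarrow> (nat \<Rightarrow> nat) \<Rightarrow>
   (nat \<Rightarrow> 'k \<times> 'v \<Rightarrow> complex) \<Rightarrow> complex" where
  "higher_orbital_perm K act \<mu> \<nu> A e n x \<sigma> f =
     (\<integral>C. (\<integral>u. (\<integral>w. (\<integral>g.
        (let P = segment_prod K (\<lambda>l. fst (g l))
         in f 0 (u \<otimes>\<^bsub>K\<^esub> coset_conj K x C \<otimes>\<^bsub>K\<^esub> inv\<^bsub>K\<^esub> u \<otimes>\<^bsub>K\<^esub> inv\<^bsub>K\<^esub> (P 1 n),
                 act (P 1 n \<otimes>\<^bsub>K\<^esub> u) w - (\<Sum>j=1..n. act (P 1 j) (snd (g j))))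
            * (\<Prod>j=1..n. f j (g j))
            * complex_of_real
                (\<Prod>j=1..n. act (inv\<^bsub>K\<^esub> u) (act (inv\<^bsub>K\<^esub> (P (j + 1) n)) (snd (g j))) \<bullet> e (\<sigma> j)))
      \<partial>(\<Pi>\<^sub>M j\<in>{1..n}. motion_measure \<mu>)) \<partial>euclidean_measure (A\<^sup>\<bottom>)) \<partial>\<mu>) \<partial>\<nu>)"

definition higher_orbital_integral ::
  "'k monoid \<Rightarrow> ('k \<Rightarrow> 'v::real_inner \<Rightarrow> 'v) \<Rightarrow> 'k measure \<Rightarrow> 'k set measure \<Rightarrow>
   'v set \<Rightarrow> (nat \<Rightarrow> 'v) \<Rightarrow> nat \<Rightarrow> 'k \<Rightarrow> (nat \<Rightarrow> 'k \<times> 'v \<Rightarrow> complex) \<Rightarrow> complex" where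
  "higher_orbital_integral K act \<mu> \<nu> A e n x f =
     (\<Sum>\<sigma> | \<sigma> permutes {1..n}. of_int (sign \<sigma>) * higher_orbital_perm K act \<mu> \<nu> A e n x \<sigma> f)"

text \<open>The tuple \<open>(f\<^sub>0, \<dots>, f\<^sub>i * f\<^sub>i\<^sub>+\<^sub>1, \<dots>)\<close> for a product \<open>*\<close>.\<close>

definition merge_at :: "('a \<Rightarrow> 'a \<Rightarrow> 'a) \<Rightarrow> nat \<Rightarrow> (nat \<Rightarrow> 'a) \<Rightarrow> nat \<Rightarrow> 'a" where
  "merge_at mul i f j = (if j < i then f j else if j = i then mul (f i) (f (i + 1)) else f (j + 1))"

end

theory Submission
  imports Defs
begin

text \<open>
  Write \<open>y = (u m u\<^sup>-\<^sup>1, u w)\<close> with \<open>m = h x h\<^sup>-\<^sup>1\<close>. In the motion group the argument of \<open>f\<^sub>0\<close> is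
  \<open>y (g\<^sub>1 \<cdots> g\<^sub>n)\<^sup>-\<^sup>1\<close>, so \<open>\<tau>\<close> integrates \<open>f\<^sub>0 \<otimes> \<cdots> \<otimes> f\<^sub>n\<close> over the tuples with
  \<open>g\<^sub>0 g\<^sub>1 \<cdots> g\<^sub>n = y\<close>, where \<open>y\<close> runs over an orbit. If \<open>s\<^sub>j\<close> is the vector component of
  \<open>g\<^sub>j \<cdots> g\<^sub>n\<close>, the factor antisymmetrized over \<open>\<sigma>\<close> is the determinant of the \<open>A\<close>-coordinates of the
  columns \<open>c\<^sub>j = u\<^sup>-\<^sup>1 (s\<^sub>j - s\<^sub>j\<^sub>+\<^sub>1)\<close>.

  Hochschild identity: unfolding the convolution \<open>f\<^sub>i * f\<^sub>i\<^sub>+\<^sub>1\<close> and substituting turns each of the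
  \<open>n + 2\<close> terms into an integral of the same product \<open>f\<^sub>0(y (g\<^sub>1 \<cdots> g\<^sub>n\<^sub>+\<^sub>1)\<^sup>-\<^sup>1) f\<^sub>1(g\<^sub>1) \<cdots>
  f\<^sub>n\<^sub>+\<^sub>1(g\<^sub>n\<^sub>+\<^sub>1)\<close>, against a determinant in which the columns \<open>c\<^sub>i\<close> and \<open>c\<^sub>i\<^sub>+\<^sub>1\<close> are added
  (for \<open>i = 0\<close> and for the last term, an outer column is dropped). By multilinearity the alternating sum of these
  determinants telescopes to 0 (\<open>leibniz_det_merge_columns\<close>).

  Cyclicity: in the cyclic rotation of the tuple, the product \<open>y\<close> is conjugated by \<open>z = y (g\<^sub>1 \<cdots> g\<^sub>n)\<^sup>-\<^sup>1\<close>.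
  Because \<open>m\<close> is isometric and fixes \<open>A\<close>, conjugation acts on the orbit coordinates \<open>(u, w)\<close> by a
  translation in \<open>K\<close> and a translation of \<open>w\<close> by \<open>t - m\<^sup>-\<^sup>1 t \<in> A\<^sup>\<bottom>\<close>, so it preserves the measure
  (\<open>nn_integral_conj_point\<close>); the same fact gives the last Hochschild term. The columns rotate too, except
  that the new one is \<open>- (c\<^sub>1 + \<cdots> + c\<^sub>n)\<close> in \<open>A\<close>-coordinates, because \<open>w \<in> A\<^sup>\<bottom>\<close>; the determinant
  is therefore multiplied by \<open>(-1)\<^sup>n\<close> (\<open>leibniz_det_cycle\<close>).

  Besides translations, the substitutions invert group elements, so the motion group has to be unimodular
  (\<open>nn_integral_inv_G\<close>). The functions \<open>f\<^sub>j\<close> are bounded and Borel measurable with bounded support; these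
  properties survive convolution and make every integral absolutely convergent
  (\<open>integrable_orbit_integrand\<close>), which justifies Fubini and the exchange of sums and integrals.
\<close>

section \<open>Determinants over permutations\<close>

text \<open>
  The determinant in the form in which the definition of the higher orbital integral produces it: the first
  argument of \<open>a\<close> is the column, the second the row, and both run over \<open>{1..n}\<close> for a number \<open>n\<close> rather
  than over an index type.
\<close>
definition leibniz_det :: "nat \<Rightarrow> (nat \<Rightarrow> nat \<Rightarrow> real) \<Rightarrow> real" where
  "leibniz_det n a = (\<Sum>\<sigma> | \<sigma> permutes {1..n}. of_int (sign \<sigma>) * (\<Prod>j=1..n. a j (\<sigma> j)))"

lemma leibniz_det_cong:
  assumes "\<And>j i. j \<in> {1..n} \<Longrightarrow> i \<in> {1..n} \<Longrightarrow> a j i = b j i"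
  shows "leibniz_det n a = leibniz_det n b"
  unfolding leibniz_det_def
proof (intro sum.cong refl, goal_cases)
  case (1 \<sigma>)
  then have "\<sigma> j \<in> {1..n}" if "j \<in> {1..n}" for j
    using that permutes_in_image by fastforce
  then show ?case
    using assms by (auto intro!: prod.cong arg_cong2[where f="(*)"])
qed

lemma leibniz_det_linear:
  assumes "k \<in> {1..n}"
  shows "leibniz_det n (a(k := \<lambda>i. \<Sum>l\<in>S. t l * b l i)) = (\<Sum>l\<in>S. t l * leibniz_det n (a(k := b l)))"
proof -
  have *: "(\<Prod>j=1..n. (a(k := v)) j (\<sigma> j)) = v (\<sigma> k) * (\<Prod>j\<in>{1..n}-{k}. a j (\<sigma> j))" for v \<sigma>
  proof -
    have "(\<Prod>j=1..n. (a(k := v)) j (\<sigma> j)) = (a(k := v)) k (\<sigma> k) * (\<Prod>j\<in>{1..n}-{k}. (a(k := v)) j (\<sigma> j))"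
      using assms by (intro prod.remove) auto
    also have "(\<Prod>j\<in>{1..n}-{k}. (a(k := v)) j (\<sigma> j)) = (\<Prod>j\<in>{1..n}-{k}. a j (\<sigma> j))"
      by (intro prod.cong) auto
    finally show ?thesis by simp
  qed
  show ?thesis
    unfolding leibniz_det_def *
    by (simp add: sum_distrib_left sum_distrib_right mult_ac) (rule sum.swap)
qed

lemma leibniz_det_add:
  assumes "k \<in> {1..n}"
  shows "leibniz_det n (a(k := \<lambda>i. b i + c i)) = leibniz_det n (a(k := b)) + leibniz_det n (a(k := c))"
  using leibniz_det_linear[OF assms, where S="{False,True}" and t="\<lambda>_. 1" and b="\<lambda>l. if l then c else b"]
  by simp

lemma leibniz_det_permute:
  assumes \<pi>: "\<pi> permutes {1..n}"
  shows "leibniz_det n (\<lambda>j. a (\<pi> j)) = of_int (sign \<pi>) * leibniz_det n a"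
proof -
  have "leibniz_det n (\<lambda>j. a (\<pi> j)) =
      (\<Sum>\<sigma> | \<sigma> permutes {1..n}. of_int (sign (\<sigma> \<circ> \<pi>)) * (\<Prod>j=1..n. a (\<pi> j) ((\<sigma> \<circ> \<pi>) j)))"
    unfolding leibniz_det_def by (rule sum_permutations_compose_right[OF \<pi>])
  also have "\<dots> = (\<Sum>\<sigma> | \<sigma> permutes {1..n}. of_int (sign \<pi>) * (of_int (sign \<sigma>) * (\<Prod>j=1..n. a j (\<sigma> j))))"
  proof (intro sum.cong refl, goal_cases)
    case (1 \<sigma>)
    have "(\<Prod>j=1..n. a (\<pi> j) ((\<sigma> \<circ> \<pi>) j)) = (\<Prod>j\<in>\<pi> ` {1..n}. a j (\<sigma> j))"
      by (subst prod.reindex) (auto simp: permutes_inj_on[OF \<pi>])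
    then show ?case
      using 1 sign_compose[of \<sigma> \<pi>] permutes_imp_permutation[OF _ \<pi>]
      by (simp add: permutes_image[OF \<pi>] permutes_imp_permutation[of "{1..n}" \<sigma>] mult_ac del: atLeastAtMost_iff One_nat_def)
  qed
  finally show ?thesis by (simp add: leibniz_det_def sum_distrib_left)
qed

lemma leibniz_det_equal_columns:
  assumes "j \<in> {1..n}" "k \<in> {1..n}" "j \<noteq> k" "a j = a k"
  shows "leibniz_det n a = 0"
proof -
  have "(\<lambda>i. a (Transposition.transpose j k i)) = a"
    using assms by (auto simp: Transposition.transpose_def)
  with leibniz_det_permute[OF permutes_swap_id[OF assms(1,2)], of a] show ?thesis
    using assms by (simp add: sign_swap_id)
qed

text \<open>
  The cycle \<open>1 \<mapsto> 2 \<mapsto> \<cdots> \<mapsto> n + 1 \<mapsto> 1\<close> arises from the next shorter one by composing with the transposition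
  of 1 and \<open>n + 1\<close>, which gives its sign by induction.
\<close>
lemma cycle_with_sign:
  "\<exists>\<pi>. \<pi> permutes {1..Suc n} \<and> sign \<pi> = (-1) ^ n \<and> (\<forall>j\<in>{1..n}. \<pi> j = Suc j) \<and> \<pi> (Suc n) = 1"
proof (induction n)
  case 0
  show ?case by (intro exI[of _ id]) (auto simp: permutes_id)
next
  case (Suc n)
  then obtain \<pi> where \<pi>: "\<pi> permutes {1..Suc n}" "sign \<pi> = (-1) ^ n" "\<forall>j\<in>{1..n}. \<pi> j = Suc j" "\<pi> (Suc n) = 1"
    by blast
  let ?t = "Transposition.transpose 1 (Suc (Suc n))"
  have \<pi>': "\<pi> permutes {1..Suc (Suc n)}"
    by (rule permutes_subset[OF \<pi>(1)]) auto
  have "?t \<circ> \<pi> permutes {1..Suc (Suc n)}"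
    by (intro permutes_compose[OF \<pi>'] permutes_swap_id) auto
  moreover have "sign (?t \<circ> \<pi>) = (-1) ^ Suc n"
    using \<pi>(2) permutes_imp_permutation[OF _ \<pi>(1)]
    by (subst sign_compose) (auto simp: sign_swap_id permutation_swap_id)
  moreover have "(?t \<circ> \<pi>) (Suc (Suc n)) = 1"
    using permutes_not_in[OF \<pi>(1), of "Suc (Suc n)"] by simp
  moreover have "(?t \<circ> \<pi>) j = Suc j" if "j \<in> {1..Suc n}" for j
    using that \<pi>(3,4) by (cases "j = Suc n") (auto simp: Transposition.transpose_def)
  ultimately show ?case
    by blast
qed

text \<open>
  Expand the last column: all its summands except \<open>- a 1\<close> repeat another column of \<open>b\<close>. What remains is
  \<open>-1\<close> times the determinant of the cyclically shifted columns, whose sign is \<open>(-1) ^ n\<close>.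
\<close>
lemma leibniz_det_cycle:
  assumes "b (Suc n) = (\<lambda>i. - (\<Sum>l=1..Suc n. a l i))"
    and "\<And>j. j \<in> {1..n} \<Longrightarrow> b j = a (Suc j)"
  shows "leibniz_det (Suc n) b = (-1) ^ Suc n * leibniz_det (Suc n) a"
proof -
  obtain \<pi> where \<pi>: "\<pi> permutes {1..Suc n}" "sign \<pi> = (-1) ^ n" "\<forall>j\<in>{1..n}. \<pi> j = Suc j" "\<pi> (Suc n) = 1"
    using cycle_with_sign by blast
  have "leibniz_det (Suc n) b = leibniz_det (Suc n) ((\<lambda>j. a (Suc j))(Suc n := \<lambda>i. \<Sum>l\<in>{1..Suc n}. (-1) * a l i))"
    using assms by (intro leibniz_det_cong) (auto simp: sum_negf)
  also have "\<dots> = (\<Sum>l\<in>{1..Suc n}. (-1) * leibniz_det (Suc n) ((\<lambda>j. a (Suc j))(Suc n := a l)))"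
    by (rule leibniz_det_linear) auto
  also have "\<dots> = (\<Sum>l\<in>{1}. (-1) * leibniz_det (Suc n) ((\<lambda>j. a (Suc j))(Suc n := a l)))"
  proof (intro sum.mono_neutral_right ballI, goal_cases)
    case (3 l)
    then have "leibniz_det (Suc n) ((\<lambda>j. a (Suc j))(Suc n := a l)) = 0"
      by (intro leibniz_det_equal_columns[of "l-1" _ "Suc n"]) auto
    then show ?case by simp
  qed auto
  also have "\<dots> = - leibniz_det (Suc n) ((\<lambda>j. a (Suc j))(Suc n := a 1))" by simp
  also have "leibniz_det (Suc n) ((\<lambda>j. a (Suc j))(Suc n := a 1)) = leibniz_det (Suc n) (\<lambda>j. a (\<pi> j))"
    using \<pi> by (intro leibniz_det_cong) (auto simp: le_Suc_eq)
  finally show ?thesis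
    by (simp add: leibniz_det_permute[OF \<pi>(1)] \<pi>(2))
qed

lemma alternating_telescope:
  fixes E :: "nat \<Rightarrow> 'a::comm_ring_1"
  shows "(\<Sum>i=0..n. (-1) ^ i * (E i + E (Suc i))) = E 0 + (-1) ^ n * E (Suc n)"
  by (induction n) (simp_all add: algebra_simps)

text \<open>
  The determinantal part of the Hochschild identity. If \<open>E i\<close> is the determinant of the columns
  \<open>b 1, \<dots>, b (n + 1)\<close> without \<open>b i\<close>, the determinant with the columns \<open>i\<close> and \<open>i + 1\<close> added is
  \<open>E i + E (i + 1)\<close>, so the sum telescopes; for \<open>i = 0\<close> the first column is dropped.
\<close>
lemma leibniz_det_merge_columns:
  "(\<Sum>i=0..n. (-1) ^ i * leibniz_det n (\<lambda>j. if j < i then b j else if j = i then (\<lambda>r. b i r + b (Suc i) r) else b (Suc j)))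
    + (-1) ^ Suc n * leibniz_det n b = 0"
proof -
  \<comment> \<open>The value \<open>E 0 = 0\<close> covers the term \<open>i = 0\<close>, whose determinant is \<open>E 1\<close> alone.\<close>
  define E where "E i = (if i = 0 then 0 else leibniz_det n (\<lambda>j. if j < i then b j else b (Suc j)))" for i
  have "leibniz_det n (\<lambda>j. if j < i then b j else if j = i then (\<lambda>r. b i r + b (Suc i) r) else b (Suc j)) = E i + E (Suc i)"
    if "i \<le> n" for i
  proof (cases "i = 0")
    case True
    then show ?thesis by (auto simp: E_def intro!: leibniz_det_cong)
  next
    case False
    with that have i: "i \<in> {1..n}" by auto
    let ?c = "\<lambda>j. if j < i then b j else b (Suc j)"
    have "leibniz_det n (\<lambda>j. if j < i then b j else if j = i then (\<lambda>r. b i r + b (Suc i) r) else b (Suc j)) =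
      leibniz_det n (?c(i := \<lambda>r. b i r + b (Suc i) r))"
      by (intro leibniz_det_cong) auto
    also have "\<dots> = leibniz_det n (?c(i := b i)) + leibniz_det n (?c(i := b (Suc i)))"
      by (rule leibniz_det_add[OF i])
    also have "leibniz_det n (?c(i := b i)) = E (Suc i)"
      unfolding E_def using False by (auto intro!: leibniz_det_cong)
    also have "leibniz_det n (?c(i := b (Suc i))) = E i"
      unfolding E_def using False by (auto intro!: leibniz_det_cong)
    finally show ?thesis by simp
  qed
  moreover have "leibniz_det n b = E (Suc n)"
    unfolding E_def by (auto intro!: leibniz_det_cong)
  ultimately show ?thesis
    using alternating_telescope[of E n] by (simp add: E_def)
qed

section \<open>Lebesgue measure on subspaces\<close>

lemma orthonormal_basis_exists:
  fixes S :: "'v::real_inner set"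
  assumes "finite_dim TYPE('v)" and S: "subspace S"
  shows "\<exists>B. finite B \<and> pairwise orthogonal B \<and> (\<forall>b\<in>B. norm b = 1) \<and> span B = S"
proof -
  obtain T :: "'v set" where T: "finite T" "span T = UNIV"
    using assms(1) unfolding finite_dim_def by blast
  obtain B0 where B0: "B0 \<subseteq> S" "independent B0" "S \<subseteq> span B0"
    using maximal_independent_subset by blast
  have "finite B0"
    using independent_span_bound[OF T(1) B0(2)] T(2) by auto
  then obtain C where C: "finite C" "span C = span B0" "pairwise orthogonal C"
    using basis_orthogonal by blast
  have spanC: "span C = S"
    using B0 C(2) S by (metis span_minimal subset_antisym)
  define B where "B = (\<lambda>c. c /\<^sub>R norm c) ` (C - {0})"
  have "span B = span (C - {0})"
    unfolding B_def
  proof (rule span_image_scale)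
    show "finite (C - {0})" using C by simp
    show "\<And>c. c \<in> C - {0} \<Longrightarrow> inverse (norm c) \<noteq> 0" by simp
  qed
  then have "span B = S" using spanC by (simp add: span_delete_0)
  moreover have "pairwise orthogonal B"
    using C(3) unfolding B_def pairwise_def
    by (auto simp: orthogonal_def)
  ultimately show ?thesis
    using C(1) by (intro exI[of _ B]) (auto simp: B_def)
qed

lemma euclidean_measure_eq:
  fixes S :: "'v::real_inner set"
  assumes "finite_dim TYPE('v)" and "subspace S"
  obtains B where "finite B" "pairwise orthogonal B" "\<forall>b\<in>B. norm b = 1" "span B = S"
    "euclidean_measure S = distr (\<Pi>\<^sub>M b\<in>B. (lborel :: real measure)) borel (\<lambda>c. \<Sum>b\<in>B. c b *\<^sub>R b)"
proof -
  let ?Q = "\<lambda>B. finite B \<and> pairwise orthogonal B \<and> (\<forall>b\<in>B. norm b = 1) \<and> span B = S"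
  have "?Q (SOME B. ?Q B)"
    by (rule someI_ex[OF orthonormal_basis_exists[OF assms]])
  then show ?thesis
    by (intro that[of "SOME B. ?Q B"]) (auto simp: euclidean_measure_def Let_def)
qed

lemma sets_euclidean_measure [simp, measurable_cong]: "sets (euclidean_measure S) = sets borel"
  by (simp add: euclidean_measure_def Let_def)

lemma space_euclidean_measure [simp]: "space (euclidean_measure S) = UNIV"
  by (simp add: euclidean_measure_def Let_def)

lemma linear_combination_measurable [measurable]:
  fixes B :: "'v::{real_inner,second_countable_topology} set"
  shows "(\<lambda>c. \<Sum>b\<in>B. c b *\<^sub>R b) \<in> (\<Pi>\<^sub>M b\<in>B. (lborel :: real measure)) \<rightarrow>\<^sub>M borel"
  by measurable

lemma norm_coeff_le:
  fixes B :: "'v::real_inner set"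
  assumes "finite B" "pairwise orthogonal B" "\<forall>b\<in>B. norm b = 1" "b \<in> B"
  shows "\<bar>c b\<bar> \<le> norm (\<Sum>b\<in>B. c b *\<^sub>R b)"
proof -
  have "(\<Sum>b\<in>B. c b *\<^sub>R b) \<bullet> b = (\<Sum>a\<in>B. if a = b then c b else 0)"
    unfolding inner_sum_left
  proof (intro sum.cong refl)
    fix a assume "a \<in> B"
    then show "(c a *\<^sub>R a) \<bullet> b = (if a = b then c b else 0)"
      using assms(2-4) by (auto simp: pairwise_def orthogonal_def norm_eq_1)
  qed
  then have "(\<Sum>b\<in>B. c b *\<^sub>R b) \<bullet> b = c b" using assms by simp
  then show ?thesis
    using Cauchy_Schwarz_ineq2[of "\<Sum>b\<in>B. c b *\<^sub>R b" b] assms by simp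
qed

interpretation lborel_product: product_sigma_finite "\<lambda>_::'a. lborel :: real measure"
  by standard

lemma PiM_lborel_translate:
  fixes t :: "'a \<Rightarrow> real"
  assumes "finite B"
  shows "distr (\<Pi>\<^sub>M b\<in>B. lborel) (\<Pi>\<^sub>M b\<in>B. lborel) (\<lambda>c. \<lambda>b\<in>B. c b + t b) = (\<Pi>\<^sub>M b\<in>B. lborel)"
proof (rule lborel_product.PiM_eqI[OF assms])
  fix A :: "'a \<Rightarrow> real set"
  assume A: "\<And>i. i \<in> B \<Longrightarrow> A i \<in> sets lborel"
  have A': "(\<lambda>r. r + t b) -` A b \<in> sets lborel" if "b \<in> B" for b
  proof -
    have "(\<lambda>r. r + t b) \<in> borel_measurable borel" by measurable
    from measurable_sets[OF this, of "A b"] A[OF that] show ?thesis by simp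
  qed
  have eq: "(\<lambda>c. \<lambda>b\<in>B. c b + t b) -` Pi\<^sub>E B A \<inter> space (\<Pi>\<^sub>M b\<in>B. lborel) = Pi\<^sub>E B (\<lambda>b. (\<lambda>r. r + t b) -` A b)"
    by (auto simp: space_PiM PiE_def Pi_def)
  have "emeasure (distr (\<Pi>\<^sub>M b\<in>B. lborel) (\<Pi>\<^sub>M b\<in>B. lborel) (\<lambda>c. \<lambda>b\<in>B. c b + t b)) (Pi\<^sub>E B A)
      = emeasure (\<Pi>\<^sub>M b\<in>B. lborel) (Pi\<^sub>E B (\<lambda>b. (\<lambda>r. r + t b) -` A b))"
    using A assms by (subst emeasure_distr) (simp_all add: eq sets_PiM_I_finite)
  also have "\<dots> = (\<Prod>b\<in>B. emeasure lborel ((\<lambda>r. r + t b) -` A b))"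
    using A' assms by (intro lborel_product.emeasure_PiM)
  also have "\<dots> = (\<Prod>b\<in>B. emeasure lborel (A b))"
  proof (intro prod.cong refl)
    fix b assume "b \<in> B"
    then have "emeasure (distr lborel borel ((+) (t b))) (A b) = emeasure lborel ((+) (t b) -` A b \<inter> space lborel)"
      using A by (intro emeasure_distr) auto
    then show "emeasure lborel ((\<lambda>r. r + t b) -` A b) = emeasure lborel (A b)"
      by (simp add: lborel_distr_plus add.commute[of _ "t b"] vimage_def)
  qed
  finally show "emeasure (distr (\<Pi>\<^sub>M b\<in>B. lborel) (\<Pi>\<^sub>M b\<in>B. lborel) (\<lambda>c. \<lambda>b\<in>B. c b + t b)) (Pi\<^sub>E B A) = (\<Prod>b\<in>B. emeasure lborel (A b))" .
qed auto

lemma euclidean_measure_translate: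
  fixes S :: "'v::{real_inner,second_countable_topology} set"
  assumes "finite_dim TYPE('v)" "subspace S" "t \<in> S"
  shows "distr (euclidean_measure S) borel (\<lambda>v. v + t) = euclidean_measure S"
proof -
  obtain B where B: "finite B" "pairwise orthogonal B" "\<forall>b\<in>B. norm b = 1" "span B = S"
    "euclidean_measure S = distr (\<Pi>\<^sub>M b\<in>B. (lborel :: real measure)) borel (\<lambda>c. \<Sum>b\<in>B. c b *\<^sub>R b)"
    by (rule euclidean_measure_eq[OF assms(1,2)]) (rule that)
  obtain r where r: "t = (\<Sum>b\<in>B. r b *\<^sub>R b)"
    using assms(3) B(1,4) span_finite[of B] by auto
  let ?P = "\<Pi>\<^sub>M b\<in>B. (lborel :: real measure)"
  let ?L = "\<lambda>c. \<Sum>b\<in>B. c b *\<^sub>R b"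
  have "distr (euclidean_measure S) borel (\<lambda>v. v + t) = distr ?P borel (\<lambda>c. ?L c + t)"
    unfolding B(5) by (subst distr_distr) (auto simp: o_def)
  also have "(\<lambda>c. ?L c + t) = ?L \<circ> (\<lambda>c. \<lambda>b\<in>B. c b + r b)"
    by (auto simp: r scaleR_add_left sum.distrib)
  also have "distr ?P borel (?L \<circ> (\<lambda>c. \<lambda>b\<in>B. c b + r b)) = distr (distr ?P ?P (\<lambda>c. \<lambda>b\<in>B. c b + r b)) borel ?L"
    by (rule distr_distr[symmetric]) measurable
  also have "\<dots> = euclidean_measure S"
    by (simp only: PiM_lborel_translate[OF B(1)] B(5))
  finally show ?thesis .
qed

lemma nn_integral_euclidean_translate:
  fixes S :: "'v::{real_inner,second_countable_topology} set"
  assumes "finite_dim TYPE('v)" "subspace S" "t \<in> S" and [measurable]: "F \<in> borel_measurable borel"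
  shows "(\<integral>\<^sup>+v. F (v + t) \<partial>euclidean_measure S) = (\<integral>\<^sup>+v. F v \<partial>euclidean_measure S)"
  by (subst (2) euclidean_measure_translate[OF assms(1-3), symmetric])
    (simp add: nn_integral_distr)

lemma emeasure_euclidean_cball_finite:
  fixes S :: "'v::{real_inner,second_countable_topology} set"
  assumes "finite_dim TYPE('v)" "subspace S"
  shows "emeasure (euclidean_measure S) (cball 0 r) < \<infinity>"
proof -
  obtain B where B: "finite B" "pairwise orthogonal B" "\<forall>b\<in>B. norm b = 1" "span B = S"
    "euclidean_measure S = distr (\<Pi>\<^sub>M b\<in>B. (lborel :: real measure)) borel (\<lambda>c. \<Sum>b\<in>B. c b *\<^sub>R b)"
    by (rule euclidean_measure_eq[OF assms(1,2)]) (rule that)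
  let ?P = "\<Pi>\<^sub>M b\<in>B. (lborel :: real measure)"
  have "emeasure (euclidean_measure S) (cball 0 r) = emeasure ?P ((\<lambda>c. \<Sum>b\<in>B. c b *\<^sub>R b) -` cball 0 r \<inter> space ?P)"
    unfolding B(5) by (intro emeasure_distr) auto
  also have "\<dots> \<le> emeasure ?P (Pi\<^sub>E B (\<lambda>_. {-r..r}))"
  proof (rule emeasure_mono)
    show "(\<lambda>c. \<Sum>b\<in>B. c b *\<^sub>R b) -` cball 0 r \<inter> space ?P \<subseteq> Pi\<^sub>E B (\<lambda>_. {-r..r})"
    proof
      fix c assume "c \<in> (\<lambda>c. \<Sum>b\<in>B. c b *\<^sub>R b) -` cball 0 r \<inter> space ?P"
      then have c: "(\<Sum>b\<in>B. c b *\<^sub>R b) \<in> cball 0 r" "c \<in> space ?P" by auto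
      have "\<bar>c b\<bar> \<le> r" if "b \<in> B" for b
        using norm_coeff_le[OF B(1-3) that, of c] c(1) by (simp add: dist_norm)
      then have "c b \<in> {-r..r}" if "b \<in> B" for b
        using that by (force simp: abs_le_iff)
      with c(2) show "c \<in> Pi\<^sub>E B (\<lambda>_. {-r..r})"
        by (auto simp: space_PiM PiE_def)
    qed
  qed (use B(1) in \<open>auto intro!: sets_PiM_I_finite\<close>)
  also have "\<dots> = (\<Prod>b\<in>B. emeasure lborel {-r..r})"
    by (intro lborel_product.emeasure_PiM) (auto simp: B(1))
  also have "\<dots> < \<infinity>"
    by (simp add: emeasure_lborel_Icc_eq power_less_top_ennreal)
  finally show ?thesis .
qed

lemma sigma_finite_euclidean_measure:
  fixes S :: "'v::{real_inner,second_countable_topology} set"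
  assumes "finite_dim TYPE('v)" "subspace S"
  shows "sigma_finite_measure (euclidean_measure S)"
proof (rule sigma_finite_measure.intro, intro exI conjI)
  show "countable (range (\<lambda>k::nat. cball (0::'v) (real k)))" by auto
  show "\<Union> (range (\<lambda>k::nat. cball (0::'v) (real k))) = space (euclidean_measure S)"
    by (auto simp: real_arch_simple)
  show "\<forall>a\<in>range (\<lambda>k. cball 0 (real k)). emeasure (euclidean_measure S) a \<noteq> \<infinity>"
    using emeasure_euclidean_cball_finite[OF assms, THEN less_imp_neq] by auto
qed auto

text \<open>
  Provides the ball whose measure is cancelled in the proof that the motion group is unimodular.
\<close>
lemma emeasure_euclidean_cball_nonzero:
  fixes S :: "'v::{real_inner,second_countable_topology} set"
  assumes "finite_dim TYPE('v)" "subspace S"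
  obtains k :: nat where "emeasure (euclidean_measure S) (cball 0 (real k)) \<noteq> 0"
proof (rule ccontr)
  assume "\<not> thesis"
  then have "emeasure (euclidean_measure S) (cball 0 (real k)) = 0" for k
    using that by blast
  then have "(\<Union>k::nat. cball (0::'v) (real k)) \<in> null_sets (euclidean_measure S)"
    by (intro null_sets_UN) (auto simp: null_sets_def)
  also have "(\<Union>k::nat. cball (0::'v) (real k)) = UNIV"
    by (auto simp: real_arch_simple)
  finally have 0: "emeasure (euclidean_measure S) UNIV = 0"
    by (auto simp: null_sets_def)
  obtain B where B: "finite B" "pairwise orthogonal B" "\<forall>b\<in>B. norm b = 1" "span B = S"
    "euclidean_measure S = distr (\<Pi>\<^sub>M b\<in>B. (lborel :: real measure)) borel (\<lambda>c. \<Sum>b\<in>B. c b *\<^sub>R b)"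
    by (rule euclidean_measure_eq[OF assms(1,2)]) (rule that)
  have "emeasure (euclidean_measure S) UNIV = emeasure (\<Pi>\<^sub>M b\<in>B. (lborel :: real measure)) (Pi\<^sub>E B (\<lambda>_. UNIV))"
    unfolding B(5) by (subst emeasure_distr) (auto simp: space_PiM)
  also have "\<dots> = (\<Prod>b\<in>B. emeasure lborel (UNIV :: real set))"
    by (intro lborel_product.emeasure_PiM) (auto simp: B(1))
  also have "\<dots> \<noteq> 0" using B(1) by simp
  finally show False using 0 by simp
qed

lemma AE_euclidean_orthogonal:
  fixes S :: "'v::{real_inner,second_countable_topology} set"
  assumes "finite_dim TYPE('v)" "subspace S" "\<And>s. s \<in> S \<Longrightarrow> s \<bullet> a = 0"
  shows "AE v in euclidean_measure S. v \<bullet> a = 0"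
proof -
  obtain B where B: "finite B" "pairwise orthogonal B" "\<forall>b\<in>B. norm b = 1" "span B = S"
    "euclidean_measure S = distr (\<Pi>\<^sub>M b\<in>B. (lborel :: real measure)) borel (\<lambda>c. \<Sum>b\<in>B. c b *\<^sub>R b)"
    by (rule euclidean_measure_eq[OF assms(1,2)]) (rule that)
  have "(\<Sum>b\<in>B. c b *\<^sub>R b) \<bullet> a = 0" for c
    by (intro assms(3)) (simp add: B(4)[symmetric] span_sum span_scale span_base)
  then show ?thesis
    unfolding B(5) by (subst AE_distr_iff) auto
qed

section \<open>Inserting a coordinate into a product measure\<close>

definition insert_coord :: "nat \<Rightarrow> nat \<Rightarrow> (nat \<Rightarrow> 'a) \<Rightarrow> 'a \<Rightarrow> nat \<Rightarrow> 'a" where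
  "insert_coord n i g h = (\<lambda>j\<in>{1..Suc n}. if j < i then g j else if j = i then h else g (j - 1))"

lemma insert_coord_measurable [measurable (raw)]:
  assumes i: "i \<in> {1..Suc n}"
    and [measurable]: "g \<in> N \<rightarrow>\<^sub>M (\<Pi>\<^sub>M j\<in>{1..n}. M)" "h \<in> N \<rightarrow>\<^sub>M M"
  shows "(\<lambda>y. insert_coord n i (g y) (h y)) \<in> N \<rightarrow>\<^sub>M (\<Pi>\<^sub>M j\<in>{1..Suc n}. M)"
  unfolding insert_coord_def
proof (rule measurable_restrict)
  fix j assume j: "j \<in> {1..Suc n}"
  have comp: "(\<lambda>y. g y l) \<in> N \<rightarrow>\<^sub>M M" if "l \<in> {1..n}" for l
    using measurable_compose[OF assms(2) measurable_component_singleton[OF that]] .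
  consider "j < i" | "j = i" | "j > i" by linarith
  then show "(\<lambda>y. if j < i then g y j else if j = i then h y else g y (j - 1)) \<in> N \<rightarrow>\<^sub>M M"
  proof cases
    case 1 then show ?thesis using comp[of j] j i by simp
  next
    case 2 then show ?thesis by simp
  next
    case 3
    then have "j - 1 \<in> {1..n}" using j i by auto
    from comp[OF this] 3 show ?thesis by simp
  qed
qed

lemma prod_insert_index:
  fixes a :: "nat \<Rightarrow> 'a::comm_monoid_mult"
  assumes "i \<in> {1..Suc n}"
  shows "(\<Prod>j=1..n. a (if j < i then j else Suc j)) * a i = (\<Prod>j=1..Suc n. a j)"
proof -
  have "(\<Prod>j=1..n. a (if j < i then j else Suc j)) = (\<Prod>j\<in>{1..Suc n} - {i}. a j)"
  proof (rule prod.reindex_bij_witness[where j="\<lambda>j. if j < i then j else Suc j" and i="\<lambda>j. if j < i then j else j - 1"])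
  qed (use assms in \<open>auto split: if_splits\<close>)
  then show ?thesis
    using prod.remove[of "{1..Suc n}" i a] assms by (simp add: mult.commute del: prod.cl_ivl_Suc)
qed

text \<open>
  Fubini at an arbitrary position: the insertion of a coordinate transports the product of an \<open>n\<close>-fold and a
  single copy of \<open>M\<close> to the \<open>(n + 1)\<close>-fold product measure, as one sees on boxes. Every change of variables in
  the group variables below is made in one inserted coordinate.
\<close>
lemma nn_integral_insert_coord:
  assumes "sigma_finite_measure M" and i: "i \<in> {1..Suc n}"
    and [measurable]: "F \<in> borel_measurable (\<Pi>\<^sub>M j\<in>{1..Suc n}. M)"
  shows "(\<integral>\<^sup>+g. F g \<partial>(\<Pi>\<^sub>M j\<in>{1..Suc n}. M)) =
    (\<integral>\<^sup>+g. \<integral>\<^sup>+h. F (insert_coord n i g h) \<partial>M \<partial>(\<Pi>\<^sub>M j\<in>{1..n}. M))"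
proof -
  interpret M: sigma_finite_measure M by fact
  interpret product_sigma_finite "\<lambda>_::nat. M" by standard
  let ?P = "(\<Pi>\<^sub>M j\<in>{1..n}. M) \<Otimes>\<^sub>M M" and ?Q = "\<Pi>\<^sub>M j\<in>{1..Suc n}. M"
  let ?T = "\<lambda>p. insert_coord n i (fst p) (snd p)"
  have T [measurable]: "?T \<in> ?P \<rightarrow>\<^sub>M ?Q"
    using i by measurable
  have "distr ?P ?Q ?T = ?Q"
  proof (rule PiM_eqI)
    fix A :: "nat \<Rightarrow> 'a set"
    assume A: "\<And>j. j \<in> {1..Suc n} \<Longrightarrow> A j \<in> sets M"
    let ?f = "\<lambda>j. if j < i then j else Suc j"
    have f: "?f j \<in> {1..Suc n}" if "j \<in> {1..n}" for j using that by auto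
    have eq: "?T -` Pi\<^sub>E {1..Suc n} A \<inter> space ?P = Pi\<^sub>E {1..n} (\<lambda>j. A (?f j)) \<times> A i"
    proof (intro Set.set_eqI iffI)
      fix p assume p: "p \<in> ?T -` Pi\<^sub>E {1..Suc n} A \<inter> space ?P"
      then have *: "?T p j \<in> A j" if "j \<in> {1..Suc n}" for j using that by (auto simp: PiE_def)
      have "fst p j \<in> A (?f j)" if "j \<in> {1..n}" for j
        using *[OF f[OF that]] f[OF that] by (auto simp: insert_coord_def split: if_splits)
      moreover have "snd p \<in> A i" using *[OF i] i by (auto simp: insert_coord_def)
      ultimately show "p \<in> Pi\<^sub>E {1..n} (\<lambda>j. A (?f j)) \<times> A i"
        using p by (cases p) (auto simp: space_pair_measure space_PiM PiE_def)
    next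
      fix p assume p: "p \<in> Pi\<^sub>E {1..n} (\<lambda>j. A (?f j)) \<times> A i"
      then have p': "\<forall>j\<in>{1..n}. fst p j \<in> A (?f j)"
        by (simp add: mem_Times_iff PiE_iff)
      have "?T p j \<in> A j" if j: "j \<in> {1..Suc n}" for j
      proof -
        consider "j < i" | "j = i" | "j > i" by linarith
        then show ?thesis
        proof cases
          case 1
          then have "j \<in> {1..n}" using i j by auto
          then have "fst p j \<in> A (?f j)" by (rule p'[rule_format])
          with 1 j show ?thesis by (simp add: insert_coord_def)
        next
          case 2 with p j show ?thesis by (auto simp: insert_coord_def)
        next
          case 3
          then have "j - 1 \<in> {1..n}" using i j by auto
          then have "fst p (j - 1) \<in> A (?f (j - 1))" by (rule p'[rule_format])
          with 3 j show ?thesis by (auto simp: insert_coord_def split: if_splits)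
        qed
      qed
      then have "?T p \<in> Pi\<^sub>E {1..Suc n} A"
        by (simp add: PiE_iff) (simp add: insert_coord_def)
      moreover have "fst p j \<in> space M" if "j \<in> {1..n}" for j
        using p'[rule_format, OF that] sets.sets_into_space[OF A[OF f[OF that]]] by blast
      then have "p \<in> space ?P"
        using p sets.sets_into_space[OF A[OF i]]
        by (auto simp: space_pair_measure space_PiM PiE_iff)
      ultimately show "p \<in> ?T -` Pi\<^sub>E {1..Suc n} A \<inter> space ?P" by simp
    qed
    have "emeasure (distr ?P ?Q ?T) (Pi\<^sub>E {1..Suc n} A) = emeasure ?P (Pi\<^sub>E {1..n} (\<lambda>j. A (?f j)) \<times> A i)"
      by (subst emeasure_distr[OF T]) (use A eq in \<open>auto intro!: sets_PiM_I_finite\<close>)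
    also have "\<dots> = emeasure (\<Pi>\<^sub>M j\<in>{1..n}. M) (Pi\<^sub>E {1..n} (\<lambda>j. A (?f j))) * emeasure M (A i)"
      by (rule M.emeasure_pair_measure_Times) (use A f i in \<open>auto intro!: sets_PiM_I_finite\<close>)
    also have "emeasure (\<Pi>\<^sub>M j\<in>{1..n}. M) (Pi\<^sub>E {1..n} (\<lambda>j. A (?f j))) = (\<Prod>j=1..n. emeasure M (A (?f j)))"
      by (rule emeasure_PiM) (use A f in auto)
    also have "\<dots> * emeasure M (A i) = (\<Prod>j\<in>{1..Suc n}. emeasure M (A j))"
      by (rule prod_insert_index[OF i])
    finally show "emeasure (distr ?P ?Q ?T) (Pi\<^sub>E {1..Suc n} A) = (\<Prod>j\<in>{1..Suc n}. emeasure M (A j))" .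
  qed auto
  then have "(\<integral>\<^sup>+g. F g \<partial>?Q) = (\<integral>\<^sup>+g. F g \<partial>distr ?P ?Q ?T)" by simp
  also have "\<dots> = (\<integral>\<^sup>+p. F (?T p) \<partial>?P)"
    by (rule nn_integral_distr) measurable
  also have "\<dots> = (\<integral>\<^sup>+g. \<integral>\<^sup>+h. F (insert_coord n i g h) \<partial>M \<partial>(\<Pi>\<^sub>M j\<in>{1..n}. M))"
    using M.nn_integral_fst[OF measurable_compose[OF T assms(3)]] by (simp only: fst_conv snd_conv)
  finally show ?thesis .
qed

section \<open>The motion group of a compact group\<close>

locale compact_motion_group =
  fixes K :: "'k::{t2_space,second_countable_topology} monoid"
    and act :: "'k \<Rightarrow> 'v::{real_inner,second_countable_topology} \<Rightarrow> 'v"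
    and \<mu> :: "'k measure"
  assumes group_K: "group K" and carrier_K [simp]: "carrier K = UNIV"
    and continuous_mult: "continuous_on UNIV (\<lambda>(k, l). k \<otimes>\<^bsub>K\<^esub> l)"
    and continuous_inv: "continuous_on UNIV (\<lambda>k. inv\<^bsub>K\<^esub> k)"
    and act_one [simp]: "act \<one>\<^bsub>K\<^esub> v = v"
    and act_mult: "act (k \<otimes>\<^bsub>K\<^esub> l) v = act k (act l v)"
    and linear_act: "linear (act k)"
    and norm_act [simp]: "norm (act k v) = norm v"
    and continuous_act: "continuous_on UNIV (\<lambda>(k, v). act k v)"
    and finite_dim_V: "finite_dim TYPE('v)"
    and sets_\<mu> [simp, measurable_cong]: "sets \<mu> = sets borel"
    and finite_\<mu>: "emeasure \<mu> UNIV \<noteq> \<infinity>" and nonzero_\<mu>: "emeasure \<mu> UNIV \<noteq> 0"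
    and left_invariant_\<mu>: "B \<in> sets borel \<Longrightarrow> emeasure \<mu> ((\<lambda>l. k \<otimes>\<^bsub>K\<^esub> l) ` B) = emeasure \<mu> B"
begin

sublocale K: group K by (rule group_K)

abbreviation "G \<equiv> motion_group K act"
abbreviation "haar \<equiv> (motion_measure \<mu> :: ('k \<times> 'v) measure)"
abbreviation "leb \<equiv> euclidean_measure (UNIV :: 'v set)"

lemma act_inv_act [simp]: "act (inv\<^bsub>K\<^esub> k) (act k v) = v" "act k (act (inv\<^bsub>K\<^esub> k) v) = v"
  by (simp_all flip: act_mult)

lemmas act_add = linear_add[OF linear_act] and act_diff = linear_diff[OF linear_act]
  and act_minus = linear_neg[OF linear_act] and act_zero [simp] = linear_0[OF linear_act]

lemma inner_act [simp]: "act k v \<bullet> act k w = v \<bullet> w"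
  by (simp add: dot_norm flip: act_add)

lemma carrier_G [simp]: "carrier G = UNIV"
  by (simp add: motion_group_def)

lemma mult_G: "a \<otimes>\<^bsub>G\<^esub> b = (fst a \<otimes>\<^bsub>K\<^esub> fst b, act (inv\<^bsub>K\<^esub> (fst b)) (snd a) + snd b)"
  by (simp add: motion_group_def case_prod_beta)

lemma one_G: "\<one>\<^bsub>G\<^esub> = (\<one>\<^bsub>K\<^esub>, 0)"
  by (simp add: motion_group_def)

sublocale G: group G
proof (rule groupI)
  fix a show "\<exists>b\<in>carrier G. b \<otimes>\<^bsub>G\<^esub> a = \<one>\<^bsub>G\<^esub>"
    by (intro bexI[of _ "(inv\<^bsub>K\<^esub> (fst a), - act (fst a) (snd a))"]) (auto simp: mult_G one_G act_minus)
qed (auto simp: mult_G one_G K.m_assoc act_add act_mult K.inv_mult_group add.assoc)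

lemma inv_G: "inv\<^bsub>G\<^esub> a = (inv\<^bsub>K\<^esub> (fst a), - act (fst a) (snd a))"
  by (rule G.inv_equality) (auto simp: mult_G one_G act_minus)

lemma fst_mult_G [simp]: "fst (a \<otimes>\<^bsub>G\<^esub> b) = fst a \<otimes>\<^bsub>K\<^esub> fst b"
  and fst_inv_G [simp]: "fst (inv\<^bsub>G\<^esub> a) = inv\<^bsub>K\<^esub> (fst a)"
  and fst_one_G [simp]: "fst \<one>\<^bsub>G\<^esub> = \<one>\<^bsub>K\<^esub>"
  and snd_one_G [simp]: "snd \<one>\<^bsub>G\<^esub> = 0"
  and snd_mult_G: "snd (a \<otimes>\<^bsub>G\<^esub> b) = act (inv\<^bsub>K\<^esub> (fst b)) (snd a) + snd b"
  and snd_inv_G: "snd (inv\<^bsub>G\<^esub> a) = - act (fst a) (snd a)"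
  by (simp_all add: mult_G inv_G one_G)

lemma norm_snd_mult_G_le: "norm (snd (a \<otimes>\<^bsub>G\<^esub> b)) \<le> norm (snd a) + norm (snd b)"
  using norm_triangle_ineq[of "act (inv\<^bsub>K\<^esub> (fst b)) (snd a)" "snd b"] by (simp add: snd_mult_G)

lemma norm_snd_inv_G [simp]: "norm (snd (inv\<^bsub>G\<^esub> a)) = norm (snd a)"
  by (simp add: snd_inv_G)

lemma mult_K_measurable [measurable (raw)]:
  assumes [measurable]: "f \<in> M \<rightarrow>\<^sub>M borel" "g \<in> M \<rightarrow>\<^sub>M borel"
  shows "(\<lambda>y. f y \<otimes>\<^bsub>K\<^esub> g y) \<in> M \<rightarrow>\<^sub>M borel"
proof -
  have "(\<lambda>p. fst p \<otimes>\<^bsub>K\<^esub> snd p) \<in> borel \<rightarrow>\<^sub>M borel"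
    using borel_measurable_continuous_onI[OF continuous_mult] by (simp add: case_prod_beta')
  then show ?thesis
    using measurable_compose[OF borel_measurable_Pair[OF assms], of "\<lambda>p. fst p \<otimes>\<^bsub>K\<^esub> snd p" borel] by simp
qed

lemma inv_K_measurable [measurable (raw)]:
  "f \<in> M \<rightarrow>\<^sub>M borel \<Longrightarrow> (\<lambda>y. inv\<^bsub>K\<^esub> (f y)) \<in> M \<rightarrow>\<^sub>M borel"
  using measurable_compose[OF _ borel_measurable_continuous_onI[OF continuous_inv]] .

lemma act_measurable [measurable (raw)]:
  assumes [measurable]: "f \<in> M \<rightarrow>\<^sub>M borel" "g \<in> M \<rightarrow>\<^sub>M borel"
  shows "(\<lambda>y. act (f y) (g y)) \<in> M \<rightarrow>\<^sub>M borel"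
proof -
  have "(\<lambda>p. act (fst p) (snd p)) \<in> borel \<rightarrow>\<^sub>M borel"
    using borel_measurable_continuous_onI[OF continuous_act] by (simp add: case_prod_beta')
  then show ?thesis
    using measurable_compose[OF borel_measurable_Pair[OF assms], of "\<lambda>p. act (fst p) (snd p)" borel] by simp
qed

lemma fst_borel [measurable (raw)]:
  "f \<in> M \<rightarrow>\<^sub>M borel \<Longrightarrow> (\<lambda>y. fst (f y :: 'k \<times> 'v)) \<in> M \<rightarrow>\<^sub>M borel"
  by (erule measurable_compose) (intro borel_measurable_continuous_onI continuous_intros)

lemma snd_borel [measurable (raw)]:
  "f \<in> M \<rightarrow>\<^sub>M borel \<Longrightarrow> (\<lambda>y. snd (f y :: 'k \<times> 'v)) \<in> M \<rightarrow>\<^sub>M borel"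
  by (erule measurable_compose) (intro borel_measurable_continuous_onI continuous_intros)

lemma mult_G_measurable [measurable (raw)]:
  assumes [measurable]: "f \<in> M \<rightarrow>\<^sub>M borel" "g \<in> M \<rightarrow>\<^sub>M borel"
  shows "(\<lambda>y. f y \<otimes>\<^bsub>G\<^esub> g y) \<in> M \<rightarrow>\<^sub>M borel"
  unfolding mult_G by measurable

lemma inv_G_measurable [measurable (raw)]:
  assumes [measurable]: "f \<in> M \<rightarrow>\<^sub>M borel"
  shows "(\<lambda>y. inv\<^bsub>G\<^esub> (f y)) \<in> M \<rightarrow>\<^sub>M borel"
  unfolding inv_G by measurable

lemma sets_haar [simp, measurable_cong]: "sets haar = sets borel"
proof -
  have "sets haar = sets (borel \<Otimes>\<^sub>M borel)"
    unfolding motion_measure_def by (intro sets_pair_measure_cong) simp_all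
  then show ?thesis by (simp only: borel_prod)
qed

lemma space_haar [simp]: "space haar = UNIV"
  using sets_eq_imp_space_eq[OF sets_haar] by simp

lemma space_\<mu> [simp]: "space \<mu> = UNIV"
  using sets_eq_imp_space_eq[OF sets_\<mu>] by simp

sublocale \<mu>: finite_measure \<mu>
  by (rule finite_measureI) (use finite_\<mu> in simp)

sublocale leb: sigma_finite_measure leb
  by (rule sigma_finite_euclidean_measure[OF finite_dim_V subspace_UNIV])

sublocale haar: sigma_finite_measure haar
  unfolding motion_measure_def
  by (intro sigma_finite_pair_measure \<mu>.sigma_finite_measure_axioms leb.sigma_finite_measure_axioms)

lemma nn_integral_mult_K:
  assumes [measurable]: "F \<in> borel_measurable borel"
  shows "(\<integral>\<^sup>+u. F (k \<otimes>\<^bsub>K\<^esub> u) \<partial>\<mu>) = (\<integral>\<^sup>+u. F u \<partial>\<mu>)"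
proof -
  have "distr \<mu> \<mu> (\<lambda>u. k \<otimes>\<^bsub>K\<^esub> u) = \<mu>"
  proof (rule measure_eqI)
    fix B assume "B \<in> sets (distr \<mu> \<mu> (\<lambda>u. k \<otimes>\<^bsub>K\<^esub> u))"
    then have B: "B \<in> sets borel" by simp
    have "(\<lambda>u. k \<otimes>\<^bsub>K\<^esub> u) -` B = (\<lambda>u. inv\<^bsub>K\<^esub> k \<otimes>\<^bsub>K\<^esub> u) ` B"
    proof (intro Set.set_eqI iffI)
      fix u assume "u \<in> (\<lambda>u. k \<otimes>\<^bsub>K\<^esub> u) -` B"
      then show "u \<in> (\<lambda>u. inv\<^bsub>K\<^esub> k \<otimes>\<^bsub>K\<^esub> u) ` B"
        by (intro image_eqI[of _ _ "k \<otimes>\<^bsub>K\<^esub> u"]) (auto simp flip: K.m_assoc)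
    qed (auto simp flip: K.m_assoc)
    then show "emeasure (distr \<mu> \<mu> (\<lambda>u. k \<otimes>\<^bsub>K\<^esub> u)) B = emeasure \<mu> B"
      using B left_invariant_\<mu>[OF B, of "inv\<^bsub>K\<^esub> k"] by (subst emeasure_distr) simp_all
  qed simp
  then have "(\<integral>\<^sup>+u. F u \<partial>\<mu>) = (\<integral>\<^sup>+u. F u \<partial>distr \<mu> \<mu> (\<lambda>u. k \<otimes>\<^bsub>K\<^esub> u))" by simp
  also have "\<dots> = (\<integral>\<^sup>+u. F (k \<otimes>\<^bsub>K\<^esub> u) \<partial>\<mu>)"
    by (rule nn_integral_distr) measurable
  finally show ?thesis by simp
qed

lemma nn_integral_haar:
  assumes [measurable]: "F \<in> borel_measurable borel"
  shows "(\<integral>\<^sup>+g. F g \<partial>haar) = (\<integral>\<^sup>+k. \<integral>\<^sup>+v. F (k, v) \<partial>leb \<partial>\<mu>)"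
proof -
  have "F \<in> borel_measurable (\<mu> \<Otimes>\<^sub>M leb)"
    using assms sets_haar unfolding motion_measure_def by (simp cong: measurable_cong_sets)
  then show ?thesis
    unfolding motion_measure_def by (rule leb.nn_integral_fst[symmetric])
qed

lemma nn_integral_leb_translate:
  assumes [measurable]: "F \<in> borel_measurable borel"
  shows "(\<integral>\<^sup>+v. F (v + t) \<partial>leb) = (\<integral>\<^sup>+v. F v \<partial>leb)"
  by (rule nn_integral_euclidean_translate[OF finite_dim_V subspace_UNIV]) auto

text \<open>
  In the product \<open>(k\<^sub>0, v\<^sub>0)(k\<^sub>1, v\<^sub>1)\<close>, left multiplication acts on the second component by a translation that
  depends on \<open>k\<^sub>1\<close>, so left invariance reduces to that of \<open>\<mu>\<close> and to translation invariance.
\<close>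
lemma nn_integral_mult_G:
  assumes [measurable]: "F \<in> borel_measurable borel"
  shows "(\<integral>\<^sup>+h. F (a \<otimes>\<^bsub>G\<^esub> h) \<partial>haar) = (\<integral>\<^sup>+h. F h \<partial>haar)"
proof -
  have "(\<integral>\<^sup>+h. F (a \<otimes>\<^bsub>G\<^esub> h) \<partial>haar) =
      (\<integral>\<^sup>+k. \<integral>\<^sup>+v. F (fst a \<otimes>\<^bsub>K\<^esub> k, v + act (inv\<^bsub>K\<^esub> k) (snd a)) \<partial>leb \<partial>\<mu>)"
    by (subst nn_integral_haar) (simp_all add: mult_G add.commute)
  also have "\<dots> = (\<integral>\<^sup>+k. \<integral>\<^sup>+v. F (fst a \<otimes>\<^bsub>K\<^esub> k, v) \<partial>leb \<partial>\<mu>)"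
    by (intro nn_integral_cong nn_integral_leb_translate) measurable
  also have "\<dots> = (\<integral>\<^sup>+k. \<integral>\<^sup>+v. F (k, v) \<partial>leb \<partial>\<mu>)"
    by (rule nn_integral_mult_K[where F="\<lambda>k. \<integral>\<^sup>+v. F (k, v) \<partial>leb"]) measurable
  finally show ?thesis by (simp add: nn_integral_haar)
qed

text \<open>
  Unimodularity of the motion group. For any weight \<open>b\<close>, left invariance and Fubini give
  \<open>\<integral>F(h) dh \<sqdot> \<integral>b(y) dy = \<integral>\<integral>F(y\<^sup>-\<^sup>1 x) b(y) dx dy = \<integral>\<integral>F(y\<^sup>-\<^sup>1) b(x y) dx dy\<close>.
  If \<open>b\<close> is the indicator of \<open>norm v \<le> r\<close>, it is invariant under \<open>K\<close>, so that the inner integral of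
  \<open>b(x y)\<close> over \<open>x\<close> involves only a translation of the ball and equals \<open>\<integral>b\<close>, a finite positive number that can
  be cancelled. Compactness of \<open>K\<close> is what makes \<open>\<integral>b\<close> finite.
\<close>
lemma nn_integral_inv_G:
  assumes [measurable]: "F \<in> borel_measurable borel"
  shows "(\<integral>\<^sup>+h. F (inv\<^bsub>G\<^esub> h) \<partial>haar) = (\<integral>\<^sup>+h. F h \<partial>haar)"
proof -
  obtain r :: nat where r: "emeasure leb (cball 0 (real r)) \<noteq> 0"
    by (rule emeasure_euclidean_cball_nonzero[OF finite_dim_V subspace_UNIV])
  \<comment> \<open>The weight of the cancellation argument; its invariance under \<open>K\<close> is essential.\<close>
  define b :: "'v \<Rightarrow> ennreal" where "b = indicator (cball 0 (real r))"
  have [measurable]: "b \<in> borel_measurable borel" unfolding b_def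
    by (intro borel_measurable_indicator borel_closed closed_cball)
  have b_act: "b (act k v) = b v" for k v
    by (simp add: b_def indicator_def)
  define c where "c = (\<integral>\<^sup>+h. b (snd h) \<partial>haar)"
  have "c = (\<integral>\<^sup>+k. emeasure leb (cball 0 (real r)) \<partial>\<mu>)"
    unfolding c_def by (subst nn_integral_haar, measurable) (simp add: b_def)
  then have c: "c \<noteq> 0" "c \<noteq> top_class.top"
    using r nonzero_\<mu> finite_\<mu> emeasure_euclidean_cball_finite[OF finite_dim_V subspace_UNIV, of "real r"]
    by (auto simp: ennreal_mult_eq_top_iff)
  have translate: "(\<integral>\<^sup>+x. b (snd (x \<otimes>\<^bsub>G\<^esub> y)) \<partial>haar) = c" for y
  proof -
    have "b (snd (x \<otimes>\<^bsub>G\<^esub> y)) = b (snd x + act (fst y) (snd y))" for x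
      using b_act[of "fst y" "snd (x \<otimes>\<^bsub>G\<^esub> y)"] by (simp add: snd_mult_G act_add)
    then have "(\<integral>\<^sup>+x. b (snd (x \<otimes>\<^bsub>G\<^esub> y)) \<partial>haar) = (\<integral>\<^sup>+k. \<integral>\<^sup>+v. b (v + act (fst y) (snd y)) \<partial>leb \<partial>\<mu>)"
      by (subst nn_integral_haar) simp_all
    also have "\<dots> = c"
      unfolding c_def by (subst nn_integral_haar, measurable) (simp add: nn_integral_leb_translate)
    finally show ?thesis .
  qed
  have pair: "pair_sigma_finite haar haar" by standard
  have "(\<integral>\<^sup>+h. F h \<partial>haar) * c = (\<integral>\<^sup>+y. (\<integral>\<^sup>+x. F x \<partial>haar) * b (snd y) \<partial>haar)"
    unfolding c_def by (subst nn_integral_cmult) auto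
  also have "\<dots> = (\<integral>\<^sup>+y. \<integral>\<^sup>+x. F (inv\<^bsub>G\<^esub> y \<otimes>\<^bsub>G\<^esub> x) * b (snd y) \<partial>haar \<partial>haar)"
    by (intro nn_integral_cong) (subst nn_integral_multc, measurable, simp add: nn_integral_mult_G)
  also have "\<dots> = (\<integral>\<^sup>+x. \<integral>\<^sup>+y. F (inv\<^bsub>G\<^esub> y \<otimes>\<^bsub>G\<^esub> x) * b (snd y) \<partial>haar \<partial>haar)"
    by (rule pair_sigma_finite.Fubini'[OF pair]) measurable
  also have "\<dots> = (\<integral>\<^sup>+x. \<integral>\<^sup>+y. F (inv\<^bsub>G\<^esub> (x \<otimes>\<^bsub>G\<^esub> y) \<otimes>\<^bsub>G\<^esub> x) * b (snd (x \<otimes>\<^bsub>G\<^esub> y)) \<partial>haar \<partial>haar)"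
    by (intro nn_integral_cong nn_integral_mult_G[symmetric]) measurable
  also have "\<dots> = (\<integral>\<^sup>+x. \<integral>\<^sup>+y. F (inv\<^bsub>G\<^esub> y) * b (snd (x \<otimes>\<^bsub>G\<^esub> y)) \<partial>haar \<partial>haar)"
    by (simp add: G.inv_mult_group G.m_assoc)
  also have "\<dots> = (\<integral>\<^sup>+y. \<integral>\<^sup>+x. F (inv\<^bsub>G\<^esub> y) * b (snd (x \<otimes>\<^bsub>G\<^esub> y)) \<partial>haar \<partial>haar)"
    by (rule pair_sigma_finite.Fubini'[OF pair]) measurable
  also have "\<dots> = (\<integral>\<^sup>+y. F (inv\<^bsub>G\<^esub> y) * c \<partial>haar)"
    by (intro nn_integral_cong) (subst nn_integral_cmult, measurable, simp add: translate)
  also have "\<dots> = (\<integral>\<^sup>+y. F (inv\<^bsub>G\<^esub> y) \<partial>haar) * c"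
    by (rule nn_integral_multc) measurable
  finally show ?thesis
    using c by (metis mult_divide_eq_ennreal)
qed

end

section \<open>Ordered products\<close>

lemma segment_prod_empty [simp]: "segment_prod H g (Suc m) m = \<one>\<^bsub>H\<^esub>"
  by (simp add: segment_prod_def)

lemma segment_prod_Cons: "i \<le> m \<Longrightarrow> segment_prod H g i m = g i \<otimes>\<^bsub>H\<^esub> segment_prod H g (Suc i) m"
  unfolding segment_prod_def by (subst upt_rec) simp

lemma segment_prod_cong:
  "(\<And>j. i \<le> j \<Longrightarrow> j \<le> m \<Longrightarrow> g j = h j) \<Longrightarrow> segment_prod H g i m = segment_prod H h i m"
  unfolding segment_prod_def by (rule foldr_cong) auto

lemma segment_prod_shift: "segment_prod H g (Suc i) (Suc m) = segment_prod H (\<lambda>j. g (Suc j)) i m"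
proof -
  have "[Suc i..<Suc (Suc m)] = map Suc [i..<Suc m]" by (simp only: map_Suc_upt)
  then show ?thesis unfolding segment_prod_def by (simp only: foldr_map) (simp add: comp_def)
qed

lemma segment_prod_snoc:
  assumes "group H" and g: "\<And>j. g j \<in> carrier H" and i: "i \<le> Suc m"
  shows "segment_prod H g i (Suc m) = segment_prod H g i m \<otimes>\<^bsub>H\<^esub> g (Suc m)"
proof -
  interpret group H by fact
  have *: "foldr (\<lambda>l p. g l \<otimes>\<^bsub>H\<^esub> p) xs \<one>\<^bsub>H\<^esub> \<in> carrier H" for xs by (induction xs) (auto simp: g)
  have "foldr (\<lambda>l p. g l \<otimes>\<^bsub>H\<^esub> p) (xs @ [l]) \<one>\<^bsub>H\<^esub> = foldr (\<lambda>l p. g l \<otimes>\<^bsub>H\<^esub> p) xs \<one>\<^bsub>H\<^esub> \<otimes>\<^bsub>H\<^esub> g l" for xs l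
    by (induction xs) (use g * in \<open>auto simp: m_assoc\<close>)
  with i show ?thesis by (simp add: segment_prod_def)
qed

section \<open>The orbit and the integrand\<close>

locale orbital_setting = compact_motion_group K act \<mu>
  for K :: "'k::{t2_space,second_countable_topology} monoid"
    and act :: "'k \<Rightarrow> 'v::{real_inner,second_countable_topology} \<Rightarrow> 'v"
    and \<mu> :: "'k measure" +
  fixes \<nu> :: "'k set measure" and A :: "'v set" and e :: "nat \<Rightarrow> 'v" and n :: nat and x :: 'k
  assumes e_in_A: "i \<in> {1..n} \<Longrightarrow> e i \<in> A"
    and x_fixes: "x \<in> fixing_subgroup K act A"
    and sets_\<nu>: "sets \<nu> = sets (quotient_borel K (fixing_subgroup K act A)
           (centralizer_in K (fixing_subgroup K act A) x))"
    and finite_\<nu>: "emeasure \<nu> (space \<nu>) \<noteq> \<infinity>"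
begin

abbreviation "conj_of \<equiv> coset_conj K x"
abbreviation "perp \<equiv> euclidean_measure (A\<^sup>\<bottom>)"

lemma space_\<nu>: "space \<nu> = lcosets\<^bsub>K\<lparr>carrier := fixing_subgroup K act A\<rparr>\<^esub> (centralizer_in K (fixing_subgroup K act A) x)"
  using sets_eq_imp_space_eq[OF sets_\<nu>] by (simp add: quotient_borel_def space_measure_of_conv)

text \<open>
  Elements of one left coset of the centralizer conjugate \<open>x\<close> to the same element, so \<open>coset_conj\<close> is the
  intended value and not a default one.
\<close>
lemma conj_of_coset:
  "conj_of (h <#\<^bsub>K\<^esub> centralizer_in K (fixing_subgroup K act A) x) = h \<otimes>\<^bsub>K\<^esub> x \<otimes>\<^bsub>K\<^esub> inv\<^bsub>K\<^esub> h"
proof -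
  let ?Z = "centralizer_in K (fixing_subgroup K act A) x"
  have "(\<lambda>h. h \<otimes>\<^bsub>K\<^esub> x \<otimes>\<^bsub>K\<^esub> inv\<^bsub>K\<^esub> h) ` (h <#\<^bsub>K\<^esub> ?Z) = {h \<otimes>\<^bsub>K\<^esub> x \<otimes>\<^bsub>K\<^esub> inv\<^bsub>K\<^esub> h}"
  proof -
    have "\<one>\<^bsub>K\<^esub> \<in> ?Z" by (simp add: centralizer_in_def fixing_subgroup_def)
    then have "h \<otimes>\<^bsub>K\<^esub> \<one>\<^bsub>K\<^esub> \<in> h <#\<^bsub>K\<^esub> ?Z" unfolding l_coset_def by blast
    then have "h \<in> h <#\<^bsub>K\<^esub> ?Z" by simp
    moreover have "(h \<otimes>\<^bsub>K\<^esub> z) \<otimes>\<^bsub>K\<^esub> x \<otimes>\<^bsub>K\<^esub> inv\<^bsub>K\<^esub> (h \<otimes>\<^bsub>K\<^esub> z) = h \<otimes>\<^bsub>K\<^esub> x \<otimes>\<^bsub>K\<^esub> inv\<^bsub>K\<^esub> h" if "z \<in> ?Z" for z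
    proof -
      have "(h \<otimes>\<^bsub>K\<^esub> z) \<otimes>\<^bsub>K\<^esub> x \<otimes>\<^bsub>K\<^esub> inv\<^bsub>K\<^esub> (h \<otimes>\<^bsub>K\<^esub> z) = h \<otimes>\<^bsub>K\<^esub> (z \<otimes>\<^bsub>K\<^esub> x) \<otimes>\<^bsub>K\<^esub> inv\<^bsub>K\<^esub> z \<otimes>\<^bsub>K\<^esub> inv\<^bsub>K\<^esub> h"
        by (simp add: K.inv_mult_group K.m_assoc)
      also have "z \<otimes>\<^bsub>K\<^esub> x = x \<otimes>\<^bsub>K\<^esub> z" using that by (simp add: centralizer_in_def)
      finally show ?thesis by (simp add: K.m_assoc)
    qed
    ultimately show ?thesis by (auto simp: l_coset_def)
  qed
  then show ?thesis by (simp add: coset_conj_def)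
qed

lemma l_coset_carrier_update [simp]: "h <#\<^bsub>K\<lparr>carrier := M\<rparr>\<^esub> Z = h <#\<^bsub>K\<^esub> Z"
  by (simp add: l_coset_def)

lemma act_conj_of_fixes:
  assumes "C \<in> space \<nu>" "a \<in> A"
  shows "act (conj_of C) a = a"
proof -
  obtain h where h: "h \<in> fixing_subgroup K act A"
    and C: "C = h <#\<^bsub>K\<^esub> centralizer_in K (fixing_subgroup K act A) x"
    using assms(1) by (auto simp: space_\<nu> LCOSETS_def)
  have "act (inv\<^bsub>K\<^esub> h) a = a"
    using h assms(2) act_inv_act(1)[of h a] by (simp add: fixing_subgroup_def)
  then show ?thesis
    unfolding C conj_of_coset using h x_fixes assms(2) by (simp add: act_mult fixing_subgroup_def)
qed

text \<open>
  The sets that generate the Borel sets of the quotient are those with relatively open preimage, and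
  \<open>h \<mapsto> h x h\<^sup>-\<^sup>1\<close> is continuous.
\<close>
lemma conj_of_measurable [measurable]: "conj_of \<in> \<nu> \<rightarrow>\<^sub>M borel"
proof (rule borel_measurableI)
  fix S :: "'k set" assume S: "open S"
  let ?M = "fixing_subgroup K act A" and ?Z = "centralizer_in K (fixing_subgroup K act A) x"
  have mult: "continuous_on UNIV (\<lambda>h. f h \<otimes>\<^bsub>K\<^esub> g h)"
    if "continuous_on UNIV f" "continuous_on UNIV g" for f g :: "'k \<Rightarrow> 'k"
    using continuous_on_compose2[OF continuous_mult[unfolded case_prod_beta'] continuous_on_Pair[OF that]] by simp
  have "continuous_on UNIV (\<lambda>h. h \<otimes>\<^bsub>K\<^esub> x \<otimes>\<^bsub>K\<^esub> inv\<^bsub>K\<^esub> h)"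
    by (intro mult continuous_inv continuous_on_id continuous_on_const)
  then have "open ((\<lambda>h. h \<otimes>\<^bsub>K\<^esub> x \<otimes>\<^bsub>K\<^esub> inv\<^bsub>K\<^esub> h) -` S)"
    using S by (simp add: continuous_on_open_vimage)
  moreover have "{h \<in> ?M. h <#\<^bsub>K\<^esub> ?Z \<in> conj_of -` S \<inter> space \<nu>} = ?M \<inter> ((\<lambda>h. h \<otimes>\<^bsub>K\<^esub> x \<otimes>\<^bsub>K\<^esub> inv\<^bsub>K\<^esub> h) -` S)"
    by (auto simp: conj_of_coset space_\<nu> LCOSETS_def)
  ultimately have "openin (top_of_set ?M) {h \<in> ?M. h <#\<^bsub>K\<^esub> ?Z \<in> conj_of -` S \<inter> space \<nu>}"
    by (auto simp: openin_open)
  then show "conj_of -` S \<inter> space \<nu> \<in> sets \<nu>"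
    unfolding sets_\<nu> quotient_borel_def
    by (subst sets_measure_of) (auto simp: space_\<nu>)
qed

sublocale \<nu>: finite_measure \<nu>
  by (rule finite_measureI) (use finite_\<nu> in simp)

sublocale perp: sigma_finite_measure perp
  by (rule sigma_finite_euclidean_measure[OF finite_dim_V subspace_orthogonal_comp])

abbreviation "\<Omega> \<equiv> (\<nu> \<Otimes>\<^sub>M \<mu>) \<Otimes>\<^sub>M perp"
abbreviation "haars N \<equiv> (\<Pi>\<^sub>M j\<in>{1..N::nat}. haar)"

sublocale \<nu>\<mu>: pair_sigma_finite \<nu> \<mu> ..
sublocale \<nu>\<mu>: sigma_finite_measure "\<nu> \<Otimes>\<^sub>M \<mu>"
  by (intro sigma_finite_pair_measure \<mu>.sigma_finite_measure_axioms \<nu>.sigma_finite_measure_axioms)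
sublocale \<Omega>: pair_sigma_finite "\<nu> \<Otimes>\<^sub>M \<mu>" perp ..
sublocale \<Omega>: sigma_finite_measure \<Omega>
  by (intro sigma_finite_pair_measure \<nu>\<mu>.sigma_finite_measure_axioms perp.sigma_finite_measure_axioms)
sublocale haar_power: product_sigma_finite "\<lambda>_::nat. haar" ..

lemma sigma_finite_haars: "sigma_finite_measure (haars N)"
  by (rule haar_power.sigma_finite) simp

lemma component_haars:
  "g \<in> M \<rightarrow>\<^sub>M haars N \<Longrightarrow> j \<in> {1..N} \<Longrightarrow> (\<lambda>y. g y j) \<in> M \<rightarrow>\<^sub>M borel"
  using measurable_compose[OF _ measurable_component_singleton, of g M "{1..N}" "\<lambda>_. haar" j]
  by (simp cong: measurable_cong_sets)

lemma measurable_segment_prod [measurable (raw)]: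
  assumes "g \<in> M \<rightarrow>\<^sub>M haars N" "1 \<le> i" "m \<le> N"
  shows "(\<lambda>y. segment_prod G (g y) i m) \<in> M \<rightarrow>\<^sub>M borel"
proof -
  have "(\<lambda>y. foldr (\<lambda>l p. g y l \<otimes>\<^bsub>G\<^esub> p) xs \<one>\<^bsub>G\<^esub>) \<in> M \<rightarrow>\<^sub>M borel" if "set xs \<subseteq> {1..N}" for xs
    using that
  proof (induction xs)
    case (Cons l xs)
    then have "(\<lambda>y. g y l \<otimes>\<^bsub>G\<^esub> foldr (\<lambda>l p. g y l \<otimes>\<^bsub>G\<^esub> p) xs \<one>\<^bsub>G\<^esub>) \<in> M \<rightarrow>\<^sub>M borel"
      by (intro mult_G_measurable component_haars[OF assms(1)]) auto
    then show ?case by simp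
  qed simp
  moreover have "set [i..<Suc m] \<subseteq> {1..N}" using assms(2,3) by auto
  ultimately show ?thesis unfolding segment_prod_def .
qed

text \<open>
  The element \<open>y\<close> of the motion group that all products \<open>g\<^sub>0 \<cdots> g\<^sub>n\<close> are constrained to equal.
\<close>
definition orbit_point :: "('k set \<times> 'k) \<times> 'v \<Rightarrow> 'k \<times> 'v" where
  "orbit_point \<omega> = (snd (fst \<omega>) \<otimes>\<^bsub>K\<^esub> conj_of (fst (fst \<omega>)) \<otimes>\<^bsub>K\<^esub> inv\<^bsub>K\<^esub> (snd (fst \<omega>)), act (snd (fst \<omega>)) (snd \<omega>))"

lemma orbit_point_measurable [measurable]: "orbit_point \<in> \<Omega> \<rightarrow>\<^sub>M borel"
  unfolding orbit_point_def by measurable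

text \<open>
  The \<open>A\<close>-coordinates of the columns. Writing a column as a difference of tail products makes it evident
  that merging two neighbouring group elements adds their columns.
\<close>
definition proj_column :: "nat \<Rightarrow> 'k \<Rightarrow> (nat \<Rightarrow> 'k \<times> 'v) \<Rightarrow> nat \<Rightarrow> nat \<Rightarrow> real" where
  "proj_column N u g j i = act (inv\<^bsub>K\<^esub> u) (snd (segment_prod G g j N) - snd (segment_prod G g (Suc j) N)) \<bullet> e i"

lemma proj_column_measurable [measurable (raw)]:
  assumes [measurable]: "u \<in> M \<rightarrow>\<^sub>M borel" "g \<in> M \<rightarrow>\<^sub>M haars N" and j: "j \<in> {1..N}"
  shows "(\<lambda>y. proj_column N (u y) (g y) j i) \<in> borel_measurable M"
  unfolding proj_column_def
  by (intro borel_measurable_inner act_measurable inv_K_measurable borel_measurable_diff borel_measurable_const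
      snd_borel measurable_segment_prod[OF assms(2)] assms(1)) (use j in auto)

definition orbit_integrand :: "(nat \<Rightarrow> 'k \<times> 'v \<Rightarrow> complex) \<Rightarrow> nat \<Rightarrow> (('k set \<times> 'k) \<times> 'v) \<times> (nat \<Rightarrow> 'k \<times> 'v) \<Rightarrow> complex" where
  "orbit_integrand f N = (\<lambda>(\<omega>, g). f 0 (orbit_point \<omega> \<otimes>\<^bsub>G\<^esub> inv\<^bsub>G\<^esub> (segment_prod G g 1 N)) * (\<Prod>j=1..N. f j (g j)))"

section \<open>Absolute convergence\<close>

text \<open>
  The class of functions in which all computations take place. It contains the smooth functions with compact support
  and is closed under convolution.
\<close>
definition test_function :: "('k \<times> 'v \<Rightarrow> complex) \<Rightarrow> bool" where
  "test_function f \<longleftrightarrow> f \<in> borel_measurable borel \<and> (\<exists>B. \<forall>g. norm (f g) \<le> B) \<and> (\<exists>R. \<forall>g. norm (snd g) > R \<longrightarrow> f g = 0)"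

text \<open>
  Weights, such as determinants of columns, that are bounded as long as the vector components of the group elements
  are, uniformly in the orbit coordinates; decay in \<open>w\<close> is left to \<open>f\<^sub>0\<close>.
\<close>
definition tame :: "nat \<Rightarrow> ((('k set \<times> 'k) \<times> 'v) \<times> (nat \<Rightarrow> 'k \<times> 'v) \<Rightarrow> real) \<Rightarrow> bool" where
  "tame N q \<longleftrightarrow> q \<in> borel_measurable (\<Omega> \<Otimes>\<^sub>M haars N) \<and>
     (\<forall>R. \<exists>B. \<forall>\<omega> g. (\<forall>j\<in>{1..N}. norm (snd (g j)) \<le> R) \<longrightarrow> \<bar>q (\<omega>, g)\<bar> \<le> B)"

lemma orbit_integrand_measurable:
  assumes "\<And>j. j \<le> N \<Longrightarrow> f j \<in> borel_measurable borel"
  shows "orbit_integrand f N \<in> borel_measurable (\<Omega> \<Otimes>\<^sub>M haars N)"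
proof -
  have [measurable]: "f 0 \<in> borel_measurable borel" using assms by simp
  have "(\<lambda>p. f j (snd p j)) \<in> borel_measurable (\<Omega> \<Otimes>\<^sub>M haars N)" if "j \<in> {1..N}" for j
    using measurable_compose[OF component_haars[OF measurable_snd that] assms, of j] that by simp
  note [measurable] = borel_measurable_prod[OF this]
  show ?thesis
    unfolding orbit_integrand_def case_prod_beta' by measurable
qed

lemma norm_snd_segment_prod_le:
  assumes "\<And>j. j \<in> {i..m} \<Longrightarrow> norm (snd (g j)) \<le> R" "0 \<le> R"
  shows "norm (snd (segment_prod G g i m)) \<le> real (Suc m - i) * R"
proof -
  have "norm (snd (foldr (\<lambda>l p. g l \<otimes>\<^bsub>G\<^esub> p) xs \<one>\<^bsub>G\<^esub>)) \<le> real (length xs) * R"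
    if "set xs \<subseteq> {i..m}" for xs
    using that
  proof (induction xs)
    case (Cons l xs)
    then show ?case
      using norm_snd_mult_G_le[of "g l" "foldr (\<lambda>l p. g l \<otimes>\<^bsub>G\<^esub> p) xs \<one>\<^bsub>G\<^esub>"] assms(1)[of l]
      by (simp add: algebra_simps)
  qed simp
  then show ?thesis unfolding segment_prod_def by (metis atLeastLessThanSuc_atLeastAtMost length_upt set_upt subset_refl)
qed

lemma test_functions_uniform_bounds:
  assumes "\<And>j. j \<le> (N::nat) \<Longrightarrow> test_function (f j)"
  shows "\<exists>B R. 0 \<le> B \<and> 0 \<le> R \<and> (\<forall>j\<le>N. \<forall>g. norm (f j g) \<le> B \<and> (norm (snd g) > R \<longrightarrow> f j g = 0))"
proof -
  have "\<forall>j. \<exists>B R. j \<le> N \<longrightarrow> (\<forall>g. norm (f j g) \<le> B) \<and> (\<forall>g. norm (snd g) > R \<longrightarrow> f j g = 0)"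
    using assms unfolding test_function_def by blast
  then obtain B R where BR: "\<And>j g. j \<le> N \<Longrightarrow> norm (f j g) \<le> B j"
    "\<And>j g. j \<le> N \<Longrightarrow> norm (snd g) > R j \<Longrightarrow> f j g = 0" by metis
  have le: "c j \<le> (\<Sum>j\<le>N. \<bar>c j\<bar>)" if "j \<le> N" for j and c :: "nat \<Rightarrow> real"
    using member_le_sum[of j "{..N}" "\<lambda>j. \<bar>c j\<bar>"] that by simp
  show ?thesis
  proof (rule exI[of _ "\<Sum>j\<le>N. \<bar>B j\<bar>"], rule exI[of _ "\<Sum>j\<le>N. \<bar>R j\<bar>"], intro conjI allI impI)
    fix j g assume j: "j \<le> N"
    show "norm (f j g) \<le> (\<Sum>j\<le>N. \<bar>B j\<bar>)"
      using BR(1)[OF j] le[OF j, of B] order_trans by blast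
    assume "norm (snd g) > (\<Sum>j\<le>N. \<bar>R j\<bar>)"
    then show "f j g = 0"
      using BR(2)[OF j] le[OF j, of R] by simp
  qed (auto intro: sum_nonneg)
qed

lemma emeasure_haar_slab: "emeasure haar {h. norm (snd h) \<le> R} < \<infinity>"
proof -
  have "emeasure haar {h. norm (snd h) \<le> R} = emeasure \<mu> UNIV * emeasure leb (cball 0 R)"
    unfolding motion_measure_def
    by (subst leb.emeasure_pair_measure_Times[symmetric]) (auto intro!: arg_cong2[where f=emeasure])
  also have "\<dots> < \<infinity>"
    using finite_\<mu> emeasure_euclidean_cball_finite[OF finite_dim_V subspace_UNIV, of R]
    by (simp add: ennreal_mult_eq_top_iff less_top[symmetric])
  finally show ?thesis .
qed

text \<open>
  The noncompact variable \<open>w\<close> is controlled by \<open>f\<^sub>0\<close>: if all \<open>g\<^sub>j\<close> have vector components of norm at most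
  \<open>R\<close> and \<open>f\<^sub>0\<close> does not vanish at \<open>y (g\<^sub>1 \<cdots> g\<^sub>N)\<^sup>-\<^sup>1\<close>, then \<open>norm w \<le> (N + 1) R\<close>. So the
  integrand is bounded and lives on a set of finite measure.
\<close>
lemma integrable_orbit_integrand:
  assumes f: "\<And>j. j \<le> N \<Longrightarrow> test_function (f j)" and q: "tame N q"
  shows "integrable (\<Omega> \<Otimes>\<^sub>M haars N) (\<lambda>y. orbit_integrand f N y * complex_of_real (q y))"
proof -
  obtain B R where BR: "0 \<le> B" "0 \<le> R" "\<And>j g. j \<le> N \<Longrightarrow> norm (f j g) \<le> B"
    "\<And>j g. j \<le> N \<Longrightarrow> norm (snd g) > R \<Longrightarrow> f j g = 0"
    using test_functions_uniform_bounds[of N f] f by metis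
  obtain Q where Q: "\<And>\<omega> g. (\<forall>j\<in>{1..N}. norm (snd (g j)) \<le> R) \<Longrightarrow> \<bar>q (\<omega>, g)\<bar> \<le> Q"
    using q unfolding tame_def by blast
  interpret haars: sigma_finite_measure "haars N" by (rule sigma_finite_haars)
  \<comment> \<open>The orbit point is a product of \<open>N + 1\<close> elements whose vector components have norm at most \<open>R\<close>.\<close>
  define W where "W = (space \<nu> \<times> space \<mu>) \<times> cball (0::'v) (real (Suc N) * R)"
  define T where "T = Pi\<^sub>E {1..N} (\<lambda>_. {h :: 'k \<times> 'v. norm (snd h) \<le> R})"
  have slab: "{h. norm (snd h) \<le> R} \<in> sets haar"
    by simp
  have W: "W \<in> sets \<Omega>" unfolding W_def by (intro pair_measureI) auto
  have T: "T \<in> sets (haars N)"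
    unfolding T_def using slab by (intro sets_PiM_I_finite) auto
  have q_meas [measurable]: "q \<in> borel_measurable (\<Omega> \<Otimes>\<^sub>M haars N)" using q by (simp add: tame_def)
  have [measurable]: "orbit_integrand f N \<in> borel_measurable (\<Omega> \<Otimes>\<^sub>M haars N)"
    using f by (intro orbit_integrand_measurable) (auto simp: test_function_def)
  show ?thesis
  proof (rule integrableI_bounded_set[where A="W \<times> T" and B="B * B ^ N * Q"])
    show "W \<times> T \<in> sets (\<Omega> \<Otimes>\<^sub>M haars N)" using W T by auto
    have "emeasure \<Omega> W = emeasure \<nu> (space \<nu>) * emeasure \<mu> (space \<mu>) * emeasure perp (cball 0 (real (Suc N) * R))"
      unfolding W_def by (subst perp.emeasure_pair_measure_Times) (auto simp: \<mu>.emeasure_pair_measure_Times)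
    also have "\<dots> < \<infinity>"
      using \<nu>.emeasure_finite[of "space \<nu>"] \<mu>.emeasure_finite[of "space \<mu>"]
        emeasure_euclidean_cball_finite[OF finite_dim_V subspace_orthogonal_comp, of A "real (Suc N) * R"]
      by (simp add: ennreal_mult_eq_top_iff less_top[symmetric])
    finally have W': "emeasure \<Omega> W < \<infinity>" .
    have "emeasure (haars N) T = emeasure haar {h. norm (snd h) \<le> R} ^ N"
      unfolding T_def by (subst haar_power.emeasure_PiM) (use slab in auto)
    then have T': "emeasure (haars N) T < \<infinity>"
      using emeasure_haar_slab[of R] by (simp add: power_less_top_ennreal)
    show "emeasure (\<Omega> \<Otimes>\<^sub>M haars N) (W \<times> T) < \<infinity>"
      using W' T' by (subst haars.emeasure_pair_measure_Times[OF W T]) (simp add: ennreal_mult_less_top)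
    show "AE y in \<Omega> \<Otimes>\<^sub>M haars N. y \<in> W \<times> T \<longrightarrow> norm (orbit_integrand f N y * complex_of_real (q y)) \<le> B * B ^ N * Q"
    proof (intro AE_I2 impI)
      fix y assume "y \<in> W \<times> T"
      then obtain \<omega> g where y: "y = (\<omega>, g)" "g \<in> T" by auto
      have "\<bar>q y\<bar> \<le> Q" using Q[of g \<omega>] y by (auto simp: T_def)
      moreover have "norm (\<Prod>j=1..N. f j (g j)) \<le> (\<Prod>j=1..N. B)"
        unfolding prod_norm[symmetric] by (intro prod_mono) (auto intro: BR)
      moreover have "norm (f 0 (orbit_point \<omega> \<otimes>\<^bsub>G\<^esub> inv\<^bsub>G\<^esub> (segment_prod G g 1 N))) \<le> B"
        by (rule BR) simp
      ultimately show "norm (orbit_integrand f N y * complex_of_real (q y)) \<le> B * B ^ N * Q"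
        unfolding y orbit_integrand_def using BR(1)
        by (auto simp: norm_mult intro!: mult_mono)
    qed
    show "AE y in \<Omega> \<Otimes>\<^sub>M haars N. y \<notin> W \<times> T \<longrightarrow> orbit_integrand f N y * complex_of_real (q y) = 0"
    proof (intro AE_I2 impI)
      fix y assume y: "y \<in> space (\<Omega> \<Otimes>\<^sub>M haars N)" "y \<notin> W \<times> T"
      obtain C u w g where y': "y = (((C, u), w), g)" by (metis prod.exhaust)
      consider j where "j \<in> {1..N}" "norm (snd (g j)) > R" | "\<forall>j\<in>{1..N}. norm (snd (g j)) \<le> R"
        by force
      then have "orbit_integrand f N y = 0"
      proof cases
        case 1
        then have "f j (g j) = 0" using BR(4)[of j "g j"] by simp
        with 1(1) show ?thesis by (auto simp: y' orbit_integrand_def)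
      next
        case 2
        with y have "norm w > real (Suc N) * R"
          by (auto simp: y' W_def T_def space_pair_measure space_PiM PiE_def)
        moreover have "norm (snd (segment_prod G g 1 N)) \<le> real N * R"
          using norm_snd_segment_prod_le[of 1 N g R] 2 BR(2) by simp
        moreover have "norm w \<le> norm (snd (orbit_point ((C,u),w) \<otimes>\<^bsub>G\<^esub> inv\<^bsub>G\<^esub> (segment_prod G g 1 N))) + norm (snd (segment_prod G g 1 N))"
        proof -
          have "orbit_point ((C,u),w) = orbit_point ((C,u),w) \<otimes>\<^bsub>G\<^esub> inv\<^bsub>G\<^esub> (segment_prod G g 1 N) \<otimes>\<^bsub>G\<^esub> segment_prod G g 1 N"
            by (simp add: G.m_assoc)
          then have "norm (snd (orbit_point ((C,u),w))) \<le> norm (snd (orbit_point ((C,u),w) \<otimes>\<^bsub>G\<^esub> inv\<^bsub>G\<^esub> (segment_prod G g 1 N))) + norm (snd (segment_prod G g 1 N))"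
            using norm_snd_mult_G_le by metis
          then show ?thesis by (simp add: orbit_point_def)
        qed
        ultimately have "norm (snd (orbit_point ((C,u),w) \<otimes>\<^bsub>G\<^esub> inv\<^bsub>G\<^esub> (segment_prod G g 1 N))) > R"
          by (simp add: algebra_simps)
        then show ?thesis using BR(4)[of 0] by (simp add: y' orbit_integrand_def)
      qed
      then show "orbit_integrand f N y * complex_of_real (q y) = 0" by simp
    qed
  qed measurable
qed

text \<open>
  The product measure is associated to the left, so that Fubini can be applied to one outer pair at a time; the
  integral over the last factor is then again integrable, without exceptional null sets.
\<close>
lemma nested_integral:
  fixes F :: "(('k set \<times> 'k) \<times> 'v) \<times> (nat \<Rightarrow> 'k \<times> 'v) \<Rightarrow> complex"
  assumes F: "integrable (\<Omega> \<Otimes>\<^sub>M haars N) F"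
  shows "(\<integral>C. \<integral>u. \<integral>w. \<integral>g. F (((C, u), w), g) \<partial>haars N \<partial>perp \<partial>\<mu> \<partial>\<nu>) = integral\<^sup>L (\<Omega> \<Otimes>\<^sub>M haars N) F"
proof -
  interpret haars: sigma_finite_measure "haars N" by (rule sigma_finite_haars)
  interpret Y: pair_sigma_finite \<Omega> "haars N" ..
  note 1 = Y.integrable_fst'[OF F]
  note 2 = \<Omega>.integrable_fst'[OF 1]
  show ?thesis
    by (simp only: Y.integral_fst'[OF F, symmetric] \<Omega>.integral_fst'[OF 1, symmetric] \<nu>\<mu>.integral_fst'[OF 2, symmetric])
qed

lemma tame_proj_column:
  assumes "j \<in> {1..N}"
  shows "tame N (\<lambda>y. proj_column N (snd (fst (fst y))) (snd y) j i)"
  unfolding tame_def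
proof (intro conjI allI)
  show "(\<lambda>y. proj_column N (snd (fst (fst y))) (snd y) j i) \<in> borel_measurable (\<Omega> \<Otimes>\<^sub>M haars N)"
    using assms by measurable
  fix R :: real
  let ?R = "max 0 R"
  show "\<exists>B. \<forall>\<omega> g. (\<forall>j\<in>{1..N}. norm (snd (g j)) \<le> R) \<longrightarrow>
      \<bar>proj_column N (snd (fst (fst (\<omega>::('k set \<times> 'k) \<times> 'v, g)))) (snd (\<omega>, g)) j i\<bar> \<le> B"
  proof (intro exI allI impI)
    fix \<omega> :: "('k set \<times> 'k) \<times> 'v" and g :: "nat \<Rightarrow> 'k \<times> 'v"
    assume g: "\<forall>j\<in>{1..N}. norm (snd (g j)) \<le> R"
    have s: "norm (snd (segment_prod G g l N)) \<le> real N * ?R" if "1 \<le> l" for l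
    proof -
      have "norm (snd (segment_prod G g l N)) \<le> real (Suc N - l) * ?R"
        using g that by (intro norm_snd_segment_prod_le) (auto simp: le_max_iff_disj)
      also have "\<dots> \<le> real N * ?R" using that by (intro mult_right_mono) auto
      finally show ?thesis .
    qed
    define v where "v = snd (segment_prod G g j N) - snd (segment_prod G g (Suc j) N)"
    have "norm v \<le> real N * ?R + real N * ?R"
      unfolding v_def using s[of j] s[of "Suc j"] assms norm_triangle_ineq4 by (smt (verit) atLeastAtMost_iff le_Suc_eq)
    then have "norm v * norm (e i) \<le> (real N * ?R + real N * ?R) * norm (e i)"
      by (intro mult_right_mono) auto
    then show "\<bar>proj_column N (snd (fst (fst (\<omega>, g)))) (snd (\<omega>, g)) j i\<bar> \<le> (real N * ?R + real N * ?R) * norm (e i)"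
      using Cauchy_Schwarz_ineq2[of "act (inv\<^bsub>K\<^esub> (snd (fst \<omega>))) v" "e i"]
      by (simp add: proj_column_def v_def)
  qed
qed

lemma tame_const: "tame N (\<lambda>_. c)"
  by (auto simp: tame_def)

lemma tame_add:
  assumes "tame N p" "tame N q"
  shows "tame N (\<lambda>y. p y + q y)"
  unfolding tame_def
proof (intro conjI allI)
  show "(\<lambda>y. p y + q y) \<in> borel_measurable (\<Omega> \<Otimes>\<^sub>M haars N)"
    using assms by (auto simp: tame_def)
  fix R :: real
  obtain P Q where PQ: "\<And>\<omega> g. \<forall>j\<in>{1..N}. norm (snd (g j)) \<le> R \<Longrightarrow> \<bar>p (\<omega>, g)\<bar> \<le> P"
    "\<And>\<omega> g. \<forall>j\<in>{1..N}. norm (snd (g j)) \<le> R \<Longrightarrow> \<bar>q (\<omega>, g)\<bar> \<le> Q"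
    using assms unfolding tame_def by meson
  show "\<exists>B. \<forall>\<omega> g. (\<forall>j\<in>{1..N}. norm (snd (g j)) \<le> R) \<longrightarrow> \<bar>p (\<omega>, g) + q (\<omega>, g)\<bar> \<le> B"
  proof (intro exI[of _ "P + Q"] allI impI)
    fix \<omega> and g :: "nat \<Rightarrow> 'k \<times> 'v" assume g: "\<forall>j\<in>{1..N}. norm (snd (g j)) \<le> R"
    show "\<bar>p (\<omega>, g) + q (\<omega>, g)\<bar> \<le> P + Q"
      using PQ(1)[OF g, of \<omega>] PQ(2)[OF g, of \<omega>] by linarith
  qed
qed

lemma tame_mult:
  assumes "tame N p" "tame N q"
  shows "tame N (\<lambda>y. p y * q y)"
  unfolding tame_def
proof (intro conjI allI)
  show "(\<lambda>y. p y * q y) \<in> borel_measurable (\<Omega> \<Otimes>\<^sub>M haars N)"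
    using assms by (auto simp: tame_def)
  fix R :: real
  obtain P Q where PQ: "\<And>\<omega> g. \<forall>j\<in>{1..N}. norm (snd (g j)) \<le> R \<Longrightarrow> \<bar>p (\<omega>, g)\<bar> \<le> P"
    "\<And>\<omega> g. \<forall>j\<in>{1..N}. norm (snd (g j)) \<le> R \<Longrightarrow> \<bar>q (\<omega>, g)\<bar> \<le> Q"
    using assms unfolding tame_def by meson
  show "\<exists>B. \<forall>\<omega> g. (\<forall>j\<in>{1..N}. norm (snd (g j)) \<le> R) \<longrightarrow> \<bar>p (\<omega>, g) * q (\<omega>, g)\<bar> \<le> B"
  proof (intro exI[of _ "P * Q"] allI impI)
    fix \<omega> and g :: "nat \<Rightarrow> 'k \<times> 'v" assume g: "\<forall>j\<in>{1..N}. norm (snd (g j)) \<le> R"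
    have "0 \<le> P" using PQ(1)[OF g, of \<omega>] by linarith
    then show "\<bar>p (\<omega>, g) * q (\<omega>, g)\<bar> \<le> P * Q"
      using PQ(1)[OF g, of \<omega>] PQ(2)[OF g, of \<omega>] by (auto simp: abs_mult intro!: mult_mono)
  qed
qed

lemma tame_sum: "(\<And>i. i \<in> I \<Longrightarrow> tame N (q i)) \<Longrightarrow> tame N (\<lambda>y. \<Sum>i\<in>I. q i y)"
  by (induction I rule: infinite_finite_induct) (auto intro: tame_const tame_add)

lemma tame_prod: "(\<And>i. i \<in> I \<Longrightarrow> tame N (q i)) \<Longrightarrow> tame N (\<lambda>y. \<Prod>i\<in>I. q i y)"
  by (induction I rule: infinite_finite_induct) (auto intro: tame_const tame_mult)

lemma tame_leibniz_det:
  assumes "\<And>j i. j \<in> {1..n} \<Longrightarrow> tame N (\<lambda>y. a y j i)"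
  shows "tame N (\<lambda>y. leibniz_det n (a y))"
  unfolding leibniz_det_def by (intro tame_sum tame_mult tame_prod tame_const assms)

text \<open>
  The integrand of the convolution at \<open>g\<close> lives on \<open>norm (snd h) \<le> R\<close>, a set of finite measure, and vanishes
  identically when \<open>g\<close> has vector component of norm larger than \<open>R + R'\<close>, by the triangle inequality.
\<close>
lemma test_function_convolution:
  assumes "test_function f" "test_function f'"
  shows "test_function (convolution K act \<mu> f f')"
proof -
  obtain B R where B: "\<And>g. norm (f g) \<le> B" and R: "\<And>g. norm (snd g) > R \<Longrightarrow> f g = 0"
    and [measurable]: "f \<in> borel_measurable borel"
    using assms(1) unfolding test_function_def by blast
  obtain B' R' where B': "\<And>g. norm (f' g) \<le> B'" and R': "\<And>g. norm (snd g) > R' \<Longrightarrow> f' g = 0"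
    and [measurable]: "f' \<in> borel_measurable borel"
    using assms(2) unfolding test_function_def by blast
  have "0 \<le> B" "0 \<le> B'" using B B' norm_ge_zero order_trans by blast+
  let ?S = "{h :: 'k \<times> 'v. norm (snd h) \<le> R}"
  have S: "?S \<in> sets haar" by simp
  let ?F = "\<lambda>g h. f h * f' (inv\<^bsub>G\<^esub> h \<otimes>\<^bsub>G\<^esub> g)"
  have "(\<lambda>g. \<integral>h. ?F g h \<partial>haar) \<in> borel_measurable borel"
    by (rule haar.borel_measurable_lebesgue_integral) measurable
  then have meas: "convolution K act \<mu> f f' \<in> borel_measurable borel"
    by (simp add: convolution_def[abs_def])
  have bound: "norm (convolution K act \<mu> f f' g) \<le> (\<integral>h. indicator ?S h * (B * B') \<partial>haar)" for g
  proof -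
    have le: "norm (?F g h) \<le> indicator ?S h * (B * B')" for h
      using B[of h] B'[of "inv\<^bsub>G\<^esub> h \<otimes>\<^bsub>G\<^esub> g"] R[of h] \<open>0 \<le> B\<close> \<open>0 \<le> B'\<close>
      by (auto simp: norm_mult indicator_def intro!: mult_mono)
    have int: "integrable haar (\<lambda>h. indicator ?S h * (B * B'))"
      using S emeasure_haar_slab[of R] by simp
    have "integrable haar (?F g)"
      by (rule Bochner_Integration.integrable_bound[OF int]) (measurable, use le in \<open>auto intro!: AE_I2 order_trans[OF _ abs_ge_self]\<close>)
    then show ?thesis
      unfolding convolution_def using int le
      by (intro order_trans[OF integral_norm_bound] integral_mono) auto
  qed
  have supp: "convolution K act \<mu> f f' g = 0" if g: "norm (snd g) > R + R'" for g
  proof -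
    have "?F g h = 0" for h
    proof (cases "norm (snd h) > R")
      case True then show ?thesis using R by simp
    next
      case False
      have "norm (snd g) \<le> norm (snd h) + norm (snd (inv\<^bsub>G\<^esub> h \<otimes>\<^bsub>G\<^esub> g))"
        using norm_snd_mult_G_le[of h "inv\<^bsub>G\<^esub> h \<otimes>\<^bsub>G\<^esub> g"] by (simp flip: G.m_assoc)
      then show ?thesis using False g R' by simp
    qed
    then show ?thesis unfolding convolution_def by (simp only: Bochner_Integration.integral_zero)
  qed
  show ?thesis
    unfolding test_function_def using meas bound supp by blast
qed

end

section \<open>Changes of variables\<close>

lemma change_of_variables:
  fixes H :: "'b \<Rightarrow> 'c::{banach,second_countable_topology}"
  assumes T: "T \<in> M \<rightarrow>\<^sub>M N"
    and pres: "\<And>F. F \<in> borel_measurable N \<Longrightarrow> (\<integral>\<^sup>+y. F (T y) \<partial>M) = (\<integral>\<^sup>+y. F y \<partial>N)"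
    and H: "integrable N H"
  shows "integrable M (\<lambda>y. H (T y))" "(\<integral>y. H (T y) \<partial>M) = (\<integral>y. H y \<partial>N)"
proof -
  have D: "distr M N T = N"
  proof (rule measure_eqI)
    fix S assume "S \<in> sets (distr M N T)"
    then have S: "S \<in> sets N" by simp
    have "emeasure (distr M N T) S = (\<integral>\<^sup>+y. indicator S y \<partial>distr M N T)"
      using S by simp
    also have "\<dots> = (\<integral>\<^sup>+y. indicator S (T y) \<partial>M)"
      by (rule nn_integral_distr[OF T]) (use S in simp)
    also have "\<dots> = (\<integral>\<^sup>+y. indicator S y \<partial>N)"
      by (rule pres) (use S in simp)
    finally show "emeasure (distr M N T) S = emeasure N S" using S by simp
  qed simp
  show "integrable M (\<lambda>y. H (T y))"
    using integrable_distr_eq[OF T, of H] H D by simp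
  show "(\<integral>y. H (T y) \<partial>M) = (\<integral>y. H y \<partial>N)"
    using integral_distr[OF T, of H] H D by simp
qed

context orbital_setting
begin

text \<open>
  Conjugation of \<open>y\<close> by \<open>h = (k, v)\<close> in orbit coordinates: with \<open>u' = k\<^sup>-\<^sup>1 u\<close> and \<open>t = u'\<^sup>-\<^sup>1 v\<close>, the
  point \<open>h\<^sup>-\<^sup>1 y h\<close> has the coordinates \<open>(u', w + t - m\<^sup>-\<^sup>1 t)\<close>.
\<close>
definition conj_point :: "'k \<times> 'v \<Rightarrow> ('k set \<times> 'k) \<times> 'v \<Rightarrow> ('k set \<times> 'k) \<times> 'v" where
  "conj_point h \<omega> =
    (let t = act (inv\<^bsub>K\<^esub> (snd (fst \<omega>)) \<otimes>\<^bsub>K\<^esub> fst h) (snd h)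
     in ((fst (fst \<omega>), inv\<^bsub>K\<^esub> (fst h) \<otimes>\<^bsub>K\<^esub> snd (fst \<omega>)),
         snd \<omega> + (t - act (inv\<^bsub>K\<^esub> (conj_of (fst (fst \<omega>)))) t)))"

lemma conj_point_measurable [measurable (raw)]:
  assumes [measurable]: "h \<in> M \<rightarrow>\<^sub>M borel" "\<omega> \<in> M \<rightarrow>\<^sub>M \<Omega>"
  shows "(\<lambda>y. conj_point (h y) (\<omega> y)) \<in> M \<rightarrow>\<^sub>M \<Omega>"
proof -
  have [measurable]: "(\<lambda>y. fst (h y)) \<in> M \<rightarrow>\<^sub>M borel" "(\<lambda>y. snd (h y)) \<in> M \<rightarrow>\<^sub>M borel"
    using assms(1) by (rule fst_borel, rule snd_borel)
  have fst_\<omega>: "(\<lambda>y. fst (\<omega> y)) \<in> M \<rightarrow>\<^sub>M \<nu> \<Otimes>\<^sub>M \<mu>"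
    by (rule measurable_compose[OF assms(2) measurable_fst])
  have [measurable]: "(\<lambda>y. fst (fst (\<omega> y))) \<in> M \<rightarrow>\<^sub>M \<nu>"
    by (rule measurable_compose[OF fst_\<omega> measurable_fst])
  have [measurable]: "(\<lambda>y. snd (fst (\<omega> y))) \<in> M \<rightarrow>\<^sub>M borel"
    using measurable_compose[OF fst_\<omega> measurable_snd] by (simp cong: measurable_cong_sets)
  have [measurable]: "(\<lambda>y. snd (\<omega> y)) \<in> M \<rightarrow>\<^sub>M borel"
    using measurable_compose[OF assms(2) measurable_snd] by (simp cong: measurable_cong_sets)
  show ?thesis unfolding conj_point_def Let_def by measurable
qed

lemma orbit_point_conj:
  "orbit_point (conj_point h \<omega>) = inv\<^bsub>G\<^esub> h \<otimes>\<^bsub>G\<^esub> orbit_point \<omega> \<otimes>\<^bsub>G\<^esub> h"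
  by (simp add: orbit_point_def conj_point_def Let_def mult_G inv_G K.inv_mult_group K.m_assoc
      act_mult act_add act_diff act_minus)

lemma diff_act_conj_of_orthogonal:
  assumes "C \<in> space \<nu>"
  shows "t - act (inv\<^bsub>K\<^esub> (conj_of C)) t \<in> A\<^sup>\<bottom>"
proof -
  have "a \<bullet> act (inv\<^bsub>K\<^esub> (conj_of C)) t = a \<bullet> t" if "a \<in> A" for a
    using inner_act[of "conj_of C" a "act (inv\<^bsub>K\<^esub> (conj_of C)) t"] act_conj_of_fixes[OF assms that] by simp
  then show ?thesis
    by (simp add: orthogonal_comp_def orthogonal_def inner_diff_right)
qed

lemma nn_integral_\<Omega>:
  assumes [measurable]: "F \<in> borel_measurable \<Omega>"
  shows "(\<integral>\<^sup>+\<omega>. F \<omega> \<partial>\<Omega>) = (\<integral>\<^sup>+C. \<integral>\<^sup>+u. \<integral>\<^sup>+w. F ((C, u), w) \<partial>perp \<partial>\<mu> \<partial>\<nu>)"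
  by (subst perp.nn_integral_fst[symmetric], measurable, subst \<mu>.nn_integral_fst[symmetric], measurable)

text \<open>
  The shift of \<open>w\<close> depends on the other coordinates but lies in \<open>A\<^sup>\<bottom>\<close>, so it is removed first by translation
  invariance; then left invariance of \<open>\<mu>\<close> removes \<open>k\<^sup>-\<^sup>1\<close>.
\<close>
lemma nn_integral_conj_point:
  assumes F [measurable]: "F \<in> borel_measurable \<Omega>"
  shows "(\<integral>\<^sup>+\<omega>. F (conj_point h \<omega>) \<partial>\<Omega>) = (\<integral>\<^sup>+\<omega>. F \<omega> \<partial>\<Omega>)"
proof -
  have "(\<integral>\<^sup>+\<omega>. F (conj_point h \<omega>) \<partial>\<Omega>) = (\<integral>\<^sup>+C. \<integral>\<^sup>+u. \<integral>\<^sup>+w. F (conj_point h ((C, u), w)) \<partial>perp \<partial>\<mu> \<partial>\<nu>)"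
    by (rule nn_integral_\<Omega>) measurable
  also have "\<dots> = (\<integral>\<^sup>+C. \<integral>\<^sup>+u. \<integral>\<^sup>+w. F ((C, inv\<^bsub>K\<^esub> (fst h) \<otimes>\<^bsub>K\<^esub> u), w) \<partial>perp \<partial>\<mu> \<partial>\<nu>)"
  proof (rule nn_integral_cong, rule nn_integral_cong)
    fix C u assume C: "C \<in> space \<nu>"
    have [measurable]: "(\<lambda>w. F ((C, inv\<^bsub>K\<^esub> (fst h) \<otimes>\<^bsub>K\<^esub> u), w)) \<in> borel_measurable borel"
      using measurable_compose[OF _ F, of "\<lambda>w. ((C, inv\<^bsub>K\<^esub> (fst h) \<otimes>\<^bsub>K\<^esub> u), w)" borel] C by measurable
    show "(\<integral>\<^sup>+w. F (conj_point h ((C, u), w)) \<partial>perp) = (\<integral>\<^sup>+w. F ((C, inv\<^bsub>K\<^esub> (fst h) \<otimes>\<^bsub>K\<^esub> u), w) \<partial>perp)"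
      unfolding conj_point_def Let_def fst_conv snd_conv
      by (rule nn_integral_euclidean_translate[OF finite_dim_V subspace_orthogonal_comp diff_act_conj_of_orthogonal[OF C],
            where F="\<lambda>w. F ((C, inv\<^bsub>K\<^esub> (fst h) \<otimes>\<^bsub>K\<^esub> u), w)"]) measurable
  qed
  also have "\<dots> = (\<integral>\<^sup>+C. \<integral>\<^sup>+u. \<integral>\<^sup>+w. F ((C, u), w) \<partial>perp \<partial>\<mu> \<partial>\<nu>)"
  proof (rule nn_integral_cong)
    fix C assume C [measurable]: "C \<in> space \<nu>"
    show "(\<integral>\<^sup>+u. \<integral>\<^sup>+w. F ((C, inv\<^bsub>K\<^esub> (fst h) \<otimes>\<^bsub>K\<^esub> u), w) \<partial>perp \<partial>\<mu>) = (\<integral>\<^sup>+u. \<integral>\<^sup>+w. F ((C, u), w) \<partial>perp \<partial>\<mu>)"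
      by (rule nn_integral_mult_K[where F="\<lambda>u. \<integral>\<^sup>+w. F ((C, u), w) \<partial>perp"]) measurable
  qed
  also have "\<dots> = (\<integral>\<^sup>+\<omega>. F \<omega> \<partial>\<Omega>)"
    by (rule nn_integral_\<Omega>[symmetric]) measurable
  finally show ?thesis .
qed

lemma nn_integral_Y:
  assumes [measurable]: "F \<in> borel_measurable (\<Omega> \<Otimes>\<^sub>M haars N)"
  shows "(\<integral>\<^sup>+y. F y \<partial>(\<Omega> \<Otimes>\<^sub>M haars N)) = (\<integral>\<^sup>+\<omega>. \<integral>\<^sup>+g. F (\<omega>, g) \<partial>haars N \<partial>\<Omega>)"
proof -
  interpret haars: sigma_finite_measure "haars N" by (rule sigma_finite_haars)
  show ?thesis by (rule haars.nn_integral_fst[symmetric]) measurable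
qed

lemma nn_integral_Y_haar:
  assumes [measurable]: "F \<in> borel_measurable ((\<Omega> \<Otimes>\<^sub>M haars N) \<Otimes>\<^sub>M haar)"
  shows "(\<integral>\<^sup>+y. F y \<partial>((\<Omega> \<Otimes>\<^sub>M haars N) \<Otimes>\<^sub>M haar)) = (\<integral>\<^sup>+\<omega>. \<integral>\<^sup>+g. \<integral>\<^sup>+h. F ((\<omega>, g), h) \<partial>haar \<partial>haars N \<partial>\<Omega>)"
  by (subst haar.nn_integral_fst[symmetric], measurable, subst nn_integral_Y) measurable

lemma nn_integral_Y_Suc:
  assumes F [measurable]: "F \<in> borel_measurable (\<Omega> \<Otimes>\<^sub>M haars (Suc N))" and i: "i \<in> {1..Suc N}"
  shows "(\<integral>\<^sup>+y. F y \<partial>(\<Omega> \<Otimes>\<^sub>M haars (Suc N))) =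
    (\<integral>\<^sup>+\<omega>. \<integral>\<^sup>+g. \<integral>\<^sup>+h. F (\<omega>, insert_coord N i g h) \<partial>haar \<partial>haars N \<partial>\<Omega>)"
  unfolding nn_integral_Y[OF F]
  by (intro nn_integral_cong nn_integral_insert_coord[OF haar.sigma_finite_measure_axioms i]) measurable

lemma nn_integral_mult_coord:
  assumes F [measurable]: "F \<in> borel_measurable (haars N)" and i: "i \<in> {1..N}"
  shows "(\<integral>\<^sup>+g. F (g(i := a \<otimes>\<^bsub>G\<^esub> g i)) \<partial>haars N) = (\<integral>\<^sup>+g. F g \<partial>haars N)"
proof -
  obtain m where N: "N = Suc m" using i by (cases N) auto
  have i': "i \<in> {1..Suc m}" using i N by simp
  have upd: "(insert_coord m i g h)(i := a \<otimes>\<^bsub>G\<^esub> insert_coord m i g h i) = insert_coord m i g (a \<otimes>\<^bsub>G\<^esub> h)" for g h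
    using i' by (auto simp: insert_coord_def fun_eq_iff)
  have F': "F \<in> borel_measurable (haars (Suc m))" using F by (simp add: N)
  have "(\<lambda>g. g(i := a \<otimes>\<^bsub>G\<^esub> g i)) \<in> haars (Suc m) \<rightarrow>\<^sub>M haars (Suc m)"
  proof (rule measurable_fun_upd)
    show "{1..Suc m} = {1..Suc m} \<union> {i}" using i' by auto
    have [measurable]: "(\<lambda>g. g i) \<in> haars (Suc m) \<rightarrow>\<^sub>M borel"
      by (rule component_haars[OF _ i']) measurable
    show "(\<lambda>g. a \<otimes>\<^bsub>G\<^esub> g i) \<in> haars (Suc m) \<rightarrow>\<^sub>M haar" by measurable
  qed measurable
  from measurable_compose[OF this F']
  have "(\<integral>\<^sup>+g. F (g(i := a \<otimes>\<^bsub>G\<^esub> g i)) \<partial>haars (Suc m)) =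
      (\<integral>\<^sup>+g. \<integral>\<^sup>+h. F ((insert_coord m i g h)(i := a \<otimes>\<^bsub>G\<^esub> insert_coord m i g h i)) \<partial>haar \<partial>haars m)"
    by (rule nn_integral_insert_coord[OF haar.sigma_finite_measure_axioms i'])
  also have "\<dots> = (\<integral>\<^sup>+g. \<integral>\<^sup>+h. F (insert_coord m i g h) \<partial>haar \<partial>haars m)"
    unfolding upd
  proof (rule nn_integral_cong)
    fix g assume [measurable]: "g \<in> space (haars m)"
    have "(\<lambda>h. insert_coord m i g h) \<in> borel \<rightarrow>\<^sub>M haars (Suc m)"
      by (intro insert_coord_measurable[OF i']) measurable
    from measurable_compose[OF this F']
    show "(\<integral>\<^sup>+h. F (insert_coord m i g (a \<otimes>\<^bsub>G\<^esub> h)) \<partial>haar) = (\<integral>\<^sup>+h. F (insert_coord m i g h) \<partial>haar)"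
      by (rule nn_integral_mult_G)
  qed
  also have "\<dots> = (\<integral>\<^sup>+g. F g \<partial>haars (Suc m))"
    by (rule nn_integral_insert_coord[OF haar.sigma_finite_measure_axioms i' F', symmetric])
  finally show ?thesis by (simp only: N)
qed

text \<open>
  As a function of \<open>h\<close>, the argument is the inverse of \<open>z\<^sup>-\<^sup>1 h\<close>.
\<close>
lemma nn_integral_inv_mult_G:
  assumes [measurable]: "F \<in> borel_measurable borel"
  shows "(\<integral>\<^sup>+h. F (inv\<^bsub>G\<^esub> h \<otimes>\<^bsub>G\<^esub> z) \<partial>haar) = (\<integral>\<^sup>+h. F h \<partial>haar)"
proof -
  have "(\<integral>\<^sup>+h. F (inv\<^bsub>G\<^esub> h \<otimes>\<^bsub>G\<^esub> z) \<partial>haar) = (\<integral>\<^sup>+h. F (inv\<^bsub>G\<^esub> (inv\<^bsub>G\<^esub> z \<otimes>\<^bsub>G\<^esub> h)) \<partial>haar)"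
    by (simp add: G.inv_mult_group)
  also have "\<dots> = (\<integral>\<^sup>+h. F (inv\<^bsub>G\<^esub> h) \<partial>haar)"
    by (rule nn_integral_mult_G[where F="\<lambda>h. F (inv\<^bsub>G\<^esub> h)"]) measurable
  also have "\<dots> = (\<integral>\<^sup>+h. F h \<partial>haar)" by (rule nn_integral_inv_G) measurable
  finally show ?thesis .
qed

end

section \<open>The Hochschild identity\<close>

lemma prod_insert_coord:
  fixes f :: "nat \<Rightarrow> 'a \<Rightarrow> 'b::comm_monoid_mult"
  assumes i: "i \<in> {1..Suc n}"
  shows "(\<Prod>j=1..Suc n. f j (insert_coord n i g h j)) = (\<Prod>j=1..n. f (if j < i then j else Suc j) (g j)) * f i h"
proof -
  have "(\<Prod>j=1..Suc n. f j (insert_coord n i g h j)) =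
      (\<Prod>j=1..n. f (if j < i then j else Suc j) (insert_coord n i g h (if j < i then j else Suc j))) * f i (insert_coord n i g h i)"
    by (rule prod_insert_index[OF i, symmetric])
  also have "(\<Prod>j=1..n. f (if j < i then j else Suc j) (insert_coord n i g h (if j < i then j else Suc j))) =
      (\<Prod>j=1..n. f (if j < i then j else Suc j) (g j))"
    by (intro prod.cong refl) (auto simp: insert_coord_def)
  also have "insert_coord n i g h i = h"
    using i by (auto simp: insert_coord_def)
  finally show ?thesis .
qed

lemma segment_prod_insert_above:
  assumes "1 \<le> i" "i \<le> j"
  shows "segment_prod H (insert_coord n i g h) (Suc j) (Suc n) = segment_prod H g j n"
  unfolding segment_prod_shift using assms
  by (intro segment_prod_cong) (auto simp: insert_coord_def)

lemma segment_prod_insert_at: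
  assumes "i \<in> {1..Suc n}"
  shows "segment_prod H (insert_coord n i g h) i (Suc n) = h \<otimes>\<^bsub>H\<^esub> segment_prod H g i n"
proof -
  have "insert_coord n i g h i = h"
    using assms by (auto simp: insert_coord_def)
  then show ?thesis
    using assms segment_prod_Cons[of i "Suc n" H "insert_coord n i g h"] by (simp add: segment_prod_insert_above)
qed

context orbital_setting
begin

text \<open>
  Replacing the factor \<open>g i\<close> by the two factors \<open>h\<close> and \<open>h\<^sup>-\<^sup>1 g i\<close> does not change products that contain
  both.
\<close>
lemma segment_prod_insert_split:
  assumes i: "i \<in> {1..n}" and j: "1 \<le> j" "j \<le> i"
  shows "segment_prod G (insert_coord n i (g(i := inv\<^bsub>G\<^esub> h \<otimes>\<^bsub>G\<^esub> g i)) h) j (Suc n) = segment_prod G g j n"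
  using j(2,1)
proof (induction rule: inc_induct)
  case base
  have "segment_prod G (g(i := inv\<^bsub>G\<^esub> h \<otimes>\<^bsub>G\<^esub> g i)) i n = inv\<^bsub>G\<^esub> h \<otimes>\<^bsub>G\<^esub> g i \<otimes>\<^bsub>G\<^esub> segment_prod G g (Suc i) n"
    using i by (subst segment_prod_Cons) (auto intro!: arg_cong2[where f="(\<otimes>\<^bsub>G\<^esub>)"] segment_prod_cong)
  moreover have "segment_prod G g i n = g i \<otimes>\<^bsub>G\<^esub> segment_prod G g (Suc i) n"
    using i by (intro segment_prod_Cons) auto
  ultimately show ?case
    using i by (subst segment_prod_insert_at) (auto simp: G.m_assoc[symmetric])
next
  case (step l)
  have "insert_coord n i (g(i := inv\<^bsub>G\<^esub> h \<otimes>\<^bsub>G\<^esub> g i)) h l = g l"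
    using step i by (auto simp: insert_coord_def)
  moreover have "l \<le> Suc n" "l \<le> n" using step i by auto
  moreover have "segment_prod G (insert_coord n i (g(i := inv\<^bsub>G\<^esub> h \<otimes>\<^bsub>G\<^esub> g i)) h) (Suc l) (Suc n) = segment_prod G g (Suc l) n"
    by (rule step.IH) simp
  ultimately show ?case
    by (simp only: segment_prod_Cons[of l])
qed

lemma segment_prod_insert_last:
  assumes "1 \<le> j" "j \<le> Suc N"
  shows "segment_prod G (insert_coord N (Suc N) g h) j (Suc N) = segment_prod G g j N \<otimes>\<^bsub>G\<^esub> h"
proof -
  have "segment_prod G (insert_coord N (Suc N) g h) j N = segment_prod G g j N"
    using assms by (intro segment_prod_cong) (auto simp: insert_coord_def)
  then show ?thesis
    using assms by (subst segment_prod_snoc[OF G.is_group]) (auto simp: insert_coord_def)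
qed

lemma fst_segment_prod: "fst (segment_prod G g i m) = segment_prod K (\<lambda>l. fst (g l)) i m"
proof -
  have "fst (foldr (\<lambda>l p. g l \<otimes>\<^bsub>G\<^esub> p) xs \<one>\<^bsub>G\<^esub>) = foldr (\<lambda>l p. fst (g l) \<otimes>\<^bsub>K\<^esub> p) xs \<one>\<^bsub>K\<^esub>" for xs
    by (induction xs) auto
  then show ?thesis by (simp add: segment_prod_def)
qed

text \<open>
  This identifies the columns with the vectors that occur in the definition of the higher orbital integral.
\<close>
lemma snd_segment_prod_diff:
  assumes "j \<le> m"
  shows "snd (segment_prod G g j m) - snd (segment_prod G g (Suc j) m) =
    act (inv\<^bsub>K\<^esub> (segment_prod K (\<lambda>l. fst (g l)) (Suc j) m)) (snd (g j))"
  using assms by (simp add: segment_prod_Cons snd_mult_G fst_segment_prod)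

lemma act_snd_segment_prod:
  "act (segment_prod K (\<lambda>l. fst (g l)) 1 m) (snd (segment_prod G g 1 m)) =
    (\<Sum>j=1..m. act (segment_prod K (\<lambda>l. fst (g l)) 1 j) (snd (g j)))"
proof (induction m)
  case 0
  show ?case using segment_prod_empty[of G g 0] by simp
next
  case (Suc m)
  have "segment_prod G g 1 (Suc m) = segment_prod G g 1 m \<otimes>\<^bsub>G\<^esub> g (Suc m)"
    by (rule segment_prod_snoc[OF G.is_group]) auto
  moreover have "segment_prod K (\<lambda>l. fst (g l)) 1 (Suc m) = segment_prod K (\<lambda>l. fst (g l)) 1 m \<otimes>\<^bsub>K\<^esub> fst (g (Suc m))"
    by (rule segment_prod_snoc[OF K.is_group]) auto
  ultimately show ?case
    using Suc by (simp add: snd_mult_G act_add act_mult)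
qed

definition det_factor :: "(('k set \<times> 'k) \<times> 'v) \<times> (nat \<Rightarrow> 'k \<times> 'v) \<Rightarrow> real" where
  "det_factor y = leibniz_det n (proj_column n (snd (fst (fst y))) (snd y))"

lemma tame_det_factor: "tame n det_factor"
  unfolding det_factor_def[abs_def] by (intro tame_leibniz_det tame_proj_column)

lemma higher_orbital_perm_eq:
  assumes "\<And>j. j \<le> n \<Longrightarrow> test_function (f j)"
  shows "higher_orbital_perm K act \<mu> \<nu> A e n x \<sigma> f =
    (\<integral>y. orbit_integrand f n y * complex_of_real (\<Prod>j=1..n. proj_column n (snd (fst (fst y))) (snd y) j (\<sigma> j)) \<partial>(\<Omega> \<Otimes>\<^sub>M haars n))"
    (is "_ = integral\<^sup>L _ ?F")
proof -
  have F: "integrable (\<Omega> \<Otimes>\<^sub>M haars n) ?F"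
    by (intro integrable_orbit_integrand assms tame_prod tame_proj_column)
  have "?F (((C, u), w), g) = (let P = segment_prod K (\<lambda>l. fst (g l))
         in f 0 (u \<otimes>\<^bsub>K\<^esub> coset_conj K x C \<otimes>\<^bsub>K\<^esub> inv\<^bsub>K\<^esub> u \<otimes>\<^bsub>K\<^esub> inv\<^bsub>K\<^esub> (P 1 n),
                 act (P 1 n \<otimes>\<^bsub>K\<^esub> u) w - (\<Sum>j=1..n. act (P 1 j) (snd (g j))))
            * (\<Prod>j=1..n. f j (g j))
            * complex_of_real
                (\<Prod>j=1..n. act (inv\<^bsub>K\<^esub> u) (act (inv\<^bsub>K\<^esub> (P (j + 1) n)) (snd (g j))) \<bullet> e (\<sigma> j)))" for C u w g
  proof -
    have "orbit_point ((C, u), w) \<otimes>\<^bsub>G\<^esub> inv\<^bsub>G\<^esub> (segment_prod G g 1 n) =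
        (u \<otimes>\<^bsub>K\<^esub> coset_conj K x C \<otimes>\<^bsub>K\<^esub> inv\<^bsub>K\<^esub> u \<otimes>\<^bsub>K\<^esub> inv\<^bsub>K\<^esub> (segment_prod K (\<lambda>l. fst (g l)) 1 n),
          act (segment_prod K (\<lambda>l. fst (g l)) 1 n \<otimes>\<^bsub>K\<^esub> u) w - (\<Sum>j=1..n. act (segment_prod K (\<lambda>l. fst (g l)) 1 j) (snd (g j))))"
      by (simp only: act_snd_segment_prod[symmetric])
        (simp add: orbit_point_def mult_G inv_G fst_segment_prod act_mult)
    moreover have "(\<Prod>j=1..n. proj_column n u g j (\<sigma> j)) =
        (\<Prod>j=1..n. act (inv\<^bsub>K\<^esub> u) (act (inv\<^bsub>K\<^esub> (segment_prod K (\<lambda>l. fst (g l)) (j + 1) n)) (snd (g j))) \<bullet> e (\<sigma> j))"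
      by (intro prod.cong refl) (auto simp: proj_column_def snd_segment_prod_diff)
    ultimately show ?thesis
      by (simp add: orbit_integrand_def Let_def)
  qed
  then show ?thesis
    unfolding higher_orbital_perm_def nested_integral[OF F, symmetric] by presburger
qed

text \<open>
  Absolute convergence allows the sum over permutations to be taken inside the integral.
\<close>
lemma higher_orbital_integral_eq:
  assumes f: "\<And>j. j \<le> n \<Longrightarrow> test_function (f j)"
  shows "higher_orbital_integral K act \<mu> \<nu> A e n x f =
    (\<integral>y. orbit_integrand f n y * complex_of_real (det_factor y) \<partial>(\<Omega> \<Otimes>\<^sub>M haars n))"
proof -
  let ?p = "\<lambda>\<sigma> y. \<Prod>j=1..n. proj_column n (snd (fst (fst y))) (snd y) j (\<sigma> j)"
  have int: "integrable (\<Omega> \<Otimes>\<^sub>M haars n) (\<lambda>y. orbit_integrand f n y * complex_of_real (?p \<sigma> y))" for \<sigma>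
    by (intro integrable_orbit_integrand assms tame_prod tame_proj_column)
  have "higher_orbital_integral K act \<mu> \<nu> A e n x f =
      (\<Sum>\<sigma> | \<sigma> permutes {1..n}. \<integral>y. of_int (sign \<sigma>) * (orbit_integrand f n y * complex_of_real (?p \<sigma> y)) \<partial>(\<Omega> \<Otimes>\<^sub>M haars n))"
    by (simp only: higher_orbital_integral_def higher_orbital_perm_eq[OF f] integral_mult_right_zero)
  also have "\<dots> = (\<integral>y. (\<Sum>\<sigma> | \<sigma> permutes {1..n}. of_int (sign \<sigma>) * (orbit_integrand f n y * complex_of_real (?p \<sigma> y))) \<partial>(\<Omega> \<Otimes>\<^sub>M haars n))"
    by (rule Bochner_Integration.integral_sum[symmetric]) (intro integrable_mult_right int)
  also have "(\<lambda>y. \<Sum>\<sigma> | \<sigma> permutes {1..n}. of_int (sign \<sigma>) * (orbit_integrand f n y * complex_of_real (?p \<sigma> y))) =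
      (\<lambda>y. orbit_integrand f n y * complex_of_real (det_factor y))"
    by (simp add: det_factor_def leibniz_det_def sum_distrib_left mult_ac)
  finally show ?thesis .
qed

text \<open>
  The common frame of the three kinds of Hochschild terms: \<open>T\<close> is the substitution that absorbs the integration
  variable \<open>h\<close> of the convolution as an additional group element.
\<close>
lemma integral_orbit_integrand_transform:
  assumes T: "T \<in> (\<Omega> \<Otimes>\<^sub>M haars N) \<Otimes>\<^sub>M haar \<rightarrow>\<^sub>M \<Omega> \<Otimes>\<^sub>M haars (Suc N)"
    and pres: "\<And>F. F \<in> borel_measurable (\<Omega> \<Otimes>\<^sub>M haars (Suc N)) \<Longrightarrow>
      (\<integral>\<^sup>+p. F (T p) \<partial>((\<Omega> \<Otimes>\<^sub>M haars N) \<Otimes>\<^sub>M haar)) = (\<integral>\<^sup>+y. F y \<partial>(\<Omega> \<Otimes>\<^sub>M haars (Suc N)))"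
    and f: "\<And>j. j \<le> Suc N \<Longrightarrow> test_function (f j)" and q: "tame (Suc N) q"
    and dens: "\<And>\<omega> g. orbit_integrand f' N (\<omega>, g) = (\<integral>h. orbit_integrand f (Suc N) (T ((\<omega>, g), h)) \<partial>haar)"
    and weight: "\<And>\<omega> g h. q (T ((\<omega>, g), h)) = q' (\<omega>, g)"
  shows "(\<integral>y. orbit_integrand f' N y * complex_of_real (q' y) \<partial>(\<Omega> \<Otimes>\<^sub>M haars N)) =
    (\<integral>y. orbit_integrand f (Suc N) y * complex_of_real (q y) \<partial>(\<Omega> \<Otimes>\<^sub>M haars (Suc N)))"
proof -
  interpret haars: sigma_finite_measure "haars N" by (rule sigma_finite_haars)
  interpret Y: sigma_finite_measure "\<Omega> \<Otimes>\<^sub>M haars N"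
    by (intro sigma_finite_pair_measure \<Omega>.sigma_finite_measure_axioms haars.sigma_finite_measure_axioms)
  interpret Yl: pair_sigma_finite "\<Omega> \<Otimes>\<^sub>M haars N" haar ..
  let ?H = "\<lambda>y. orbit_integrand f (Suc N) y * complex_of_real (q y)"
  note cov = change_of_variables[OF T pres integrable_orbit_integrand[OF f q]]
  have "(\<integral>y. ?H y \<partial>(\<Omega> \<Otimes>\<^sub>M haars (Suc N))) = (\<integral>p. ?H (T p) \<partial>((\<Omega> \<Otimes>\<^sub>M haars N) \<Otimes>\<^sub>M haar))"
    by (rule cov(2)[symmetric])
  also have "\<dots> = (\<integral>y. \<integral>h. ?H (T (y, h)) \<partial>haar \<partial>(\<Omega> \<Otimes>\<^sub>M haars N))"
    by (rule Yl.integral_fst'[OF cov(1), symmetric])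
  also have "\<dots> = (\<integral>y. orbit_integrand f' N y * complex_of_real (q' y) \<partial>(\<Omega> \<Otimes>\<^sub>M haars N))"
  proof (intro Bochner_Integration.integral_cong refl)
    fix y :: "(('k set \<times> 'k) \<times> 'v) \<times> (nat \<Rightarrow> 'k \<times> 'v)"
    obtain \<omega> g where y: "y = (\<omega>, g)" by (cases y)
    show "(\<integral>h. ?H (T (y, h)) \<partial>haar) = orbit_integrand f' N y * complex_of_real (q' y)"
      by (simp add: y weight dens)
  qed
  finally show ?thesis by simp
qed

lemma mult_coord_measurable:
  assumes "g \<in> M \<rightarrow>\<^sub>M haars N" "h \<in> M \<rightarrow>\<^sub>M borel" "i \<in> {1..N}"
  shows "(\<lambda>y. (g y)(i := h y \<otimes>\<^bsub>G\<^esub> g y i)) \<in> M \<rightarrow>\<^sub>M haars N"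
proof (rule measurable_fun_upd[OF _ assms(1)])
  show "{1..N} = {1..N} \<union> {i}" using assms(3) by auto
  have "(\<lambda>y. h y \<otimes>\<^bsub>G\<^esub> g y i) \<in> M \<rightarrow>\<^sub>M borel"
    by (intro mult_G_measurable assms(2) component_haars[OF assms(1,3)])
  then show "(\<lambda>y. h y \<otimes>\<^bsub>G\<^esub> g y i) \<in> M \<rightarrow>\<^sub>M haar"
    by (simp cong: measurable_cong_sets)
qed

text \<open>
  The determinant of the \<open>i\<close>-th Hochschild term, expressed by the columns of the longer tuple.
\<close>
definition merge_columns :: "nat \<Rightarrow> (('k set \<times> 'k) \<times> 'v) \<times> (nat \<Rightarrow> 'k \<times> 'v) \<Rightarrow> real" where
  "merge_columns i y = (let b = proj_column (Suc n) (snd (fst (fst y))) (snd y) in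
     leibniz_det n (\<lambda>j. if j < i then b j else if j = i then (\<lambda>r. b i r + b (Suc i) r) else b (Suc j)))"

lemma tame_merge_columns: "tame (Suc n) (merge_columns i)"
  unfolding merge_columns_def[abs_def] Let_def
proof (rule tame_leibniz_det)
  fix j r assume j: "j \<in> {1..n}"
  show "tame (Suc n) (\<lambda>y. (if j < i then proj_column (Suc n) (snd (fst (fst y))) (snd y) j
            else if j = i then (\<lambda>r. proj_column (Suc n) (snd (fst (fst y))) (snd y) i r + proj_column (Suc n) (snd (fst (fst y))) (snd y) (Suc i) r)
            else proj_column (Suc n) (snd (fst (fst y))) (snd y) (Suc j)) r)"
    using j by (cases "j < i"; cases "j = i") (auto intro!: tame_add tame_proj_column)
qed

text \<open>
  Substitution \<open>(g\<^sub>i, h) \<mapsto> (h, h\<^sup>-\<^sup>1 g\<^sub>i)\<close>, which preserves the Haar measure by left invariance in \<open>g\<^sub>i\<close>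
  for fixed \<open>h\<close>.
\<close>
lemma hochschild_term_middle:
  assumes f: "\<And>j. j \<le> Suc n \<Longrightarrow> test_function (f j)" and i: "i \<in> {1..n}"
  shows "(\<integral>y. orbit_integrand (merge_at (convolution K act \<mu>) i f) n y * complex_of_real (det_factor y) \<partial>(\<Omega> \<Otimes>\<^sub>M haars n)) =
    (\<integral>y. orbit_integrand f (Suc n) y * complex_of_real (merge_columns i y) \<partial>(\<Omega> \<Otimes>\<^sub>M haars (Suc n)))"
proof (rule integral_orbit_integrand_transform[where
      T="\<lambda>p. (fst (fst p), insert_coord n i ((snd (fst p))(i := inv\<^bsub>G\<^esub> (snd p) \<otimes>\<^bsub>G\<^esub> snd (fst p) i)) (snd p))", OF _ _ f tame_merge_columns])
  have i': "i \<in> {1..Suc n}" using i by auto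
  let ?g = "\<lambda>g h. insert_coord n i (g(i := inv\<^bsub>G\<^esub> h \<otimes>\<^bsub>G\<^esub> g i)) h"
  have g_meas: "(\<lambda>y. ?g (g y) (h y)) \<in> M \<rightarrow>\<^sub>M haars (Suc n)"
    if "g \<in> M \<rightarrow>\<^sub>M haars n" "h \<in> M \<rightarrow>\<^sub>M haar" for M :: "'z measure" and g h
  proof -
    have h: "h \<in> M \<rightarrow>\<^sub>M borel" using that(2) by (simp cong: measurable_cong_sets)
    show ?thesis
      by (intro insert_coord_measurable[OF i'] mult_coord_measurable that inv_G_measurable h i)
  qed
  let ?T = "\<lambda>p :: ((('k set \<times> 'k) \<times> 'v) \<times> (nat \<Rightarrow> 'k \<times> 'v)) \<times> ('k \<times> 'v). (fst (fst p), ?g (snd (fst p)) (snd p))"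
  show T: "?T \<in> (\<Omega> \<Otimes>\<^sub>M haars n) \<Otimes>\<^sub>M haar \<rightarrow>\<^sub>M \<Omega> \<Otimes>\<^sub>M haars (Suc n)"
    by (intro measurable_Pair g_meas) measurable
  interpret haars: sigma_finite_measure "haars n" by (rule sigma_finite_haars)
  interpret Pl: pair_sigma_finite "haars n" haar ..
  show "(\<integral>\<^sup>+p. F (?T p) \<partial>((\<Omega> \<Otimes>\<^sub>M haars n) \<Otimes>\<^sub>M haar)) = (\<integral>\<^sup>+y. F y \<partial>(\<Omega> \<Otimes>\<^sub>M haars (Suc n)))"
    if F: "F \<in> borel_measurable (\<Omega> \<Otimes>\<^sub>M haars (Suc n))" for F
  proof -
    have "(\<integral>\<^sup>+p. F (?T p) \<partial>((\<Omega> \<Otimes>\<^sub>M haars n) \<Otimes>\<^sub>M haar)) = (\<integral>\<^sup>+\<omega>. \<integral>\<^sup>+g. \<integral>\<^sup>+h. F (\<omega>, ?g g h) \<partial>haar \<partial>haars n \<partial>\<Omega>)"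
      by (subst nn_integral_Y_haar[OF measurable_compose[OF T F]]) simp
    also have "\<dots> = (\<integral>\<^sup>+\<omega>. \<integral>\<^sup>+g. \<integral>\<^sup>+h. F (\<omega>, insert_coord n i g h) \<partial>haar \<partial>haars n \<partial>\<Omega>)"
    proof (rule nn_integral_cong)
      fix \<omega> assume \<omega>: "\<omega> \<in> space \<Omega>"
      have F\<omega>: "(\<lambda>g. F (\<omega>, g)) \<in> borel_measurable (haars (Suc n))"
        using measurable_compose[OF measurable_Pair1'[OF \<omega>] F] .
      have 1: "(\<lambda>(g, h). F (\<omega>, ?g g h)) \<in> borel_measurable (haars n \<Otimes>\<^sub>M haar)"
        unfolding case_prod_beta' by (intro measurable_compose[OF _ F\<omega>] g_meas measurable_fst measurable_snd)
      have 2: "(\<lambda>(g, h). F (\<omega>, insert_coord n i g h)) \<in> borel_measurable (haars n \<Otimes>\<^sub>M haar)"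
        unfolding case_prod_beta' by (intro measurable_compose[OF _ F\<omega>] insert_coord_measurable[OF i'] measurable_fst measurable_snd)
      \<comment> \<open>With \<open>h\<close> outermost, the twist is a left translation by a constant.\<close>
      have "(\<integral>\<^sup>+g. \<integral>\<^sup>+h. F (\<omega>, ?g g h) \<partial>haar \<partial>haars n) = (\<integral>\<^sup>+h. \<integral>\<^sup>+g. F (\<omega>, ?g g h) \<partial>haars n \<partial>haar)"
        by (rule Pl.Fubini'[OF 1, symmetric])
      also have "\<dots> = (\<integral>\<^sup>+h. \<integral>\<^sup>+g. F (\<omega>, insert_coord n i g h) \<partial>haars n \<partial>haar)"
      proof (rule nn_integral_cong)
        fix h :: "'k \<times> 'v"
        show "(\<integral>\<^sup>+g. F (\<omega>, ?g g h) \<partial>haars n) = (\<integral>\<^sup>+g. F (\<omega>, insert_coord n i g h) \<partial>haars n)"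
          by (rule nn_integral_mult_coord[where F="\<lambda>g. F (\<omega>, insert_coord n i g h)", OF _ i])
            (intro measurable_compose[OF _ F\<omega>] insert_coord_measurable[OF i'], measurable)
      qed
      also have "\<dots> = (\<integral>\<^sup>+g. \<integral>\<^sup>+h. F (\<omega>, insert_coord n i g h) \<partial>haar \<partial>haars n)"
        by (rule Pl.Fubini'[OF 2])
      finally show "(\<integral>\<^sup>+g. \<integral>\<^sup>+h. F (\<omega>, ?g g h) \<partial>haar \<partial>haars n) = (\<integral>\<^sup>+g. \<integral>\<^sup>+h. F (\<omega>, insert_coord n i g h) \<partial>haar \<partial>haars n)" .
    qed
    also have "\<dots> = (\<integral>\<^sup>+y. F y \<partial>(\<Omega> \<Otimes>\<^sub>M haars (Suc n)))"
      by (rule nn_integral_Y_Suc[OF F i', symmetric])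
    finally show ?thesis .
  qed
  show "orbit_integrand (merge_at (convolution K act \<mu>) i f) n (\<omega>, g) = (\<integral>h. orbit_integrand f (Suc n) (?T ((\<omega>, g), h)) \<partial>haar)" for \<omega> g
  proof -
    let ?c = "f 0 (orbit_point \<omega> \<otimes>\<^bsub>G\<^esub> inv\<^bsub>G\<^esub> (segment_prod G g 1 n)) * (\<Prod>j\<in>{1..n}-{i}. f (if j < i then j else Suc j) (g j))"
    have "orbit_integrand f (Suc n) (?T ((\<omega>, g), h)) = ?c * (f i h * f (i + 1) (inv\<^bsub>G\<^esub> h \<otimes>\<^bsub>G\<^esub> g i))" for h
    proof -
      let ?g' = "g(i := inv\<^bsub>G\<^esub> h \<otimes>\<^bsub>G\<^esub> g i)"
      have "(\<Prod>j=1..n. f (if j < i then j else Suc j) (?g' j)) =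
        f (i + 1) (inv\<^bsub>G\<^esub> h \<otimes>\<^bsub>G\<^esub> g i) * (\<Prod>j\<in>{1..n}-{i}. f (if j < i then j else Suc j) (g j))"
        by (subst prod.remove[OF _ i]) (auto intro!: prod.cong)
      then show ?thesis
        using segment_prod_insert_split[OF i, of 1 g h] i
        unfolding orbit_integrand_def case_prod_conv fst_conv snd_conv prod_insert_coord[OF i']
        by (simp add: mult_ac)
    qed
    moreover have "(\<Prod>j=1..n. merge_at (convolution K act \<mu>) i f j (g j)) =
        convolution K act \<mu> (f i) (f (i + 1)) (g i) * (\<Prod>j\<in>{1..n}-{i}. f (if j < i then j else Suc j) (g j))"
    proof -
      have "(\<Prod>j\<in>{1..n}-{i}. merge_at (convolution K act \<mu>) i f j (g j)) = (\<Prod>j\<in>{1..n}-{i}. f (if j < i then j else Suc j) (g j))"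
        by (intro prod.cong) (auto simp: merge_at_def)
      then show ?thesis by (subst prod.remove[OF _ i]) (simp_all add: merge_at_def)
    qed
    then have "orbit_integrand (merge_at (convolution K act \<mu>) i f) n (\<omega>, g) =
        ?c * (\<integral>h. f i h * f (i + 1) (inv\<^bsub>G\<^esub> h \<otimes>\<^bsub>G\<^esub> g i) \<partial>haar)"
      using i by (simp add: orbit_integrand_def convolution_def merge_at_def mult_ac)
    ultimately show ?thesis by (simp only: integral_mult_right_zero)
  qed
  show "merge_columns i (?T ((\<omega>, g), h)) = det_factor (\<omega>, g)" for \<omega> g h
    unfolding merge_columns_def det_factor_def Let_def fst_conv snd_conv
  proof (rule leibniz_det_cong)
    fix j r assume j: "j \<in> {1..n}"
    have "segment_prod G (g(i := inv\<^bsub>G\<^esub> h \<otimes>\<^bsub>G\<^esub> g i)) l n = segment_prod G g l n" if "l > i" for l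
      using that by (intro segment_prod_cong) auto
    then have up: "segment_prod G (?g g h) (Suc l) (Suc n) = segment_prod G g l n" if "l > i" for l
      using that i segment_prod_insert_above[of i l G n] by simp
    note low = segment_prod_insert_split[OF i, of _ g h]
    consider "j < i" | "j = i" | "j > i" by linarith
    then show "(if j < i then proj_column (Suc n) (snd (fst \<omega>)) (?g g h) j
       else if j = i then (\<lambda>r. proj_column (Suc n) (snd (fst \<omega>)) (?g g h) i r + proj_column (Suc n) (snd (fst \<omega>)) (?g g h) (Suc i) r)
       else proj_column (Suc n) (snd (fst \<omega>)) (?g g h) (Suc j)) r = proj_column n (snd (fst \<omega>)) g j r"
    proof cases
      case 1
      then show ?thesis using j low[of j] low[of "Suc j"] by (simp add: proj_column_def)
    next
      case 2
      then show ?thesis using j low[of i] up[of "Suc i"]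
        by (simp add: proj_column_def act_diff flip: inner_add_left)
    next
      case 3
      then show ?thesis using up[of j] up[of "Suc j"] by (simp add: proj_column_def)
    qed
  qed
qed

text \<open>
  Here \<open>f\<^sub>0 * f\<^sub>1\<close> is evaluated at \<open>z = y (g\<^sub>1 \<cdots> g\<^sub>n)\<^sup>-\<^sup>1\<close>; the new first group element is
  \<open>h\<^sup>-\<^sup>1 z\<close>, and the integration variable \<open>h\<close> becomes the argument of \<open>f\<^sub>0\<close>. The substitution
  \<open>h \<mapsto> h\<^sup>-\<^sup>1 z\<close> needs unimodularity.
\<close>
lemma hochschild_term_first:
  assumes f: "\<And>j. j \<le> Suc n \<Longrightarrow> test_function (f j)"
  shows "(\<integral>y. orbit_integrand (merge_at (convolution K act \<mu>) 0 f) n y * complex_of_real (det_factor y) \<partial>(\<Omega> \<Otimes>\<^sub>M haars n)) =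
    (\<integral>y. orbit_integrand f (Suc n) y * complex_of_real (merge_columns 0 y) \<partial>(\<Omega> \<Otimes>\<^sub>M haars (Suc n)))"
proof (rule integral_orbit_integrand_transform[where
      T="\<lambda>p. (fst (fst p), insert_coord n 1 (snd (fst p))
        (inv\<^bsub>G\<^esub> (snd p) \<otimes>\<^bsub>G\<^esub> (orbit_point (fst (fst p)) \<otimes>\<^bsub>G\<^esub> inv\<^bsub>G\<^esub> (segment_prod G (snd (fst p)) 1 n))))", OF _ _ f tame_merge_columns])
  have i': "1 \<in> {1..Suc n}" by auto
  let ?z = "\<lambda>\<omega> g. orbit_point \<omega> \<otimes>\<^bsub>G\<^esub> inv\<^bsub>G\<^esub> (segment_prod G g 1 n)"
  let ?T = "\<lambda>p :: ((('k set \<times> 'k) \<times> 'v) \<times> (nat \<Rightarrow> 'k \<times> 'v)) \<times> ('k \<times> 'v).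
    (fst (fst p), insert_coord n 1 (snd (fst p)) (inv\<^bsub>G\<^esub> (snd p) \<otimes>\<^bsub>G\<^esub> ?z (fst (fst p)) (snd (fst p))))"
  have fm: "(\<lambda>p. fst (fst p)) \<in> (\<Omega> \<Otimes>\<^sub>M haars n) \<Otimes>\<^sub>M haar \<rightarrow>\<^sub>M \<Omega>"
    by (rule measurable_compose[OF measurable_fst measurable_fst])
  have sm: "(\<lambda>p. snd (fst p)) \<in> (\<Omega> \<Otimes>\<^sub>M haars n) \<Otimes>\<^sub>M haar \<rightarrow>\<^sub>M haars n"
    by (rule measurable_compose[OF measurable_fst measurable_snd])
  have hm: "snd \<in> (\<Omega> \<Otimes>\<^sub>M haars n) \<Otimes>\<^sub>M haar \<rightarrow>\<^sub>M borel"
    using measurable_snd[of "\<Omega> \<Otimes>\<^sub>M haars n" haar] by (simp cong: measurable_cong_sets)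
  have "(\<lambda>p. inv\<^bsub>G\<^esub> (snd p) \<otimes>\<^bsub>G\<^esub> ?z (fst (fst p)) (snd (fst p))) \<in> (\<Omega> \<Otimes>\<^sub>M haars n) \<Otimes>\<^sub>M haar \<rightarrow>\<^sub>M borel"
    by (intro mult_G_measurable inv_G_measurable hm measurable_segment_prod[OF sm] measurable_compose[OF fm orbit_point_measurable]) auto
  then have zm: "(\<lambda>p. inv\<^bsub>G\<^esub> (snd p) \<otimes>\<^bsub>G\<^esub> ?z (fst (fst p)) (snd (fst p))) \<in> (\<Omega> \<Otimes>\<^sub>M haars n) \<Otimes>\<^sub>M haar \<rightarrow>\<^sub>M haar"
    by (simp cong: measurable_cong_sets)
  show T: "?T \<in> (\<Omega> \<Otimes>\<^sub>M haars n) \<Otimes>\<^sub>M haar \<rightarrow>\<^sub>M \<Omega> \<Otimes>\<^sub>M haars (Suc n)"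
    by (intro measurable_Pair fm insert_coord_measurable[OF i'] sm zm)
  show "(\<integral>\<^sup>+p. F (?T p) \<partial>((\<Omega> \<Otimes>\<^sub>M haars n) \<Otimes>\<^sub>M haar)) = (\<integral>\<^sup>+y. F y \<partial>(\<Omega> \<Otimes>\<^sub>M haars (Suc n)))"
    if F: "F \<in> borel_measurable (\<Omega> \<Otimes>\<^sub>M haars (Suc n))" for F
  proof -
    have "(\<integral>\<^sup>+p. F (?T p) \<partial>((\<Omega> \<Otimes>\<^sub>M haars n) \<Otimes>\<^sub>M haar)) =
        (\<integral>\<^sup>+\<omega>. \<integral>\<^sup>+g. \<integral>\<^sup>+h. F (\<omega>, insert_coord n 1 g (inv\<^bsub>G\<^esub> h \<otimes>\<^bsub>G\<^esub> ?z \<omega> g)) \<partial>haar \<partial>haars n \<partial>\<Omega>)"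
      by (subst nn_integral_Y_haar[OF measurable_compose[OF T F]]) simp
    also have "\<dots> = (\<integral>\<^sup>+\<omega>. \<integral>\<^sup>+g. \<integral>\<^sup>+h. F (\<omega>, insert_coord n 1 g h) \<partial>haar \<partial>haars n \<partial>\<Omega>)"
    proof (rule nn_integral_cong, rule nn_integral_cong)
      fix \<omega> g assume \<omega>: "\<omega> \<in> space \<Omega>" and g: "g \<in> space (haars n)"
      have F\<omega>: "(\<lambda>g. F (\<omega>, g)) \<in> borel_measurable (haars (Suc n))"
        using measurable_compose[OF measurable_Pair1'[OF \<omega>] F] .
      show "(\<integral>\<^sup>+h. F (\<omega>, insert_coord n 1 g (inv\<^bsub>G\<^esub> h \<otimes>\<^bsub>G\<^esub> ?z \<omega> g)) \<partial>haar) = (\<integral>\<^sup>+h. F (\<omega>, insert_coord n 1 g h) \<partial>haar)"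
        by (rule nn_integral_inv_mult_G[where F="\<lambda>h. F (\<omega>, insert_coord n 1 g h)"])
          (intro measurable_compose[OF _ F\<omega>] insert_coord_measurable[OF i'] measurable_const g, measurable)
    qed
    also have "\<dots> = (\<integral>\<^sup>+y. F y \<partial>(\<Omega> \<Otimes>\<^sub>M haars (Suc n)))"
      by (rule nn_integral_Y_Suc[OF F i', symmetric])
    finally show ?thesis .
  qed
  have at: "segment_prod G (insert_coord n 1 g h) 1 (Suc n) = h \<otimes>\<^bsub>G\<^esub> segment_prod G g 1 n" for g h
    by (rule segment_prod_insert_at[OF i'])
  show "orbit_integrand (merge_at (convolution K act \<mu>) 0 f) n (\<omega>, g) = (\<integral>h. orbit_integrand f (Suc n) (?T ((\<omega>, g), h)) \<partial>haar)" for \<omega> g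
  proof -
    let ?c = "\<Prod>j=1..n. f (Suc j) (g j)"
    have "orbit_integrand f (Suc n) (?T ((\<omega>, g), h)) = ?c * (f 0 h * f 1 (inv\<^bsub>G\<^esub> h \<otimes>\<^bsub>G\<^esub> ?z \<omega> g))" for h
    proof -
      have "(\<Prod>j=1..n. f (if j < 1 then j else Suc j) (g j)) = ?c"
        by (intro prod.cong) auto
      moreover have "orbit_point \<omega> \<otimes>\<^bsub>G\<^esub> inv\<^bsub>G\<^esub> (inv\<^bsub>G\<^esub> h \<otimes>\<^bsub>G\<^esub> ?z \<omega> g \<otimes>\<^bsub>G\<^esub> segment_prod G g 1 n) = h"
        by (simp add: G.inv_mult_group G.m_assoc) (simp flip: G.m_assoc)
      ultimately show ?thesis
        unfolding orbit_integrand_def case_prod_conv fst_conv snd_conv prod_insert_coord[OF i'] at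
        by (simp add: mult_ac)
    qed
    moreover have "(\<Prod>j=1..n. merge_at (convolution K act \<mu>) 0 f j (g j)) = ?c"
      by (intro prod.cong) (auto simp: merge_at_def)
    then have "orbit_integrand (merge_at (convolution K act \<mu>) 0 f) n (\<omega>, g) =
        ?c * (\<integral>h. f 0 h * f 1 (inv\<^bsub>G\<^esub> h \<otimes>\<^bsub>G\<^esub> ?z \<omega> g) \<partial>haar)"
      by (simp add: orbit_integrand_def convolution_def merge_at_def)
    ultimately show ?thesis by (simp only: integral_mult_right_zero)
  qed
  show "merge_columns 0 (?T ((\<omega>, g), h)) = det_factor (\<omega>, g)" for \<omega> g h
    unfolding merge_columns_def det_factor_def Let_def fst_conv snd_conv
    by (rule leibniz_det_cong) (auto simp: proj_column_def segment_prod_insert_above)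
qed

text \<open>
  The conjugating element may depend on further integration variables, since for fixed values of those the orbit
  coordinates can be integrated first.
\<close>
lemma nn_integral_conj_point_family:
  assumes "sigma_finite_measure Q" and h: "h \<in> Q \<rightarrow>\<^sub>M borel" and F: "F \<in> borel_measurable (\<Omega> \<Otimes>\<^sub>M Q)"
  shows "(\<integral>\<^sup>+\<omega>. \<integral>\<^sup>+q. F (conj_point (h q) \<omega>, q) \<partial>Q \<partial>\<Omega>) = (\<integral>\<^sup>+\<omega>. \<integral>\<^sup>+q. F (\<omega>, q) \<partial>Q \<partial>\<Omega>)"
proof -
  interpret Q: sigma_finite_measure Q by fact
  interpret Q\<Omega>: pair_sigma_finite \<Omega> Q ..
  have 1: "(\<lambda>(\<omega>, q). F (conj_point (h q) \<omega>, q)) \<in> borel_measurable (\<Omega> \<Otimes>\<^sub>M Q)"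
    unfolding case_prod_beta'
    by (intro measurable_compose[OF _ F] measurable_Pair conj_point_measurable measurable_compose[OF measurable_snd h]
        measurable_fst measurable_snd)
  have 2: "(\<lambda>(\<omega>, q). F (\<omega>, q)) \<in> borel_measurable (\<Omega> \<Otimes>\<^sub>M Q)"
    using F by simp
  have "(\<integral>\<^sup>+\<omega>. \<integral>\<^sup>+q. F (conj_point (h q) \<omega>, q) \<partial>Q \<partial>\<Omega>) = (\<integral>\<^sup>+q. \<integral>\<^sup>+\<omega>. F (conj_point (h q) \<omega>, q) \<partial>\<Omega> \<partial>Q)"
    by (rule Q\<Omega>.Fubini'[OF 1, symmetric])
  also have "\<dots> = (\<integral>\<^sup>+q. \<integral>\<^sup>+\<omega>. F (\<omega>, q) \<partial>\<Omega> \<partial>Q)"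
    by (intro nn_integral_cong nn_integral_conj_point[where F="\<lambda>\<omega>. F (\<omega>, _)"] measurable_compose[OF _ F] measurable_Pair2')
  also have "\<dots> = (\<integral>\<^sup>+\<omega>. \<integral>\<^sup>+q. F (\<omega>, q) \<partial>Q \<partial>\<Omega>)"
    by (rule Q\<Omega>.Fubini'[OF 2])
  finally show ?thesis .
qed

lemma nn_integral_conj_insert_last:
  assumes F: "F \<in> borel_measurable (\<Omega> \<Otimes>\<^sub>M haars (Suc N))"
  shows "(\<integral>\<^sup>+\<omega>. \<integral>\<^sup>+g. \<integral>\<^sup>+h. F (conj_point h \<omega>, insert_coord N (Suc N) g h) \<partial>haar \<partial>haars N \<partial>\<Omega>) = (\<integral>\<^sup>+y. F y \<partial>(\<Omega> \<Otimes>\<^sub>M haars (Suc N)))"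
proof -
  interpret haars: sigma_finite_measure "haars N" by (rule sigma_finite_haars)
  have Q: "sigma_finite_measure (haars N \<Otimes>\<^sub>M haar)"
    by (intro sigma_finite_pair_measure haar.sigma_finite_measure_axioms haars.sigma_finite_measure_axioms)
  have i: "Suc N \<in> {1..Suc N}" by auto
  have hm: "snd \<in> haars N \<Otimes>\<^sub>M haar \<rightarrow>\<^sub>M borel"
    using measurable_snd[of "haars N" haar] by (simp cong: measurable_cong_sets)
  let ?I = "\<lambda>q. insert_coord N (Suc N) (fst q) (snd q)"
  have im: "?I \<in> haars N \<Otimes>\<^sub>M haar \<rightarrow>\<^sub>M haars (Suc N)"
    by (intro insert_coord_measurable[OF i] measurable_fst measurable_snd)
  have F': "(\<lambda>p. F (fst p, ?I (snd p))) \<in> borel_measurable (\<Omega> \<Otimes>\<^sub>M (haars N \<Otimes>\<^sub>M haar))"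
    by (intro measurable_compose[OF _ F] measurable_Pair measurable_fst measurable_compose[OF measurable_snd im])
  have 1: "(\<integral>\<^sup>+g. \<integral>\<^sup>+h. F (conj_point h \<omega>, insert_coord N (Suc N) g h) \<partial>haar \<partial>haars N) =
      (\<integral>\<^sup>+q. F (conj_point (snd q) \<omega>, ?I q) \<partial>(haars N \<Otimes>\<^sub>M haar))" if \<omega>: "\<omega> \<in> space \<Omega>" for \<omega>
  proof -
    have "(\<lambda>q. F (conj_point (snd q) \<omega>, ?I q)) \<in> borel_measurable (haars N \<Otimes>\<^sub>M haar)"
      by (intro measurable_compose[OF _ F] measurable_Pair im conj_point_measurable hm measurable_const \<omega>)
    from haar.nn_integral_fst[OF this] show ?thesis by simp
  qed
  have 2: "(\<integral>\<^sup>+g. \<integral>\<^sup>+h. F (\<omega>, insert_coord N (Suc N) g h) \<partial>haar \<partial>haars N) =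
      (\<integral>\<^sup>+q. F (\<omega>, ?I q) \<partial>(haars N \<Otimes>\<^sub>M haar))" if \<omega>: "\<omega> \<in> space \<Omega>" for \<omega>
  proof -
    have "(\<lambda>q. F (\<omega>, ?I q)) \<in> borel_measurable (haars N \<Otimes>\<^sub>M haar)"
      by (intro measurable_compose[OF _ F] measurable_Pair im measurable_const \<omega>)
    from haar.nn_integral_fst[OF this] show ?thesis by simp
  qed
  have "(\<integral>\<^sup>+\<omega>. \<integral>\<^sup>+g. \<integral>\<^sup>+h. F (conj_point h \<omega>, insert_coord N (Suc N) g h) \<partial>haar \<partial>haars N \<partial>\<Omega>) =
      (\<integral>\<^sup>+\<omega>. \<integral>\<^sup>+q. F (conj_point (snd q) \<omega>, ?I q) \<partial>(haars N \<Otimes>\<^sub>M haar) \<partial>\<Omega>)"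
    by (rule nn_integral_cong) (rule 1)
  also have "\<dots> = (\<integral>\<^sup>+\<omega>. \<integral>\<^sup>+q. F (\<omega>, ?I q) \<partial>(haars N \<Otimes>\<^sub>M haar) \<partial>\<Omega>)"
    using nn_integral_conj_point_family[OF Q hm F'] by simp
  also have "\<dots> = (\<integral>\<^sup>+\<omega>. \<integral>\<^sup>+g. \<integral>\<^sup>+h. F (\<omega>, insert_coord N (Suc N) g h) \<partial>haar \<partial>haars N \<partial>\<Omega>)"
    by (rule nn_integral_cong) (rule 2[symmetric])
  also have "\<dots> = (\<integral>\<^sup>+y. F y \<partial>(\<Omega> \<Otimes>\<^sub>M haars (Suc N)))"
    by (rule nn_integral_Y_Suc[OF F i, symmetric])
  finally show ?thesis .
qed

text \<open>
  Multiplying all tail products by \<open>h\<close> on the right applies \<open>k\<^sup>-\<^sup>1\<close> to the differences of their vector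
  components; this cancels against the change of \<open>u\<close> to \<open>k\<^sup>-\<^sup>1 u\<close>.
\<close>
lemma proj_column_conj_insert_last:
  assumes "1 \<le> j" "j \<le> N"
  shows "proj_column (Suc N) (snd (fst (conj_point h \<omega>))) (insert_coord N (Suc N) g h) j = proj_column N (snd (fst \<omega>)) g j"
  using assms
  by (auto simp: proj_column_def segment_prod_insert_last conj_point_def Let_def snd_mult_G K.inv_mult_group act_mult
      simp flip: act_diff)

definition last_columns :: "(('k set \<times> 'k) \<times> 'v) \<times> (nat \<Rightarrow> 'k \<times> 'v) \<Rightarrow> real" where
  "last_columns y = leibniz_det n (proj_column (Suc n) (snd (fst (fst y))) (snd y))"

lemma tame_last_columns: "tame (Suc n) last_columns"
  unfolding last_columns_def[abs_def] by (intro tame_leibniz_det tame_proj_column) auto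

text \<open>
  With \<open>h\<close> appended to the tuple, the argument \<open>h\<^sup>-\<^sup>1 y (g\<^sub>1 \<cdots> g\<^sub>n)\<^sup>-\<^sup>1\<close> of \<open>f\<^sub>0\<close> equals
  \<open>(h\<^sup>-\<^sup>1 y h) (g\<^sub>1 \<cdots> g\<^sub>n h)\<^sup>-\<^sup>1\<close>, so the substitution has to conjugate the orbit point as well.
\<close>
lemma hochschild_term_last:
  assumes f: "\<And>j. j \<le> Suc n \<Longrightarrow> test_function (f j)"
  shows "(\<integral>y. orbit_integrand (f(0 := convolution K act \<mu> (f (Suc n)) (f 0))) n y * complex_of_real (det_factor y) \<partial>(\<Omega> \<Otimes>\<^sub>M haars n)) =
    (\<integral>y. orbit_integrand f (Suc n) y * complex_of_real (last_columns y) \<partial>(\<Omega> \<Otimes>\<^sub>M haars (Suc n)))"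
proof (rule integral_orbit_integrand_transform[where
      T="\<lambda>p. (conj_point (snd p) (fst (fst p)), insert_coord n (Suc n) (snd (fst p)) (snd p))", OF _ _ f tame_last_columns])
  have i': "Suc n \<in> {1..Suc n}" by auto
  let ?T = "\<lambda>p :: ((('k set \<times> 'k) \<times> 'v) \<times> (nat \<Rightarrow> 'k \<times> 'v)) \<times> ('k \<times> 'v).
    (conj_point (snd p) (fst (fst p)), insert_coord n (Suc n) (snd (fst p)) (snd p))"
  have hm: "snd \<in> (\<Omega> \<Otimes>\<^sub>M haars n) \<Otimes>\<^sub>M haar \<rightarrow>\<^sub>M borel"
    using measurable_snd[of "\<Omega> \<Otimes>\<^sub>M haars n" haar] by (simp cong: measurable_cong_sets)
  show T: "?T \<in> (\<Omega> \<Otimes>\<^sub>M haars n) \<Otimes>\<^sub>M haar \<rightarrow>\<^sub>M \<Omega> \<Otimes>\<^sub>M haars (Suc n)"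
    by (intro measurable_Pair conj_point_measurable insert_coord_measurable[OF i'] hm measurable_snd
        measurable_compose[OF measurable_fst measurable_fst] measurable_compose[OF measurable_fst measurable_snd])
  show "(\<integral>\<^sup>+p. F (?T p) \<partial>((\<Omega> \<Otimes>\<^sub>M haars n) \<Otimes>\<^sub>M haar)) = (\<integral>\<^sup>+y. F y \<partial>(\<Omega> \<Otimes>\<^sub>M haars (Suc n)))"
    if F: "F \<in> borel_measurable (\<Omega> \<Otimes>\<^sub>M haars (Suc n))" for F
    by (subst nn_integral_Y_haar[OF measurable_compose[OF T F]]) (simp only: fst_conv snd_conv nn_integral_conj_insert_last[OF F])
  show "orbit_integrand (f(0 := convolution K act \<mu> (f (Suc n)) (f 0))) n (\<omega>, g) = (\<integral>h. orbit_integrand f (Suc n) (?T ((\<omega>, g), h)) \<partial>haar)" for \<omega> g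
  proof -
    let ?c = "\<Prod>j=1..n. f j (g j)" and ?z = "orbit_point \<omega> \<otimes>\<^bsub>G\<^esub> inv\<^bsub>G\<^esub> (segment_prod G g 1 n)"
    have "orbit_integrand f (Suc n) (?T ((\<omega>, g), h)) = ?c * (f (Suc n) h * f 0 (inv\<^bsub>G\<^esub> h \<otimes>\<^bsub>G\<^esub> ?z))" for h
    proof -
      have "(\<Prod>j=1..n. f (if j < Suc n then j else Suc j) (g j)) = ?c"
        by (intro prod.cong) auto
      moreover have "orbit_point (conj_point h \<omega>) \<otimes>\<^bsub>G\<^esub> inv\<^bsub>G\<^esub> (segment_prod G g 1 n \<otimes>\<^bsub>G\<^esub> h) = inv\<^bsub>G\<^esub> h \<otimes>\<^bsub>G\<^esub> ?z"
        by (simp add: orbit_point_conj G.inv_mult_group G.m_assoc) (simp flip: G.m_assoc)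
      ultimately show ?thesis
        using segment_prod_insert_last[of 1 n g h]
        unfolding orbit_integrand_def case_prod_conv fst_conv snd_conv prod_insert_coord[OF i']
        by (simp add: mult_ac)
    qed
    moreover have "(\<Prod>j=1..n. (f(0 := convolution K act \<mu> (f (Suc n)) (f 0))) j (g j)) = ?c"
      by (intro prod.cong) auto
    then have "orbit_integrand (f(0 := convolution K act \<mu> (f (Suc n)) (f 0))) n (\<omega>, g) =
        ?c * (\<integral>h. f (Suc n) h * f 0 (inv\<^bsub>G\<^esub> h \<otimes>\<^bsub>G\<^esub> ?z) \<partial>haar)"
      by (simp add: orbit_integrand_def convolution_def)
    ultimately show ?thesis by (simp only: integral_mult_right_zero)
  qed
  show "last_columns (?T ((\<omega>, g), h)) = det_factor (\<omega>, g)" for \<omega> g h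
    unfolding last_columns_def det_factor_def fst_conv snd_conv
    by (rule leibniz_det_cong) (simp add: proj_column_conj_insert_last)
qed

lemma test_function_merge_at:
  assumes f: "\<And>j. j \<le> Suc n \<Longrightarrow> test_function (f j)" and "i \<le> n" "j \<le> n"
  shows "test_function (merge_at (convolution K act \<mu>) i f j)"
  using assms by (auto simp: merge_at_def intro!: test_function_convolution)

lemma hochschild_identity:
  assumes f: "\<And>j. j \<le> Suc n \<Longrightarrow> test_function (f j)"
  shows "(\<Sum>i=0..n. (-1) ^ i * higher_orbital_integral K act \<mu> \<nu> A e n x (merge_at (convolution K act \<mu>) i f))
     + (-1) ^ Suc n * higher_orbital_integral K act \<mu> \<nu> A e n x (f(0 := convolution K act \<mu> (f (Suc n)) (f 0))) = 0"
proof -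
  let ?Y = "\<Omega> \<Otimes>\<^sub>M haars (Suc n)"
  let ?J = "\<lambda>q. \<integral>y. orbit_integrand f (Suc n) y * complex_of_real (q y) \<partial>?Y"
  have merge: "higher_orbital_integral K act \<mu> \<nu> A e n x (merge_at (convolution K act \<mu>) i f) = ?J (merge_columns i)"
    if i: "i \<le> n" for i
  proof (cases "i = 0")
    case True
    show ?thesis
      unfolding True using hochschild_term_first[OF f]
      by (subst higher_orbital_integral_eq) (auto intro: test_function_merge_at[OF f])
  next
    case False
    with i have "i \<in> {1..n}" by auto
    from hochschild_term_middle[OF f this] i show ?thesis
      by (subst higher_orbital_integral_eq) (auto intro: test_function_merge_at[OF f])
  qed
  have last: "higher_orbital_integral K act \<mu> \<nu> A e n x (f(0 := convolution K act \<mu> (f (Suc n)) (f 0))) = ?J last_columns"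
    using hochschild_term_last[OF f]
    by (subst higher_orbital_integral_eq) (auto intro!: f test_function_convolution)
  have int: "integrable ?Y (\<lambda>y. orbit_integrand f (Suc n) y * complex_of_real (q y))" if "tame (Suc n) q" for q
    by (rule integrable_orbit_integrand[OF f that])
  have "(\<Sum>i=0..n. (-1) ^ i * ?J (merge_columns i)) + (-1) ^ Suc n * ?J last_columns =
      (\<integral>y. (\<Sum>i=0..n. (-1) ^ i * (orbit_integrand f (Suc n) y * complex_of_real (merge_columns i y)))
        + (-1) ^ Suc n * (orbit_integrand f (Suc n) y * complex_of_real (last_columns y)) \<partial>?Y)"
  proof -
    have 1: "integrable ?Y (\<lambda>y. (-1) ^ i * (orbit_integrand f (Suc n) y * complex_of_real (merge_columns i y)))" for i
      by (intro integrable_mult_right int tame_merge_columns)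
    have 2: "integrable ?Y (\<lambda>y. (-1) ^ Suc n * (orbit_integrand f (Suc n) y * complex_of_real (last_columns y)))"
      by (intro integrable_mult_right int tame_last_columns)
    show ?thesis
      by (simp only: Bochner_Integration.integral_add[OF Bochner_Integration.integrable_sum[OF 1] 2]
          Bochner_Integration.integral_sum[OF 1] integral_mult_right_zero)
  qed
  also have "\<dots> = (\<integral>y. 0 \<partial>?Y)"
  proof (rule Bochner_Integration.integral_cong[OF refl])
    fix y
    have "(\<Sum>i=0..n. (-1) ^ i * merge_columns i y) + (-1) ^ Suc n * last_columns y = 0"
      unfolding merge_columns_def last_columns_def Let_def by (rule leibniz_det_merge_columns)
    then have "complex_of_real ((\<Sum>i=0..n. (-1) ^ i * merge_columns i y) + (-1) ^ Suc n * last_columns y) = 0"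
      by simp
    then have "orbit_integrand f (Suc n) y * ((\<Sum>i=0..n. (-1) ^ i * complex_of_real (merge_columns i y)) + (-1) ^ Suc n * complex_of_real (last_columns y)) = 0"
      by simp
    then show "(\<Sum>i=0..n. (-1) ^ i * (orbit_integrand f (Suc n) y * complex_of_real (merge_columns i y)))
        + (-1) ^ Suc n * (orbit_integrand f (Suc n) y * complex_of_real (last_columns y)) = 0"
      by (simp only: distrib_left sum_distrib_left mult.left_commute)
  qed
  finally show ?thesis
    by (simp add: merge last)
qed

end

section \<open>Cyclicity\<close>

lemma prod_shift_first:
  fixes a :: "nat \<Rightarrow> 'a::comm_monoid_mult"
  shows "(\<Prod>j=1..Suc m. a j) = a 1 * (\<Prod>j=1..m. a (Suc j))"
proof -
  have "(\<Prod>j=1..Suc m. a j) = a 1 * (\<Prod>j=Suc 1..Suc m. a j)"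
    by (rule prod.atLeast_Suc_atMost) simp
  then show ?thesis by (simp only: prod.shift_bounds_cl_Suc_ivl)
qed

context orbital_setting
begin

text \<open>
  The cyclic rotation of a tuple of length \<open>m + 1\<close>: if \<open>z\<close> denotes the element with
  \<open>z g\<^sub>1 \<cdots> g\<^sub>m\<^sub>+\<^sub>1 = y\<close>, then \<open>g\<^sub>1 (g\<^sub>2 \<cdots> g\<^sub>m\<^sub>+\<^sub>1 z) = z\<^sup>-\<^sup>1 y z\<close>.
\<close>
definition rotated_point :: "nat \<Rightarrow> (('k set \<times> 'k) \<times> 'v) \<times> (nat \<Rightarrow> 'k \<times> 'v) \<Rightarrow> (('k set \<times> 'k) \<times> 'v) \<times> (nat \<Rightarrow> 'k \<times> 'v)" where
  "rotated_point m y = (let z = orbit_point (fst y) \<otimes>\<^bsub>G\<^esub> inv\<^bsub>G\<^esub> (segment_prod G (snd y) 1 (Suc m))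
    in (conj_point z (fst y), insert_coord m (Suc m) (\<lambda>j\<in>{1..m}. snd y (Suc j)) z))"

lemma rotated_point_measurable:
  "rotated_point m \<in> \<Omega> \<Otimes>\<^sub>M haars (Suc m) \<rightarrow>\<^sub>M \<Omega> \<Otimes>\<^sub>M haars (Suc m)"
proof -
  let ?Y = "\<Omega> \<Otimes>\<^sub>M haars (Suc m)"
  have z: "(\<lambda>y. orbit_point (fst y) \<otimes>\<^bsub>G\<^esub> inv\<^bsub>G\<^esub> (segment_prod G (snd y) 1 (Suc m))) \<in> ?Y \<rightarrow>\<^sub>M borel"
    by (intro mult_G_measurable inv_G_measurable measurable_segment_prod[OF measurable_snd]
        measurable_compose[OF measurable_fst orbit_point_measurable]) auto
  then have z': "(\<lambda>y. orbit_point (fst y) \<otimes>\<^bsub>G\<^esub> inv\<^bsub>G\<^esub> (segment_prod G (snd y) 1 (Suc m))) \<in> ?Y \<rightarrow>\<^sub>M haar"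
    by (simp cong: measurable_cong_sets)
  have "(\<lambda>y. \<lambda>j\<in>{1..m}. snd y (Suc j)) \<in> ?Y \<rightarrow>\<^sub>M haars m"
  proof (rule measurable_restrict)
    fix j assume "j \<in> {1..m}"
    then have "(\<lambda>y. snd y (Suc j)) \<in> ?Y \<rightarrow>\<^sub>M borel"
      by (intro component_haars[OF measurable_snd]) auto
    then show "(\<lambda>y. snd y (Suc j)) \<in> ?Y \<rightarrow>\<^sub>M haar" by (simp cong: measurable_cong_sets)
  qed
  then show ?thesis
    unfolding rotated_point_def[abs_def] Let_def
    by (intro measurable_Pair conj_point_measurable insert_coord_measurable z z' measurable_fst) auto
qed

lemma rotated_point_insert_first:
  "rotated_point m (\<omega>, insert_coord m 1 g h) =
    (let z = orbit_point \<omega> \<otimes>\<^bsub>G\<^esub> inv\<^bsub>G\<^esub> (segment_prod G g 1 m) \<otimes>\<^bsub>G\<^esub> inv\<^bsub>G\<^esub> h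
     in (conj_point z \<omega>, insert_coord m (Suc m) g z))"
proof -
  have "segment_prod G (insert_coord m 1 g h) 1 (Suc m) = h \<otimes>\<^bsub>G\<^esub> segment_prod G g 1 m"
    by (rule segment_prod_insert_at) auto
  moreover have "insert_coord m (Suc m) (\<lambda>j\<in>{1..m}. insert_coord m 1 g h (Suc j)) z = insert_coord m (Suc m) g z" for z
    by (rule ext) (auto simp: insert_coord_def)
  ultimately show ?thesis
    by (simp only: rotated_point_def Let_def fst_conv snd_conv) (simp add: G.inv_mult_group G.m_assoc)
qed

lemma nn_integral_mult_inv_G:
  assumes [measurable]: "F \<in> borel_measurable borel"
  shows "(\<integral>\<^sup>+h. F (a \<otimes>\<^bsub>G\<^esub> inv\<^bsub>G\<^esub> h) \<partial>haar) = (\<integral>\<^sup>+h. F h \<partial>haar)"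
proof -
  have "(\<integral>\<^sup>+h. F (a \<otimes>\<^bsub>G\<^esub> inv\<^bsub>G\<^esub> h) \<partial>haar) = (\<integral>\<^sup>+h. F (a \<otimes>\<^bsub>G\<^esub> h) \<partial>haar)"
    by (rule nn_integral_inv_G[where F="\<lambda>h. F (a \<otimes>\<^bsub>G\<^esub> h)"]) measurable
  also have "\<dots> = (\<integral>\<^sup>+h. F h \<partial>haar)" by (rule nn_integral_mult_G) measurable
  finally show ?thesis .
qed

text \<open>
  For fixed orbit coordinates and \<open>g\<^sub>2, \<dots>, g\<^sub>m\<^sub>+\<^sub>1\<close>, the map \<open>g\<^sub>1 \<mapsto> z\<close> is an inversion followed by a left
  translation. Once \<open>z\<close> is an independent variable, the conjugation by \<open>z\<close> preserves the measure too.
\<close>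
lemma nn_integral_rotated_point:
  assumes F: "F \<in> borel_measurable (\<Omega> \<Otimes>\<^sub>M haars (Suc m))"
  shows "(\<integral>\<^sup>+y. F (rotated_point m y) \<partial>(\<Omega> \<Otimes>\<^sub>M haars (Suc m))) = (\<integral>\<^sup>+y. F y \<partial>(\<Omega> \<Otimes>\<^sub>M haars (Suc m)))"
proof -
  let ?R = "\<lambda>\<omega> g z. F (conj_point z \<omega>, insert_coord m (Suc m) g z)"
  have "(\<integral>\<^sup>+y. F (rotated_point m y) \<partial>(\<Omega> \<Otimes>\<^sub>M haars (Suc m))) =
      (\<integral>\<^sup>+\<omega>. \<integral>\<^sup>+g. \<integral>\<^sup>+h. F (rotated_point m (\<omega>, insert_coord m 1 g h)) \<partial>haar \<partial>haars m \<partial>\<Omega>)"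
    by (rule nn_integral_Y_Suc[OF measurable_compose[OF rotated_point_measurable F]]) simp
  also have "\<dots> = (\<integral>\<^sup>+\<omega>. \<integral>\<^sup>+g. \<integral>\<^sup>+h.
      ?R \<omega> g (orbit_point \<omega> \<otimes>\<^bsub>G\<^esub> inv\<^bsub>G\<^esub> (segment_prod G g 1 m) \<otimes>\<^bsub>G\<^esub> inv\<^bsub>G\<^esub> h) \<partial>haar \<partial>haars m \<partial>\<Omega>)"
    by (simp only: rotated_point_insert_first Let_def)
  also have "\<dots> = (\<integral>\<^sup>+\<omega>. \<integral>\<^sup>+g. \<integral>\<^sup>+h. ?R \<omega> g h \<partial>haar \<partial>haars m \<partial>\<Omega>)"
  proof (rule nn_integral_cong, rule nn_integral_cong)
    fix \<omega> g assume \<omega>: "\<omega> \<in> space \<Omega>" and g: "g \<in> space (haars m)"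
    have "(\<lambda>z. z) \<in> borel \<rightarrow>\<^sub>M haar" by simp
    then have "?R \<omega> g \<in> borel_measurable borel"
      by (intro measurable_compose[OF _ F] measurable_Pair conj_point_measurable insert_coord_measurable measurable_const \<omega> g) auto
    then show "(\<integral>\<^sup>+h. ?R \<omega> g (orbit_point \<omega> \<otimes>\<^bsub>G\<^esub> inv\<^bsub>G\<^esub> (segment_prod G g 1 m) \<otimes>\<^bsub>G\<^esub> inv\<^bsub>G\<^esub> h) \<partial>haar) = (\<integral>\<^sup>+h. ?R \<omega> g h \<partial>haar)"
      by (rule nn_integral_mult_inv_G)
  qed
  also have "\<dots> = (\<integral>\<^sup>+y. F y \<partial>(\<Omega> \<Otimes>\<^sub>M haars (Suc m)))"
    by (rule nn_integral_conj_insert_last[OF F])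
  finally show ?thesis .
qed

text \<open>
  The measure on \<open>A\<^sup>\<bottom>\<close> is a measure on the whole of \<open>V\<close>, so that \<open>w \<in> A\<^sup>\<bottom>\<close> holds only almost
  everywhere.
\<close>
lemma AE_orbit_coordinates: "AE y in \<Omega> \<Otimes>\<^sub>M haars N. fst (fst (fst y)) \<in> space \<nu> \<and> (\<forall>i\<in>{1..n}. snd (fst y) \<bullet> e i = 0)"
proof -
  interpret haars: sigma_finite_measure "haars N" by (rule sigma_finite_haars)
  interpret Y: pair_sigma_finite \<Omega> "haars N" ..
  have perp: "AE w in perp. \<forall>i\<in>{1..n}. w \<bullet> e i = 0"
  proof (rule AE_finite_allI)
    fix i assume i: "i \<in> {1..n}"
    show "AE w in perp. w \<bullet> e i = 0"
      using e_in_A[OF i]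
      by (intro AE_euclidean_orthogonal[OF finite_dim_V subspace_orthogonal_comp])
        (auto simp: orthogonal_comp_def orthogonal_def inner_commute)
  qed simp
  have w: "(\<lambda>\<omega>. snd \<omega>) \<in> \<Omega> \<rightarrow>\<^sub>M borel"
    using measurable_snd[of "\<nu> \<Otimes>\<^sub>M \<mu>" perp] by (simp cong: measurable_cong_sets)
  have [measurable]: "(\<lambda>\<omega>. snd \<omega> \<bullet> e i) \<in> borel_measurable \<Omega>" for i
    by (intro borel_measurable_inner w measurable_const) simp
  have \<Omega>_perp: "AE \<omega> in \<Omega>. \<forall>i\<in>{1..n}. snd \<omega> \<bullet> e i = 0"
    by (rule \<Omega>.AE_pair_measure) (measurable, use perp in simp)
  have [measurable]: "(\<lambda>y. snd (fst y) \<bullet> e i) \<in> borel_measurable (\<Omega> \<Otimes>\<^sub>M haars N)" for i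
    by (intro borel_measurable_inner measurable_compose[OF measurable_fst w] measurable_const) simp
  have "AE y in \<Omega> \<Otimes>\<^sub>M haars N. \<forall>i\<in>{1..n}. snd (fst y) \<bullet> e i = 0"
  proof (rule Y.AE_pair_measure)
    show "AE \<omega> in \<Omega>. AE g in haars N. \<forall>i\<in>{1..n}. snd (fst (\<omega>, g)) \<bullet> e i = 0"
      using \<Omega>_perp by eventually_elim simp
  qed measurable
  then show ?thesis
    using AE_space by eventually_elim (auto simp: space_pair_measure)
qed

lemma orbit_integrand_rotate:
  assumes n: "n = Suc m"
  shows "orbit_integrand (\<lambda>j. if j = 0 then f n else f (j - 1)) n y = orbit_integrand f n (rotated_point m y)"
proof -
  obtain \<omega> g where y: "y = (\<omega>, g)" by (cases y)
  define z where "z = orbit_point \<omega> \<otimes>\<^bsub>G\<^esub> inv\<^bsub>G\<^esub> (segment_prod G g 1 n)"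
  define t where "t = (\<lambda>j\<in>{1..m}. g (Suc j))"
  have R: "rotated_point m y = (conj_point z \<omega>, insert_coord m (Suc m) t z)"
    by (simp only: y rotated_point_def Let_def fst_conv snd_conv z_def t_def n)
  have S: "segment_prod G t 1 m = segment_prod G g 2 n"
    unfolding n numeral_2_eq_2 One_nat_def segment_prod_shift t_def by (intro segment_prod_cong) auto
  have S1: "segment_prod G g 1 n = g 1 \<otimes>\<^bsub>G\<^esub> segment_prod G g 2 n"
    using segment_prod_Cons[of 1 n G g] by (simp add: n numeral_2_eq_2)
  have "inv\<^bsub>G\<^esub> z \<otimes>\<^bsub>G\<^esub> orbit_point \<omega> = g 1 \<otimes>\<^bsub>G\<^esub> segment_prod G g 2 n"
    unfolding z_def S1[symmetric] by (simp add: G.inv_mult_group G.m_assoc)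
  moreover have "orbit_point (conj_point z \<omega>) \<otimes>\<^bsub>G\<^esub> inv\<^bsub>G\<^esub> (segment_prod G t 1 m \<otimes>\<^bsub>G\<^esub> z) =
      inv\<^bsub>G\<^esub> z \<otimes>\<^bsub>G\<^esub> orbit_point \<omega> \<otimes>\<^bsub>G\<^esub> inv\<^bsub>G\<^esub> (segment_prod G g 2 n)"
    unfolding orbit_point_conj S
    by (simp add: G.inv_mult_group G.m_assoc) (simp flip: G.m_assoc)
  ultimately have "orbit_point (conj_point z \<omega>) \<otimes>\<^bsub>G\<^esub> inv\<^bsub>G\<^esub> (segment_prod G t 1 m \<otimes>\<^bsub>G\<^esub> z) = g 1"
    by (simp add: G.m_assoc)
  moreover have "segment_prod G (insert_coord m (Suc m) t z) 1 n = segment_prod G t 1 m \<otimes>\<^bsub>G\<^esub> z"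
    unfolding n by (rule segment_prod_insert_last) auto
  moreover have "(\<Prod>j=1..n. f j (insert_coord m (Suc m) t z j)) = (\<Prod>j=1..m. f j (g (Suc j))) * f n z"
  proof -
    have "(\<Prod>j=1..Suc m. f j (insert_coord m (Suc m) t z j)) = (\<Prod>j=1..m. f (if j < Suc m then j else Suc j) (t j)) * f (Suc m) z"
      by (rule prod_insert_coord) auto
    also have "(\<Prod>j=1..m. f (if j < Suc m then j else Suc j) (t j)) = (\<Prod>j=1..m. f j (g (Suc j)))"
      by (intro prod.cong) (auto simp: t_def)
    finally show ?thesis by (simp only: n)
  qed
  ultimately have "orbit_integrand f n (rotated_point m y) = f 0 (g 1) * ((\<Prod>j=1..m. f j (g (Suc j))) * f n z)"
    by (simp only: R orbit_integrand_def case_prod_conv)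
  moreover have "(\<Prod>j=1..n. (if j = 0 then f n else f (j - 1)) (g j)) = f 0 (g 1) * (\<Prod>j=1..m. f j (g (Suc j)))"
    unfolding n by (subst prod_shift_first) simp
  then have "orbit_integrand (\<lambda>j. if j = 0 then f n else f (j - 1)) n y = f n z * (f 0 (g 1) * (\<Prod>j=1..m. f j (g (Suc j))))"
    by (simp add: orbit_integrand_def y z_def)
  ultimately show ?thesis by (simp add: mult_ac)
qed

text \<open>
  If \<open>z = (k, v)\<close>, the new column is \<open>u\<^sup>-\<^sup>1 k v = m (w - u\<^sup>-\<^sup>1 s\<^sub>1)\<close>. Its
  \<open>A\<close>-coordinates are those of \<open>- u\<^sup>-\<^sup>1 s\<^sub>1\<close>, since \<open>m\<close> fixes \<open>A\<close> and \<open>w\<close> is orthogonal to \<open>A\<close>;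
  and \<open>u\<^sup>-\<^sup>1 s\<^sub>1\<close> is the telescoping sum of the old columns.
\<close>
lemma det_factor_rotate:
  assumes n: "n = Suc m" and C: "fst (fst (fst y)) \<in> space \<nu>" and w: "\<And>i. i \<in> {1..n} \<Longrightarrow> snd (fst y) \<bullet> e i = 0"
  shows "det_factor (rotated_point m y) = (-1) ^ n * det_factor y"
proof -
  obtain C u w g where y: "y = (((C, u), w), g)" by (metis prod.exhaust)
  let ?\<omega> = "((C, u), w)"
  define S where "S = segment_prod G g 1 n"
  define z where "z = orbit_point ?\<omega> \<otimes>\<^bsub>G\<^esub> inv\<^bsub>G\<^esub> S"
  define t where "t = (\<lambda>j\<in>{1..m}. g (Suc j))"
  define a where "a = proj_column n u g"
  define b where "b = proj_column n (snd (fst (conj_point z ?\<omega>))) (insert_coord m (Suc m) t z)"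
  have R: "rotated_point m y = (conj_point z ?\<omega>, insert_coord m (Suc m) t z)"
    by (simp only: y rotated_point_def Let_def fst_conv snd_conv z_def t_def S_def n)
  have b_inner: "b j = a (Suc j)" if j: "j \<in> {1..m}" for j
  proof -
    have "segment_prod G t l m = segment_prod G g (Suc l) (Suc m)" if "1 \<le> l" for l
      unfolding segment_prod_shift t_def using that by (intro segment_prod_cong) auto
    then have "proj_column m u t j = a (Suc j)"
      using j by (auto simp: proj_column_def a_def n fun_eq_iff)
    then show ?thesis
      using j proj_column_conj_insert_last[of j m z ?\<omega> t] by (simp add: b_def n)
  qed
  have telescope: "(\<Sum>l=1..n. a l i) = act (inv\<^bsub>K\<^esub> u) (snd S) \<bullet> e i" for i
  proof -
    let ?s = "\<lambda>l. act (inv\<^bsub>K\<^esub> u) (snd (segment_prod G g l n)) \<bullet> e i"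
    have "(\<Sum>l=1..n. a l i) = (\<Sum>l=1..n. ?s l - ?s (Suc l))"
      by (simp add: a_def proj_column_def act_diff inner_diff_left)
    also have "\<dots> = ?s 1 - ?s (Suc n)"
      using sum_Suc_diff[of 1 n "\<lambda>l. - ?s l"] by (simp add: n)
    finally show ?thesis by (simp add: S_def)
  qed
  have b_last: "b (Suc m) i = - (\<Sum>l=1..n. a l i)" if i: "i \<in> {1..n}" for i
  proof -
    have last: "segment_prod G (insert_coord m (Suc m) t z) (Suc m) (Suc m) = z"
      by (subst segment_prod_insert_last) auto
    have "b (Suc m) i = act (inv\<^bsub>K\<^esub> u) (act (fst z) (snd z)) \<bullet> e i"
      unfolding b_def n proj_column_def last
      by (simp add: conj_point_def Let_def K.inv_mult_group act_mult)
    also have "act (inv\<^bsub>K\<^esub> u) (act (fst z) (snd z)) = act (conj_of C) (w - act (inv\<^bsub>K\<^esub> u) (snd S))"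
      by (simp add: z_def orbit_point_def mult_G inv_G act_mult act_add act_diff act_minus)
    also have "\<dots> \<bullet> e i = (w - act (inv\<^bsub>K\<^esub> u) (snd S)) \<bullet> e i"
    proof -
      have "act (conj_of C) (e i) = e i"
        using act_conj_of_fixes[of C "e i"] C e_in_A[OF i] by (simp add: y)
      then show ?thesis by (metis inner_act)
    qed
    also have "\<dots> = - (\<Sum>l=1..n. a l i)"
      using w[OF i] telescope[of i] by (simp add: y inner_diff_left)
    finally show ?thesis .
  qed
  have "det_factor (rotated_point m y) = leibniz_det n b"
    by (simp add: det_factor_def R b_def)
  also have "\<dots> = leibniz_det (Suc m) (\<lambda>j. if j = Suc m then (\<lambda>i. - (\<Sum>l=1..Suc m. a l i)) else b j)"
    unfolding n by (rule leibniz_det_cong) (use b_last in \<open>auto simp: n\<close>)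
  also have "\<dots> = (-1) ^ Suc m * leibniz_det (Suc m) a"
    by (rule leibniz_det_cycle) (use b_inner in auto)
  also have "leibniz_det (Suc m) a = det_factor y"
    by (simp add: det_factor_def a_def y n[symmetric])
  finally show ?thesis by (simp only: n)
qed

lemma cyclic_identity:
  assumes f: "\<And>j. j \<le> n \<Longrightarrow> test_function (f j)"
  shows "higher_orbital_integral K act \<mu> \<nu> A e n x (\<lambda>j. if j = 0 then f n else f (j - 1)) =
    (-1) ^ n * higher_orbital_integral K act \<mu> \<nu> A e n x f"
proof (cases n)
  case 0
  then show ?thesis
    by (simp add: higher_orbital_integral_def higher_orbital_perm_def)
next
  case (Suc m)
  let ?f = "\<lambda>j. if j = 0 then f n else f (j - 1)"
  let ?Y = "\<Omega> \<Otimes>\<^sub>M haars n"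
  let ?H = "\<lambda>y. orbit_integrand f n y * complex_of_real (det_factor y)"
  have f': "test_function (?f j)" if "j \<le> n" for j using that f by auto
  have R: "rotated_point m \<in> ?Y \<rightarrow>\<^sub>M ?Y"
    unfolding Suc by (rule rotated_point_measurable)
  have pres: "(\<integral>\<^sup>+y. F (rotated_point m y) \<partial>?Y) = (\<integral>\<^sup>+y. F y \<partial>?Y)" if "F \<in> borel_measurable ?Y" for F
    using that unfolding Suc by (rule nn_integral_rotated_point)
  note cov = change_of_variables[OF R pres integrable_orbit_integrand[OF f tame_det_factor]]
  have int: "integrable ?Y (\<lambda>y. orbit_integrand ?f n y * complex_of_real (det_factor y))"
    by (rule integrable_orbit_integrand[OF f' tame_det_factor])
  have "higher_orbital_integral K act \<mu> \<nu> A e n x ?f = (\<integral>y. orbit_integrand ?f n y * complex_of_real (det_factor y) \<partial>?Y)"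
    by (rule higher_orbital_integral_eq[OF f'])
  also have "\<dots> = (\<integral>y. (-1) ^ n * ?H (rotated_point m y) \<partial>?Y)"
  proof (rule integral_cong_AE)
    show "AE y in ?Y. orbit_integrand ?f n y * complex_of_real (det_factor y) = (-1) ^ n * ?H (rotated_point m y)"
      using AE_orbit_coordinates[of n]
    proof eventually_elim
      case (elim y)
      then have "det_factor (rotated_point m y) = (-1) ^ n * det_factor y"
        by (intro det_factor_rotate[OF Suc]) auto
      then show ?case
        by (simp add: orbit_integrand_rotate[OF Suc, symmetric])
    qed
  qed (use int integrable_mult_right[OF cov(1)] in \<open>auto intro: borel_measurable_integrable\<close>)
  also have "\<dots> = (-1) ^ n * (\<integral>y. ?H y \<partial>?Y)"
    using cov(2) by (simp only: integral_mult_right_zero)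
  also have "\<dots> = (-1) ^ n * higher_orbital_integral K act \<mu> \<nu> A e n x f"
    by (simp only: higher_orbital_integral_eq[OF f])
  finally show ?thesis .
qed

end

section \<open>The cocycle property\<close>

lemma Cc_smooth_bounds:
  fixes f :: "'k::topological_space \<times> 'v::real_inner \<Rightarrow> complex"
  assumes "f \<in> Cc_smooth \<A>"
  shows "continuous_on UNIV f" "\<exists>B. \<forall>g. norm (f g) \<le> B" "\<exists>R. \<forall>g. norm (snd g) > R \<longrightarrow> f g = 0"
proof -
  show cont: "continuous_on UNIV f"
    using assms by (simp add: Cc_smooth_def smooth_map_def)
  let ?C = "closure {g. f g \<noteq> 0}"
  have C: "compact ?C" using assms by (simp add: Cc_smooth_def)
  have out: "f g = 0" if "g \<notin> ?C" for g
    using that closure_subset[of "{g. f g \<noteq> 0}"] by auto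
  have "bounded (f ` ?C)"
    by (intro compact_imp_bounded compact_continuous_image[OF _ C] continuous_on_subset[OF cont]) auto
  then obtain B where B: "\<And>g. g \<in> ?C \<Longrightarrow> norm (f g) \<le> B" by (auto simp: bounded_iff)
  have "norm (f g) \<le> max 0 B" for g
    using B[of g] out[of g] by (cases "g \<in> ?C") auto
  then show "\<exists>B. \<forall>g. norm (f g) \<le> B" by blast
  have "bounded (snd ` ?C)"
    by (intro compact_imp_bounded compact_continuous_image[OF _ C] continuous_intros)
  then obtain R where R: "\<And>g. g \<in> ?C \<Longrightarrow> norm (snd g) \<le> R" by (auto simp: bounded_iff)
  have "f g = 0" if "norm (snd g) > R" for g
    using R[of g] that out[of g] by force
  then show "\<exists>R. \<forall>g. norm (snd g) > R \<longrightarrow> f g = 0" by blast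
qed

theorem theorem3p1p8:
  fixes K :: "'k::{t2_space,second_countable_topology} monoid"
    and \<A> :: "('k, 'm::real_normed_vector) chart set"
    and act :: "'k \<Rightarrow> 'v::{real_inner,second_countable_topology} \<Rightarrow> 'v"
    and \<mu> :: "'k measure" and \<nu> :: "'k set measure"
    and A :: "'v set" and e :: "nat \<Rightarrow> 'v" and n :: nat and x :: 'k
  assumes "compact_lie_group K \<A>"
    and "finite_dim TYPE('v)"
    and "linear_isometric_action K \<A> act"
    and "haar_measure K \<mu>"
    and "subspace A" and "dim A = n"
    and "\<forall>i\<in>{1..n}. \<forall>j\<in>{1..n}. e i \<bullet> e j = (if i = j then 1 else 0)"
    and "span (e ` {1..n}) = A"
    and "x \<in> fixing_subgroup K act A"
    and "invariant_quotient_measure K (fixing_subgroup K act A)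
           (centralizer_in K (fixing_subgroup K act A) x) \<nu>"
  shows "(\<forall>f. (\<forall>i\<le>n+1. f i \<in> Cc_smooth \<A>) \<longrightarrow>
            (\<Sum>i=0..n. (-1) ^ i *
               higher_orbital_integral K act \<mu> \<nu> A e n x (merge_at (convolution K act \<mu>) i f))
            + (-1) ^ (n+1) *
               higher_orbital_integral K act \<mu> \<nu> A e n x (f(0 := convolution K act \<mu> (f (n+1)) (f 0)))
            = 0)
       \<and> (\<forall>f. (\<forall>i\<le>n. f i \<in> Cc_smooth \<A>) \<longrightarrow>
            higher_orbital_integral K act \<mu> \<nu> A e n x (\<lambda>j. if j = 0 then f n else f (j - 1))
            = (-1) ^ n * higher_orbital_integral K act \<mu> \<nu> A e n x f)"
proof -
  interpret orbital_setting K act \<mu> \<nu> A e n x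
  proof (intro orbital_setting.intro compact_motion_group.intro orbital_setting_axioms.intro)
    have lie: "lie_group K \<A>" and compact: "compact (UNIV :: 'k set)"
      using assms(1) by (auto simp: compact_lie_group_def)
    show "group K" "carrier K = UNIV" "continuous_on UNIV (\<lambda>(k, l). k \<otimes>\<^bsub>K\<^esub> l)" "continuous_on UNIV (\<lambda>k. inv\<^bsub>K\<^esub> k)"
      using lie by (auto simp: lie_group_def smooth_map_def)
    show "\<And>v. act \<one>\<^bsub>K\<^esub> v = v" "\<And>k l v. act (k \<otimes>\<^bsub>K\<^esub> l) v = act k (act l v)" "\<And>k. linear (act k)"
      "\<And>k v. norm (act k v) = norm v" "continuous_on UNIV (\<lambda>(k, v). act k v)"
      using assms(3) by (auto simp: linear_isometric_action_def smooth_map_def)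
    show "finite_dim TYPE('v)" by fact
    show "sets \<mu> = sets borel" "emeasure \<mu> UNIV \<noteq> 0"
      using assms(4) unfolding haar_measure_def by blast+
    have "emeasure \<mu> UNIV < \<infinity>"
      using assms(4) compact unfolding haar_measure_def by blast
    then show "emeasure \<mu> UNIV \<noteq> \<infinity>" by simp
    show "\<And>B k. B \<in> sets borel \<Longrightarrow> emeasure \<mu> ((\<lambda>l. k \<otimes>\<^bsub>K\<^esub> l) ` B) = emeasure \<mu> B"
      using assms(4) unfolding haar_measure_def by blast
    show "e i \<in> A" if "i \<in> {1..n}" for i
      using span_base[OF imageI[OF that, of e]] unfolding assms(8) .
    show "x \<in> fixing_subgroup K act A" by fact
    show "sets \<nu> = sets (quotient_borel K (fixing_subgroup K act A) (centralizer_in K (fixing_subgroup K act A) x))"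
      "emeasure \<nu> (space \<nu>) \<noteq> \<infinity>"
      using assms(10) by (auto simp: invariant_quotient_measure_def)
  qed
  have test_function: "test_function f" if "f \<in> Cc_smooth \<A>" for f
    unfolding test_function_def using Cc_smooth_bounds[OF that] borel_measurable_continuous_onI by blast
  show ?thesis
  proof (intro conjI allI impI)
    fix f :: "nat \<Rightarrow> 'k \<times> 'v \<Rightarrow> complex" assume "\<forall>i\<le>n + 1. f i \<in> Cc_smooth \<A>"
    then show "(\<Sum>i=0..n. (-1) ^ i *
               higher_orbital_integral K act \<mu> \<nu> A e n x (merge_at (convolution K act \<mu>) i f))
            + (-1) ^ (n+1) *
               higher_orbital_integral K act \<mu> \<nu> A e n x (f(0 := convolution K act \<mu> (f (n+1)) (f 0)))
            = 0"
      using hochschild_identity[of f] test_function unfolding Suc_eq_plus1 by blast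
  next
    fix f :: "nat \<Rightarrow> 'k \<times> 'v \<Rightarrow> complex" assume "\<forall>i\<le>n. f i \<in> Cc_smooth \<A>"
    then show "higher_orbital_integral K act \<mu> \<nu> A e n x (\<lambda>j. if j = 0 then f n else f (j - 1))
            = (-1) ^ n * higher_orbital_integral K act \<mu> \<nu> A e n x f"
      using cyclic_identity[of f] test_function by blast
  qed
qed

end
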